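(* Let $\varrho$ be a primitive substitution on a compact Hausdorff alphabet $\mathcal{A}$, with substitution operator $M$ of spectral radius $r$, normalised operator $T=\frac1r M$, and subshift $X$. Consider the following conditions: (1) $T$ is quasi-compact; (2) $T$ is uniformly power convergent; (3) $T$ is strongly power convergent; (4) $T$ is mean ergodic; (5) $\varrho$ admits a natural length function; (6) there exist $\alpha,\beta>0$ such that for all $n\in\mathbb{N}$ and $a\in\mathcal{A}$ we have $\alpha r^n\le\#\varrho^n(a)\le\beta r^n$; (7) $\displaystyle\inf_{n\in\mathbb{N}}\frac{\min_{a\in\mathcal{A}}\#\varrho^n(a)}{\max_{b\in\mathcal{A}}\#\varrho^n(b)}>0$. Then each condition implies the next one: (1)$\Rightarrow$(2)$\Rightarrow\cdots\Rightarrow$(7). Suppose, additionally, that $\mathcal{A}$ contains an isolated point or, more generally, that there exist some $p\in\mathcal{A}$ and $n\in\mathbb{N}$ such that $p\triangleleft\varrho^n(a)$ for all $a\in\mathcal{A}$. Then (7) implies (1), so (1)–(7) are equivalent, and each of them implies that $X$ is uniquely ergodic.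
   Context: Alphabet and words: $\mathcal{A}$ is a non-empty compact Hausdorff space; $\mathcal{A}^\ast = \bigsqcup_{i\ge 0}\mathcal{A}^i$ is the space of finite words (each $\mathcal{A}^i$ has the product topology, $\mathcal{A}^\ast$ the disjoint union topology, $\mathcal{A}^0=\{\varepsilon\}$). $\#u$ is the length of a word $u$; $v\triangleleft u$ means that $v$ is a (contiguous) subword of the finite or bi-infinite word $u$. $\mathbb{N}=\{1,2,\dots\}$. Substitutions: a substitution is a continuous map $\varrho\colon\mathcal{A}\to\mathcal{A}^\ast$, extended to $\mathcal{A}^\ast\to\mathcal{A}^\ast$ by concatenation. Standing assumption: $\varrho$ generates arbitrarily long words, i.e. for every $k\in\mathbb{N}$ there are $n\in\mathbb{N}$ and $a\in\mathcal{A}$ with $\#\varrho^n(a)\ge k$. $\varrho$ is primitive if for every non-empty open $U\subseteq\mathcal{A}$ there is $n=n_U$ such that for all $a\in\mathcal{A}$ the word $\varrho^n(a)$ contains a letter in $U$. Subshift: $\mathcal{L}(\varrho)$ is the closure in $\mathcal{A}^\ast$ of the set of words $u$ with $u\triangleleft\varrho^n(a)$ for some $n\in\mathbb{N}_0$, $a\in\mathcal{A}$. $X=\{w\in\mathcal{A}^{\mathbb{Z}} : \text{every finite } u\triangleleft w \text{ lies in } \mathcal{L}(\varrho)\}$ (subspace of the product topology), with left shift $\sigma$. A measure on $X$ is a positive continuous linear functional $\mu$ on $C(X)$ (real continuous functions, sup norm); it is a probability measure if $\mu(\mathbf{1})=1$ and $\sigma$-invariant if $\mu(f\circ\sigma)=\mu(f)$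 for all $f$. $X$ is uniquely ergodic if it has exactly one $\sigma$-invariant probability measure. Operators: $E=C(\mathcal{A})$ (real continuous functions, sup norm), $K=\{f\in E: f\ge 0\}$. The substitution operator is $(Mf)(a)=\sum_{b\triangleleft\varrho(a)}f(b)$ (sum over letters of $\varrho(a)$ with multiplicity). A natural length function is a non-zero $\ell\in K$ with $M\ell=\lambda\ell$ for some $\lambda\ge0$. For a bounded operator $S$ on $E$, $\|S\|_{\mathrm{ess}}=\inf\{\|S-V\|: V \text{ compact}\}$ and $r_{\mathrm{ess}}(S)=\lim_n\|S^n\|_{\mathrm{ess}}^{1/n}$; $S$ is quasi-compact if $r_{\mathrm{ess}}(S)<r(S)$ (for $T$: $r_{\mathrm{ess}}(T)<1$). $T$ is uniformly power convergent if $T^n$ converges in operator norm, strongly power convergent if $T^nf$ converges in $E$ for every $f\in E$, and mean ergodic if $\frac1n\sum_{j=0}^{n-1}T^jf$ converges in $E$ for every $f\in E$. *)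

theory Defs
  imports "HOL-Analysis.Analysis" "HOL-Library.Sublist"
begin

section \<open>Words\<close>

text \<open>The disjoint union over all lengths \<open>n\<close> of the product topologies: a set of words is open
  iff, for every \<open>n\<close>, its words of length \<open>n\<close> form an open set of the \<open>n\<close>-fold product.
  A word of length \<open>n\<close> is identified with the function on \<open>{..<n}\<close> listing its letters.\<close>

definition open_words :: "'a::topological_space list set \<Rightarrow> bool" where
  "open_words W \<longleftrightarrow> (\<forall>n. openin (product_topology (\<lambda>_. euclidean) {..<n})
      {x \<in> {..<n} \<rightarrow>\<^sub>E (UNIV :: 'a set). map x [0..<n] \<in> W})"

definition word_topology :: "'a::topological_space list topology" where
  "word_topology = topology open_words"

lemma istopology_open_words: "istopology (open_words :: 'a::topological_space list set \<Rightarrow> bool)"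
  unfolding istopology_def
proof (intro conjI allI impI)
  fix S T :: "'a list set"
  assume "open_words S" "open_words T"
  then have "openin (product_topology (\<lambda>_. euclidean) {..<n})
      ({x \<in> {..<n} \<rightarrow>\<^sub>E UNIV. map x [0..<n] \<in> S} \<inter> {x \<in> {..<n} \<rightarrow>\<^sub>E UNIV. map x [0..<n] \<in> T})" for n
    by (auto simp: open_words_def)
  moreover have "{x \<in> {..<n} \<rightarrow>\<^sub>E UNIV. map x [0..<n] \<in> S \<inter> T} =
      {x \<in> {..<n} \<rightarrow>\<^sub>E UNIV. map x [0..<n] \<in> S} \<inter> {x \<in> {..<n} \<rightarrow>\<^sub>E UNIV. map x [0..<n] \<in> T}" for n
    by auto
  ultimately show "open_words (S \<inter> T)"
    by (simp add: open_words_def)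
next
  fix \<K> :: "'a list set set"
  assume "\<forall>K\<in>\<K>. open_words K"
  then have "openin (product_topology (\<lambda>_. euclidean) {..<n})
      (\<Union>K\<in>\<K>. {x \<in> {..<n} \<rightarrow>\<^sub>E UNIV. map x [0..<n] \<in> K})" for n
    by (auto simp: open_words_def)
  moreover have "{x \<in> {..<n} \<rightarrow>\<^sub>E UNIV. map x [0..<n] \<in> \<Union>\<K>} =
      (\<Union>K\<in>\<K>. {x \<in> {..<n} \<rightarrow>\<^sub>E UNIV. map x [0..<n] \<in> K})" for n
    by auto
  ultimately show "open_words (\<Union>\<K>)"
    by (simp add: open_words_def)
qed

lemma openin_word_topology: "openin word_topology W \<longleftrightarrow> open_words W"
  by (simp add: word_topology_def istopology_open_words topology_inverse')

lemma topspace_word_topology [simp]: "topspace word_topology = UNIV"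
proof -
  have "open_words (UNIV :: 'a list set)"
    unfolding open_words_def
  proof
    fix n :: nat
    have "openin (product_topology (\<lambda>_. euclidean) {..<n}) ({..<n} \<rightarrow>\<^sub>E (UNIV :: 'a set))"
      using openin_topspace[of "product_topology (\<lambda>_. euclidean :: 'a topology) {..<n}"] by simp
    then show "openin (product_topology (\<lambda>_. euclidean) {..<n})
        {x \<in> {..<n} \<rightarrow>\<^sub>E (UNIV :: 'a set). map x [0..<n] \<in> UNIV}"
      by (simp del: topspace_product_topology)
  qed
  then have "UNIV \<subseteq> topspace (word_topology :: 'a list topology)"
    by (intro openin_subset) (simp add: openin_word_topology)
  then show ?thesis
    by blast
qed

section \<open>Substitutions and their subshifts\<close>

definition subst_word :: "('a \<Rightarrow> 'a list) \<Rightarrow> 'a list \<Rightarrow> 'a list" where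
  "subst_word \<rho> w = concat (map \<rho> w)"

definition subst_power :: "('a \<Rightarrow> 'a list) \<Rightarrow> nat \<Rightarrow> 'a \<Rightarrow> 'a list" where
  "subst_power \<rho> n a = (subst_word \<rho> ^^ n) [a]"

definition substitution :: "('a::topological_space \<Rightarrow> 'a list) \<Rightarrow> bool" where
  "substitution \<rho> \<longleftrightarrow> continuous_map euclidean word_topology \<rho> \<and>
     (\<forall>k\<ge>1. \<exists>n\<ge>1. \<exists>a. length (subst_power \<rho> n a) \<ge> k)"

definition primitive :: "('a::topological_space \<Rightarrow> 'a list) \<Rightarrow> bool" where
  "primitive \<rho> \<longleftrightarrow> (\<forall>U. open U \<and> U \<noteq> {} \<longrightarrow>
     (\<exists>n\<ge>1. \<forall>a. set (subst_power \<rho> n a) \<inter> U \<noteq> {}))"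

definition language :: "('a::topological_space \<Rightarrow> 'a list) \<Rightarrow> 'a list set" where
  "language \<rho> = word_topology closure_of {u. \<exists>n a. sublist u (subst_power \<rho> n a)}"

definition subshift :: "('a::topological_space \<Rightarrow> 'a list) \<Rightarrow> (int \<Rightarrow> 'a) set" where
  "subshift \<rho> = {w. \<forall>i n. map (\<lambda>k. w (i + int k)) [0..<n] \<in> language \<rho>}"

definition left_shift :: "(int \<Rightarrow> 'a) \<Rightarrow> int \<Rightarrow> 'a" where
  "left_shift w = (\<lambda>i. w (i + 1))"

section \<open>Unique ergodicity\<close>

text \<open>\<open>C(X)\<close> with the metric of the sup norm. Its elements are extensional, i.e. \<open>undefined\<close>
  outside \<open>X\<close>, so that equality in \<open>C(X)\<close> is equality of functions on \<open>X\<close>.\<close>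

abbreviation CX :: "'b::topological_space set \<Rightarrow> ('b \<Rightarrow> real) metric" where
  "CX X \<equiv> cfunspace (top_of_set X) euclidean_metric"

text \<open>Functionals are likewise extensional on \<open>C(X)\<close>, so that uniqueness of a functional is
  meaningful.\<close>

definition measure_on :: "'b::topological_space set \<Rightarrow> (('b \<Rightarrow> real) \<Rightarrow> real) \<Rightarrow> bool" where
  "measure_on X \<mu> \<longleftrightarrow> \<mu> \<in> extensional (mspace (CX X)) \<and>
     (\<forall>f\<in>mspace (CX X). \<forall>g\<in>mspace (CX X). \<mu> (\<lambda>x\<in>X. f x + g x) = \<mu> f + \<mu> g) \<and>
     (\<forall>c. \<forall>f\<in>mspace (CX X). \<mu> (\<lambda>x\<in>X. c * f x) = c * \<mu> f) \<and>
     continuous_map (mtopology_of (CX X)) euclidean \<mu> \<and>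
     (\<forall>f\<in>mspace (CX X). (\<forall>x\<in>X. f x \<ge> 0) \<longrightarrow> \<mu> f \<ge> 0)"

definition invariant_probability ::
  "(int \<Rightarrow> 'a::topological_space) set \<Rightarrow> (((int \<Rightarrow> 'a) \<Rightarrow> real) \<Rightarrow> real) \<Rightarrow> bool" where
  "invariant_probability X \<mu> \<longleftrightarrow> measure_on X \<mu> \<and> \<mu> (\<lambda>x\<in>X. 1) = 1 \<and>
     (\<forall>f\<in>mspace (CX X). \<mu> (\<lambda>x\<in>X. f (left_shift x)) = \<mu> f)"

definition uniquely_ergodic :: "(int \<Rightarrow> 'a::topological_space) set \<Rightarrow> bool" where
  "uniquely_ergodic X \<longleftrightarrow> (\<exists>!\<mu>. invariant_probability X \<mu>)"

section \<open>Bounded operators\<close>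

definition op_power :: "('e::real_normed_vector \<Rightarrow>\<^sub>L 'e) \<Rightarrow> nat \<Rightarrow> ('e \<Rightarrow>\<^sub>L 'e)" where
  "op_power S n = ((\<lambda>V. S o\<^sub>L V) ^^ n) id_blinfun"

text \<open>The map \<open>z I - S\<close> on the complexification \<open>{x + i y | x y}\<close> of the real space, with
  \<open>x + i y\<close> represented by \<open>(x, y)\<close>; the product norm is equivalent to every norm usually put on
  the complexification. The spectrum of an operator on a real space is, as usual, that of its
  complexification.\<close>

definition complex_shifted :: "('e::real_normed_vector \<Rightarrow>\<^sub>L 'e) \<Rightarrow> complex \<Rightarrow> 'e \<times> 'e \<Rightarrow> 'e \<times> 'e" where
  "complex_shifted S z = (\<lambda>(x, y).
     (Re z *\<^sub>R x - Im z *\<^sub>R y - blinfun_apply S x, Im z *\<^sub>R x + Re z *\<^sub>R y - blinfun_apply S y))"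

definition spectrum :: "('e::real_normed_vector \<Rightarrow>\<^sub>L 'e) \<Rightarrow> complex set" where
  "spectrum S = {z. \<not> (\<exists>R. bounded_linear R \<and>
     R \<circ> complex_shifted S z = id \<and> complex_shifted S z \<circ> R = id)}"

definition spectral_radius :: "('e::real_normed_vector \<Rightarrow>\<^sub>L 'e) \<Rightarrow> real" where
  "spectral_radius S = Sup (cmod ` spectrum S)"

definition compact_operator :: "('e::real_normed_vector \<Rightarrow>\<^sub>L 'f::real_normed_vector) \<Rightarrow> bool" where
  "compact_operator V \<longleftrightarrow> compact (closure (blinfun_apply V ` cball 0 1))"

definition ess_norm :: "('e::real_normed_vector \<Rightarrow>\<^sub>L 'e) \<Rightarrow> real" where
  "ess_norm S = (INF V\<in>{V. compact_operator V}. norm (S - V))"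

definition ess_spectral_radius :: "('e::real_normed_vector \<Rightarrow>\<^sub>L 'e) \<Rightarrow> real" where
  "ess_spectral_radius S = lim (\<lambda>n. root n (ess_norm (op_power S n)))"

definition quasi_compact :: "('e::real_normed_vector \<Rightarrow>\<^sub>L 'e) \<Rightarrow> bool" where
  "quasi_compact S \<longleftrightarrow> ess_spectral_radius S < spectral_radius S"

definition uniformly_power_convergent :: "('e::real_normed_vector \<Rightarrow>\<^sub>L 'e) \<Rightarrow> bool" where
  "uniformly_power_convergent S \<longleftrightarrow> convergent (\<lambda>n. op_power S n)"

definition strongly_power_convergent :: "('e::real_normed_vector \<Rightarrow>\<^sub>L 'e) \<Rightarrow> bool" where
  "strongly_power_convergent S \<longleftrightarrow> (\<forall>f. convergent (\<lambda>n. blinfun_apply (op_power S n) f))"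

definition mean_ergodic :: "('e::real_normed_vector \<Rightarrow>\<^sub>L 'e) \<Rightarrow> bool" where
  "mean_ergodic S \<longleftrightarrow>
     (\<forall>f. convergent (\<lambda>n. (1 / real n) *\<^sub>R (\<Sum>j<n. blinfun_apply (op_power S j) f)))"

section \<open>The substitution operator\<close>

text \<open>On a compact alphabet, \<open>'a \<Rightarrow>\<^sub>C real\<close> is the space of all continuous functions. The
  conversions \<open>Bcontfun\<close> and \<open>Blinfun\<close> are then justified by the two lemmas below.\<close>

definition subst_operator ::
  "('a::topological_space \<Rightarrow> 'a list) \<Rightarrow> ('a \<Rightarrow>\<^sub>C real) \<Rightarrow>\<^sub>L ('a \<Rightarrow>\<^sub>C real)" where
  "subst_operator \<rho> = Blinfun (\<lambda>f. Bcontfun (\<lambda>a. \<Sum>b\<leftarrow>\<rho> a. apply_bcontfun f b))"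

definition normalised_operator ::
  "('a::topological_space \<Rightarrow> 'a list) \<Rightarrow> ('a \<Rightarrow>\<^sub>C real) \<Rightarrow>\<^sub>L ('a \<Rightarrow>\<^sub>C real)" where
  "normalised_operator \<rho> = (1 / spectral_radius (subst_operator \<rho>)) *\<^sub>R subst_operator \<rho>"

definition natural_length_function ::
  "('a::topological_space \<Rightarrow> 'a list) \<Rightarrow> ('a \<Rightarrow>\<^sub>C real) \<Rightarrow> bool" where
  "natural_length_function \<rho> l \<longleftrightarrow> l \<noteq> 0 \<and> (\<forall>a. apply_bcontfun l a \<ge> 0) \<and>
     (\<exists>c\<ge>0. blinfun_apply (subst_operator \<rho>) l = c *\<^sub>R l)"

lemma continuous_map_sum_letters:
  fixes f :: "'a::topological_space \<Rightarrow> real"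
  assumes f: "continuous_on UNIV f"
  shows "continuous_map word_topology euclidean (\<lambda>w. \<Sum>b\<leftarrow>w. f b)"
  unfolding continuous_map_def openin_word_topology open_words_def
proof (intro conjI allI impI)
  fix U :: "real set" and n :: nat
  assume U: "openin euclidean U"
  have "continuous_map (product_topology (\<lambda>_. euclidean) {..<n}) euclidean (\<lambda>x. \<Sum>i<n. f (x i))"
  proof (intro continuous_map_sum)
    fix i assume i: "i \<in> {..<n}"
    have "continuous_map (product_topology (\<lambda>_. euclidean) {..<n}) euclidean (\<lambda>x. x i)"
      using i by (rule continuous_map_product_projection)
    moreover have "continuous_map euclidean euclidean f"
      using f by simp
    ultimately show "continuous_map (product_topology (\<lambda>_. euclidean) {..<n}) euclidean (\<lambda>x. f (x i))"
      using continuous_map_compose[unfolded comp_def] by blast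
  qed simp
  then have "openin (product_topology (\<lambda>_. euclidean) {..<n})
      {x \<in> topspace (product_topology (\<lambda>_. euclidean) {..<n}). (\<Sum>i<n. f (x i)) \<in> U}"
    using U by (rule openin_continuous_map_preimage)
  moreover have "(\<Sum>b\<leftarrow>map x [0..<n]. f b) = (\<Sum>i<n. f (x i))" for x
    by (simp add: interv_sum_list_conv_sum_set_nat lessThan_atLeast0 comp_def)
  ultimately show "openin (product_topology (\<lambda>_. euclidean) {..<n})
      {x \<in> {..<n} \<rightarrow>\<^sub>E UNIV. map x [0..<n] \<in> {w \<in> topspace word_topology. (\<Sum>b\<leftarrow>w. f b) \<in> U}}"
    by simp
qed auto

lemma continuous_subst_sum:
  fixes \<rho> :: "'a::topological_space \<Rightarrow> 'a list" and f :: "'a \<Rightarrow> real"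
  assumes "substitution \<rho>" "continuous_on UNIV f"
  shows "continuous_on UNIV (\<lambda>a. \<Sum>b\<leftarrow>\<rho> a. f b)"
  using continuous_map_compose[OF _ continuous_map_sum_letters[OF assms(2)], of euclidean \<rho>] assms(1)
  by (simp add: substitution_def comp_def)

lemma subst_operator_apply:
  fixes \<rho> :: "'a::topological_space \<Rightarrow> 'a list"
  assumes K: "compact (UNIV :: 'a set)" and \<rho>: "substitution \<rho>"
  shows "apply_bcontfun (blinfun_apply (subst_operator \<rho>) f) a = (\<Sum>b\<leftarrow>\<rho> a. apply_bcontfun f b)"
proof -
  have bc: "g \<in> bcontfun" if "continuous_on UNIV g" for g :: "'a \<Rightarrow> real"
    using that K compact_continuous_image compact_imp_bounded by (auto simp: bcontfun_def)
  define N where "N = (\<lambda>f :: 'a \<Rightarrow>\<^sub>C real. Bcontfun (\<lambda>a. \<Sum>b\<leftarrow>\<rho> a. apply_bcontfun f b))"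
  have M: "apply_bcontfun (N f) a = (\<Sum>b\<leftarrow>\<rho> a. apply_bcontfun f b)" for f :: "'a \<Rightarrow>\<^sub>C real" and a
    using bc[OF continuous_subst_sum[OF \<rho> continuous_on_apply_bcontfun[of _ f]]]
    by (simp add: N_def Bcontfun_inverse)
  have cont1: "continuous_on UNIV (\<lambda>a. \<Sum>b\<leftarrow>\<rho> a. (1::real))"
    by (intro continuous_subst_sum \<rho> continuous_intros)
  then obtain B where B: "\<And>a. norm (\<Sum>b\<leftarrow>\<rho> a. (1::real)) \<le> B"
    using bc[OF cont1] unfolding bcontfun_def bounded_iff by auto
  have "bounded_linear N"
  proof (rule bounded_linear_intro[where K = B])
    show "N (f + g) = N f + N g" for f g
      by (rule bcontfun_eqI) (simp add: M sum_list_addf)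
    show "N (c *\<^sub>R f) = c *\<^sub>R N f" for c f
      by (rule bcontfun_eqI) (simp add: M sum_list_const_mult)
    show "norm (N f) \<le> norm f * B" for f
    proof (rule norm_bound)
      fix a
      have "norm (\<Sum>b\<leftarrow>w. apply_bcontfun f b) \<le> norm f * (\<Sum>b\<leftarrow>w. 1)" for w
      proof (induction w)
        case (Cons b w)
        then show ?case
          using norm_bounded[of f b] by (simp add: algebra_simps)
      qed simp
      also have "norm f * (\<Sum>b\<leftarrow>\<rho> a. 1) \<le> norm f * B"
        using B[of a] by (intro mult_left_mono) auto
      finally show "norm (apply_bcontfun (N f) a) \<le> norm f * B"
        by (simp add: M)
    qed
  qed
  then show ?thesis
    by (simp add: subst_operator_def bounded_linear_Blinfun_apply M flip: N_def)
qed

end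

theory Submission
  imports Defs
begin

text \<open>For a positive operator whose powers grow at rate \<open>s\<close>, the resolvent at \<open>\<lambda> > s\<close> maps the
  constant \<open>1\<close> to a function of norm at least \<open>1/(\<lambda> - s)\<close>. This yields positive approximate
  eigenvectors for \<open>s\<close>, which put \<open>s\<close> into the spectrum; for a quasi-compact \<open>T\<close> (where \<open>s = 1\<close>)
  they converge along a subsequence to a fixed function \<open>l\<close>.
  Primitivity makes \<open>l\<close> strictly positive, so the powers of \<open>T\<close> are bounded, and it forces every
  limit point of an orbit to be a multiple of \<open>l\<close>; no description of the peripheral spectrum is
  needed. Quasi-compactness makes orbits relatively compact and turns strong into uniform
  convergence. Conversely, a letter \<open>p\<close> occurring in every \<open>\<rho>\<^sup>N(a)\<close> bounds \<open>T\<^sup>N\<close> from below by a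
  multiple of the rank-one operator \<open>f \<mapsto> f(p) 1\<close>, and two-sided length bounds make the remainder
  contract. For unique ergodicity, the sums of a local function over the words \<open>\<rho>\<^sup>n(a)\<close> are
  asymptotic to \<open>T\<close>-orbits up to boundary terms, so all Birkhoff averages converge uniformly to
  constants, and their limits define the only invariant probability measure.\<close>

text \<open>The radius \<open>r\<close> is defined through the complexified spectrum, while the
  conditions speak about powers of \<open>M\<close>. The bridge is Gelfand's infimum of the n-th
  roots of the norms: Neumann series keep the spectrum inside that disc, and positivity puts its
  radius into the spectrum. Primitivity forbids empty images, so lengths never shrink and
  \<open>r \<ge> 1\<close>. The obstacle is that balls of C(A) are not compact in general:
  eigenfunctions are at first only approximate, and (4) yields (5) by testing the averages against
  these approximate eigenvectors. The common letter serves the step from (6) to (1); (7) leads back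
  to (6) in general, because \<open>r ^ n\<close> lies between the smallest and the largest length
  at level \<open>n\<close>. An isolated point gives a common letter by primitivity for the open set
  \<open>{p}\<close>. That words become arbitrarily long enters as \<open>r > 1\<close>, which makes
  the boundary terms of the ergodic part vanish.\<close>

section \<open>Submultiplicative sequences and the essential spectral radius\<close>

lemma submultiplicative_bound:
  fixes u :: "nat \<Rightarrow> real"
  assumes nn: "\<And>n. 0 \<le> u n" and sub: "\<And>m n. u (m + n) \<le> u m * u n"
    and m: "m \<ge> 1" and q: "u m \<le> q ^ m" "0 < q"
  shows "\<exists>C>0. \<forall>n. u n \<le> C * q ^ n"
proof -
  \<comment> \<open>Every \<open>n\<close> is \<open>m * k + j\<close> with \<open>j < m\<close>:
    each of the \<open>k\<close> factors \<open>u m\<close> costs \<open>q ^ m\<close>, and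
    \<open>C\<close> absorbs the finitely many remainders. The summand 1 keeps \<open>C\<close>
    positive even if all of these vanish.\<close>
  define C where "C = 1 + (\<Sum>j<m. u j / q ^ j)"
  have C: "C > 0"
    unfolding C_def using nn q by (intro add_pos_nonneg sum_nonneg) auto
  have pw: "u (m * k + j) \<le> (q ^ m) ^ k * u j" for k j
  proof (induction k)
    case (Suc k)
    have "u (m * Suc k + j) \<le> u m * u (m * k + j)"
      using sub[of m "m * k + j"] by (simp add: algebra_simps)
    also have "\<dots> \<le> q ^ m * ((q ^ m) ^ k * u j)"
      using Suc nn q by (intro mult_mono) auto
    finally show ?case by (simp add: mult_ac)
  qed simp
  have "u n \<le> C * q ^ n" for n
  proof -
    define k j where "k = n div m" and "j = n mod m"
    have n: "n = m * k + j" and j: "j < m"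
      using m by (auto simp: k_def j_def)
    have "u n \<le> q ^ n * (u j / q ^ j)"
      using pw[of k j] q by (simp add: n power_add power_mult)
    also have "u j / q ^ j \<le> (\<Sum>j<m. u j / q ^ j)"
      using j nn q by (intro member_le_sum) auto
    also have "\<dots> \<le> C" by (simp add: C_def)
    finally show ?thesis
      using q by (simp add: mult_ac)
  qed
  with C show ?thesis by blast
qed

text \<open>Fekete's lemma. Once a single root falls below \<open>q\<close>, the whole sequence is
  at most a constant times \<open>q ^ n\<close>, and the n-th root of the constant tends to 1. The
  infimum starts at 1 because \<open>root 0\<close> is constantly 0.\<close>

lemma submultiplicative_root_limit:
  fixes u :: "nat \<Rightarrow> real"
  assumes nn: "\<And>n. 0 \<le> u n" and sub: "\<And>m n. u (m + n) \<le> u m * u n"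
  shows "(\<lambda>n. root n (u n)) \<longlonglongrightarrow> (INF n\<in>{1..}. root n (u n))"
proof (rule order_tendstoI)
  let ?L = "INF n\<in>{1..}. root n (u n)"
  have bdd: "bdd_below ((\<lambda>n. root n (u n)) ` {1..})"
    by (rule bdd_belowI[of _ 0]) (auto simp: nn real_root_ge_zero)
  show "eventually (\<lambda>n. a < root n (u n)) sequentially" if "a < ?L" for a
  proof (rule eventually_sequentiallyI[of 1])
    show "a < root n (u n)" if "1 \<le> n" for n
      using cINF_lower[OF bdd, of n] that \<open>a < ?L\<close> by auto
  qed
  show "eventually (\<lambda>n. root n (u n) < a) sequentially" if La: "?L < a" for a
  proof -
    obtain q where q: "?L < q" "q < a"
      using dense[OF La] by blast
    obtain m where m: "m \<ge> 1" "root m (u m) < q"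
      using q(1) cINF_less_iff[OF _ bdd, of q] by auto
    have q0: "q > 0"
      using m(2) real_root_ge_zero[OF nn[of m], of m] by linarith
    have "u m = root m (u m) ^ m"
      using m(1) nn by simp
    also have "\<dots> \<le> q ^ m"
      using m nn by (intro power_mono) (auto simp: real_root_ge_zero)
    finally have "u m \<le> q ^ m" .
    then have "\<exists>C>0. \<forall>n. u n \<le> C * q ^ n"
      by (intro submultiplicative_bound[OF nn sub m(1)] q0)
    then obtain C where C: "C > 0" "\<And>n. u n \<le> C * q ^ n"
      by blast
    have "(\<lambda>n. root n C * q) \<longlonglongrightarrow> 1 * q"
      by (rule tendsto_mult[OF LIMSEQ_root_const[OF C(1)] tendsto_const])
    then have "eventually (\<lambda>n. root n C * q < a) sequentially"
      using q by (intro order_tendstoD(2)[where y = "1 * q"]) simp_all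
    then show ?thesis
      using eventually_ge_at_top[of 1]
    proof eventually_elim
      case (elim n)
      have "root n (u n) \<le> root n (C * q ^ n)"
        using elim C by simp
      also have "\<dots> = root n C * q"
        using elim q0 by (simp add: real_root_mult real_root_pos2)
      finally show ?case using elim by simp
    qed
  qed
qed

text \<open>Comparison of exponential rates, insensitive to constants; it turns growth bounds of
  powers into inequalities between radii.\<close>

lemma power_le_const_mult_power_imp_le:
  fixes x y :: real
  assumes "0 < y" and "\<And>n. x ^ n \<le> C * y ^ n"
  shows "x \<le> y"
proof (rule ccontr)
  assume "\<not> x \<le> y"
  then have "1 < x / y" using assms(1) by simp
  then obtain n where "C < (x / y) ^ n"
    using real_arch_pow by blast
  then have "C * y ^ n < x ^ n"
    using assms(1) by (simp add: power_divide pos_less_divide_eq)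
  with assms(2)[of n] show False by simp
qed

section \<open>Compact operators and the essential norm\<close>

lemma compact_operatorI:
  assumes "compact K" "blinfun_apply V ` cball 0 1 \<subseteq> K"
  shows "compact_operator V"
proof -
  have "closure (blinfun_apply V ` cball 0 1) \<subseteq> K"
    using assms by (intro closure_minimal compact_imp_closed)
  then have "closure (blinfun_apply V ` cball 0 1) = K \<inter> closure (blinfun_apply V ` cball 0 1)"
    by blast
  then show ?thesis
    unfolding compact_operator_def
    using compact_Int_closed[OF assms(1) closed_closure, of "blinfun_apply V ` cball 0 1"] by argo
qed

lemma compact_operator_cball:
  assumes "compact_operator V" "0 < B"
  obtains K where "compact K" "blinfun_apply V ` cball 0 B \<subseteq> K"
proof
  show "compact ((*\<^sub>R) B ` closure (blinfun_apply V ` cball 0 1))"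
    using assms(1) unfolding compact_operator_def by (rule compact_scaling)
  show "blinfun_apply V ` cball 0 B \<subseteq> (*\<^sub>R) B ` closure (blinfun_apply V ` cball 0 1)"
  proof (rule image_subsetI)
    fix f :: 'a assume f: "f \<in> cball 0 B"
    have "V f = B *\<^sub>R V (f /\<^sub>R B)"
      using assms(2) by (simp add: blinfun.scaleR_right)
    moreover have "f /\<^sub>R B \<in> cball 0 1"
      using f assms(2) by (simp add: field_simps)
    ultimately show "V f \<in> (*\<^sub>R) B ` closure (blinfun_apply V ` cball 0 1)"
      using closure_subset by blast
  qed
qed

lemma compact_operator_zero [simp]: "compact_operator 0"
  by (rule compact_operatorI[of "{0}"]) auto

lemma compact_operator_add:
  assumes "compact_operator V" "compact_operator W"
  shows "compact_operator (V + W)"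
proof -
  obtain K where K: "compact K" "blinfun_apply V ` cball 0 1 \<subseteq> K"
    using compact_operator_cball[OF assms(1), of 1] by auto
  obtain L where L: "compact L" "blinfun_apply W ` cball 0 1 \<subseteq> L"
    using compact_operator_cball[OF assms(2), of 1] by auto
  have "blinfun_apply (V + W) ` cball 0 1 \<subseteq> {x + y |x y. x \<in> K \<and> y \<in> L}"
  proof (rule image_subsetI)
    fix f :: 'a assume "f \<in> cball 0 1"
    then have "V f \<in> K" "W f \<in> L" using K L by blast+
    then show "(V + W) f \<in> {x + y |x y. x \<in> K \<and> y \<in> L}"
      by (auto simp: blinfun.add_left)
  qed
  then show ?thesis
    by (rule compact_operatorI[OF compact_sums[OF K(1) L(1)]])
qed

lemma compact_operator_compose_left:
  assumes "compact_operator V"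
  shows "compact_operator (S o\<^sub>L V)"
proof -
  obtain K where K: "compact K" "blinfun_apply V ` cball 0 1 \<subseteq> K"
    using compact_operator_cball[OF assms, of 1] by auto
  have "compact (blinfun_apply S ` K)"
    by (intro compact_continuous_image K(1) linear_continuous_on blinfun.bounded_linear_right)
  then show ?thesis
    by (rule compact_operatorI) (use K in auto)
qed

lemma compact_operator_compose_right:
  assumes "compact_operator V"
  shows "compact_operator (V o\<^sub>L S)"
proof -
  obtain K where K: "compact K" "blinfun_apply V ` cball 0 (norm S + 1) \<subseteq> K"
    using compact_operator_cball[OF assms add_nonneg_pos[OF norm_ge_zero zero_less_one]] by blast
  have "norm (S f) \<le> norm S + 1" if "norm f \<le> 1" for f
    using norm_blinfun[of S f] mult_left_mono[OF that norm_ge_zero[of S]] by simp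
  then have "blinfun_apply (V o\<^sub>L S) ` cball 0 1 \<subseteq> K"
    using K(2) by (auto simp: image_subset_iff)
  with K(1) show ?thesis by (rule compact_operatorI)
qed

lemma compact_operator_scaleR:
  assumes "compact_operator V"
  shows "compact_operator (c *\<^sub>R V)"
proof -
  have "c *\<^sub>R V = (c *\<^sub>R id_blinfun) o\<^sub>L V"
    by (rule blinfun_eqI) (simp add: blinfun.scaleR_left)
  then show ?thesis
    using compact_operator_compose_left[OF assms] by metis
qed

lemma compact_operator_diff:
  assumes "compact_operator V" "compact_operator W"
  shows "compact_operator (V - W)"
  using compact_operator_add[OF assms(1) compact_operator_scaleR[OF assms(2), of "-1"]] by simp

lemma ess_norm_nonneg: "0 \<le> ess_norm S"
  unfolding ess_norm_def by (rule cINF_greatest) (auto intro: compact_operator_zero)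

lemma ess_norm_le:
  assumes "compact_operator V"
  shows "ess_norm S \<le> norm (S - V)"
  unfolding ess_norm_def using assms
  by (intro cINF_lower) (auto intro!: bdd_belowI[of _ 0])

lemma ess_norm_lessE:
  assumes "ess_norm S < c"
  obtains V where "compact_operator V" "norm (S - V) < c"
proof -
  have "\<exists>V\<in>{V. compact_operator V}. norm (S - V) < c"
    using assms unfolding ess_norm_def
    by (subst (asm) cINF_less_iff) (auto intro: bdd_belowI[of _ 0] compact_operator_zero)
  with that show thesis by auto
qed

text \<open>The product of the remainders \<open>S - V\<close> and \<open>S' - V'\<close> differs
  from \<open>S o\<^sub>L S'\<close> by \<open>W\<close>, whose three terms each have a compact
  factor. The infima need not be attained, hence the slack \<open>e\<close>, which is removed by a
  limit.\<close>

lemma ess_norm_compose: "ess_norm (S o\<^sub>L S') \<le> ess_norm S * ess_norm S'"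
proof -
  have *: "ess_norm (S o\<^sub>L S') \<le> (ess_norm S + e) * (ess_norm S' + e)" if "e > 0" for e
  proof -
    have "ess_norm S < ess_norm S + e" using that by simp
    then obtain V where V: "compact_operator V" "norm (S - V) < ess_norm S + e"
      by (rule ess_norm_lessE)
    have "ess_norm S' < ess_norm S' + e" using that by simp
    then obtain V' where V': "compact_operator V'" "norm (S' - V') < ess_norm S' + e"
      by (rule ess_norm_lessE)
    define W where "W = (S o\<^sub>L V') + (V o\<^sub>L S') - (V o\<^sub>L V')"
    have W: "compact_operator W"
      unfolding W_def
      by (intro compact_operator_diff compact_operator_add compact_operator_compose_left V'(1)
          compact_operator_compose_right[OF V(1)])
    have "(S o\<^sub>L S') - W = (S - V) o\<^sub>L (S' - V')"
      by (rule blinfun_eqI) (simp add: W_def blinfun.add_left blinfun.diff_left blinfun.diff_right algebra_simps)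
    then have "ess_norm (S o\<^sub>L S') \<le> norm ((S - V) o\<^sub>L (S' - V'))"
      using ess_norm_le[OF W, of "S o\<^sub>L S'"] by simp
    also have "\<dots> \<le> norm (S - V) * norm (S' - V')"
      by (rule norm_blinfun_compose)
    also have "\<dots> \<le> (ess_norm S + e) * (ess_norm S' + e)"
      using V V' by (intro mult_mono) (auto intro: add_nonneg_nonneg ess_norm_nonneg less_imp_le that)
    finally show ?thesis .
  qed
  have "(\<lambda>n. (ess_norm S + inverse (real (Suc n))) * (ess_norm S' + inverse (real (Suc n))))
      \<longlonglongrightarrow> (ess_norm S + 0) * (ess_norm S' + 0)"
    by (intro tendsto_intros LIMSEQ_inverse_real_of_nat)
  then have "ess_norm (S o\<^sub>L S') \<le> (ess_norm S + 0) * (ess_norm S' + 0)"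
    by (rule LIMSEQ_le_const) (intro exI allI impI * positive_imp_inverse_positive, simp)
  then show ?thesis by simp
qed

section \<open>Powers of operators and their compact perturbations\<close>

lemma op_power_0 [simp]: "op_power S 0 = id_blinfun"
  by (simp add: op_power_def)

lemma op_power_Suc: "op_power S (Suc n) = S o\<^sub>L op_power S n"
  by (simp add: op_power_def)

lemma op_power_add: "op_power S (m + n) = op_power S m o\<^sub>L op_power S n"
  by (induction m) (auto simp: op_power_Suc intro!: blinfun_eqI)

lemma op_power_mult: "op_power S (m * n) = op_power (op_power S m) n"
  by (induction n) (auto simp: op_power_Suc op_power_add)

lemma op_power_1 [simp]: "op_power S (Suc 0) = S"
  by (auto simp: op_power_Suc intro!: blinfun_eqI)

lemma op_power_Suc_apply:
  "blinfun_apply (op_power S (Suc n)) f = blinfun_apply (op_power S n) (S f)"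
  using op_power_add[of S n 1] by simp

lemma op_power_scaleR: "op_power (c *\<^sub>R S) n = c ^ n *\<^sub>R op_power S n"
  by (induction n) (auto simp: op_power_Suc blinfun.bilinear_simps intro!: blinfun_eqI)

lemma norm_op_power_add: "norm (op_power S (m + n)) \<le> norm (op_power S m) * norm (op_power S n)"
  by (simp add: op_power_add norm_blinfun_compose)

lemma norm_op_power: "norm (op_power S n) \<le> norm S ^ n"
proof (induction n)
  case 0
  show ?case by (simp add: norm_blinfun_id_le)
next
  case (Suc n)
  have "norm (op_power S (Suc n)) \<le> norm S * norm (op_power S n)"
    by (simp add: op_power_Suc norm_blinfun_compose)
  also have "\<dots> \<le> norm S * norm S ^ n"
    using Suc by (rule mult_left_mono) simp
  finally show ?case by simp
qed

text \<open>Compact operators form a two-sided ideal, so \<open>Q + V\<close> and \<open>Q\<close>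
  have the same powers modulo compact operators.\<close>

lemma op_power_compact_perturbation:
  assumes "compact_operator V"
  shows "compact_operator (op_power (Q + V) k - op_power Q k)"
proof (induction k)
  case (Suc k)
  have "op_power (Q + V) (Suc k) - op_power Q (Suc k) =
      (Q o\<^sub>L (op_power (Q + V) k - op_power Q k)) + (V o\<^sub>L op_power (Q + V) k)"
    by (rule blinfun_eqI) (simp add: op_power_Suc blinfun.bilinear_simps)
  then show ?case
    using compact_operator_add[OF compact_operator_compose_left[OF Suc]
        compact_operator_compose_right[OF assms]] by metis
qed simp

lemma ess_spectral_radius_limit:
  "(\<lambda>n. root n (ess_norm (op_power S n))) \<longlonglongrightarrow> ess_spectral_radius S"
proof -
  have "(\<lambda>n. root n (ess_norm (op_power S n))) \<longlonglongrightarrow> (INF n\<in>{1..}. root n (ess_norm (op_power S n)))"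
    by (rule submultiplicative_root_limit) (auto simp: ess_norm_nonneg op_power_add ess_norm_compose)
  then show ?thesis
    unfolding ess_spectral_radius_def by (simp add: limI)
qed

text \<open>Turns quasi-compactness into a condition on one power: the limit is also the infimum of
  the roots, so a single essential norm below 1 is enough.\<close>

lemma ess_spectral_radius_less_one_iff:
  "ess_spectral_radius S < 1 \<longleftrightarrow> (\<exists>m\<ge>1. ess_norm (op_power S m) < 1)"
proof
  assume "ess_spectral_radius S < 1"
  then have "eventually (\<lambda>n. root n (ess_norm (op_power S n)) < 1 \<and> n \<ge> 1) sequentially"
    by (intro eventually_conj order_tendstoD(2)[OF ess_spectral_radius_limit] eventually_ge_at_top)
  from eventually_happens'[OF sequentially_bot this]
  obtain n where "root n (ess_norm (op_power S n)) < 1" "n \<ge> 1"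
    by blast
  then show "\<exists>m\<ge>1. ess_norm (op_power S m) < 1"
    by auto
next
  assume "\<exists>m\<ge>1. ess_norm (op_power S m) < 1"
  then obtain m where m: "m \<ge> 1" "ess_norm (op_power S m) < 1" by blast
  have "(\<lambda>n. root n (ess_norm (op_power S n))) \<longlonglongrightarrow> (INF n\<in>{1..}. root n (ess_norm (op_power S n)))"
    by (rule submultiplicative_root_limit) (auto simp: ess_norm_nonneg op_power_add ess_norm_compose)
  then have "ess_spectral_radius S = (INF n\<in>{1..}. root n (ess_norm (op_power S n)))"
    by (rule LIMSEQ_unique[OF ess_spectral_radius_limit])
  also have "\<dots> \<le> root m (ess_norm (op_power S m))"
    using m(1) by (intro cINF_lower) (auto intro!: bdd_belowI[of _ 0] real_root_ge_zero ess_norm_nonneg)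
  also have "\<dots> < 1" using m by simp
  finally show "ess_spectral_radius S < 1" .
qed

section \<open>Spectral radius of positive operators\<close>

text \<open>The domain is an arbitrary topological space, as the alphabet carries no metric:
  completeness comes from the target alone, through uniform limits of continuous functions. Neumann
  series and Cauchy orbits in C(A) rely on it.\<close>

lemma bcontfun_complete:
  fixes f :: "nat \<Rightarrow> ('a::topological_space \<Rightarrow>\<^sub>C 'b::complete_space)"
  assumes "Cauchy f"
  shows "convergent f"
proof -
  have "uniformly_Cauchy_on UNIV (\<lambda>n. apply_bcontfun (f n))"
  proof (rule uniformly_Cauchy_onI)
    fix e :: real assume "0 < e"
    then obtain M where M: "\<And>m n. m \<ge> M \<Longrightarrow> n \<ge> M \<Longrightarrow> dist (f m) (f n) < e"
      using assms unfolding Cauchy_def by blast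
    have "dist (apply_bcontfun (f m) x) (apply_bcontfun (f n) x) < e" if "m \<ge> M" "n \<ge> M" for m n x
      using le_less_trans[OF dist_bounded M[OF that]] .
    then show "\<exists>M. \<forall>x\<in>UNIV. \<forall>m\<ge>M. \<forall>n\<ge>M.
        dist (apply_bcontfun (f m) x) (apply_bcontfun (f n) x) < e"
      by blast
  qed
  then obtain g where "uniform_limit UNIV (\<lambda>n. apply_bcontfun (f n)) g sequentially"
    using Cauchy_uniformly_convergent[of UNIV "\<lambda>n. apply_bcontfun (f n)"]
    unfolding uniformly_convergent_on_def by blast
  then show ?thesis
    by (rule uniform_limit_bcontfunE) (auto intro: convergentI)
qed

instance bcontfun :: (topological_space, complete_space) complete_space
  by standard (rule bcontfun_complete)

instance bcontfun :: (topological_space, banach) banach ..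

text \<open>For \<open>s > 0\<close> this says that the n-th roots of
  \<open>norm (op_power S n)\<close> have a limit of at most \<open>s\<close>. The strict
  \<open>l > s\<close> tolerates subexponential factors.\<close>

definition growth_bounded :: "('e::real_normed_vector \<Rightarrow>\<^sub>L 'e) \<Rightarrow> real \<Rightarrow> bool" where
  "growth_bounded S s \<longleftrightarrow> (\<forall>l>s. \<exists>C. \<forall>n. norm (op_power S n) \<le> C * l ^ n)"

lemma summable_operator_series:
  fixes S :: "'e::banach \<Rightarrow>\<^sub>L 'e"
  assumes "growth_bounded S s" "0 < s" "s < l" and c: "\<And>n. \<bar>c n\<bar> \<le> K / l ^ n"
  shows "summable (\<lambda>n. c n *\<^sub>R op_power S n)"
proof -
  \<comment> \<open>A rate strictly between \<open>s\<close> and \<open>l\<close>: powers are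
    controlled only at rates above \<open>s\<close>, and the ratio \<open>q / l\<close> must still
    be below 1.\<close>
  define q where "q = (s + l) / 2"
  have q: "s < q" "q < l" "0 < q" "0 < l" using assms by (auto simp: q_def)
  obtain C where C: "\<And>n. norm (op_power S n) \<le> C * q ^ n"
    using assms(1) q(1) unfolding growth_bounded_def by blast
  have "0 \<le> K" using c[of 0] by simp
  have le: "norm (c n *\<^sub>R op_power S n) \<le> K * C * (q / l) ^ n" for n
  proof -
    have "norm (c n *\<^sub>R op_power S n) \<le> (K / l ^ n) * (C * q ^ n)"
      unfolding norm_scaleR using c[of n] C[of n] q \<open>0 \<le> K\<close> by (intro mult_mono) auto
    then show ?thesis by (simp add: power_divide)
  qed
  have "summable (\<lambda>n. K * C * (q / l) ^ n)"
    using q by (intro summable_mult summable_geometric) auto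
  then show ?thesis
    by (rule summable_comparison_test'[where N = 0]) (rule le)
qed

text \<open>Composition is continuous and bilinear, so multiplying the series by \<open>S\<close>
  from either side shifts the index and drops the term of order 0. With
  \<open>c n = 1 / l ^ n\<close> this is the resolvent identity; the complex version takes real and
  imaginary parts of \<open>1 / z ^ n\<close>.\<close>

lemma operator_series_shift:
  fixes S :: "'e::banach \<Rightarrow>\<^sub>L 'e"
  assumes "summable (\<lambda>n. c n *\<^sub>R op_power S n)" "summable (\<lambda>n. c (Suc n) *\<^sub>R op_power S n)"
  shows "S o\<^sub>L (\<Sum>n. c (Suc n) *\<^sub>R op_power S n) = (\<Sum>n. c n *\<^sub>R op_power S n) - c 0 *\<^sub>R id_blinfun"
    and "(\<Sum>n. c (Suc n) *\<^sub>R op_power S n) o\<^sub>L S = (\<Sum>n. c n *\<^sub>R op_power S n) - c 0 *\<^sub>R id_blinfun"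
proof -
  have 1: "(\<Sum>n. c (Suc n) *\<^sub>R op_power S (Suc n)) = (\<Sum>n. c n *\<^sub>R op_power S n) - c 0 *\<^sub>R id_blinfun"
    using suminf_split_head[OF assms(1)] by simp
  have "S o\<^sub>L (c (Suc n) *\<^sub>R op_power S n) = c (Suc n) *\<^sub>R op_power S (Suc n)"
    "(c (Suc n) *\<^sub>R op_power S n) o\<^sub>L S = c (Suc n) *\<^sub>R op_power S (Suc n)" for n
    using op_power_Suc_apply[of S n]
    by (auto intro!: blinfun_eqI simp: op_power_Suc blinfun.scaleR_left blinfun.scaleR_right)
  note terms = this
  have "S o\<^sub>L (\<Sum>n. c (Suc n) *\<^sub>R op_power S n) = (\<Sum>n. S o\<^sub>L (c (Suc n) *\<^sub>R op_power S n))"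
    by (rule bounded_linear.suminf[OF bounded_bilinear.bounded_linear_right[OF bounded_bilinear_blinfun_compose] assms(2)])
  with 1 show "S o\<^sub>L (\<Sum>n. c (Suc n) *\<^sub>R op_power S n) = (\<Sum>n. c n *\<^sub>R op_power S n) - c 0 *\<^sub>R id_blinfun"
    by (simp only: terms)
  have "(\<Sum>n. c (Suc n) *\<^sub>R op_power S n) o\<^sub>L S = (\<Sum>n. (c (Suc n) *\<^sub>R op_power S n) o\<^sub>L S)"
    by (rule bounded_linear.suminf[OF bounded_bilinear.bounded_linear_left[OF bounded_bilinear_blinfun_compose] assms(2)])
  with 1 show "(\<Sum>n. c (Suc n) *\<^sub>R op_power S n) o\<^sub>L S = (\<Sum>n. c n *\<^sub>R op_power S n) - c 0 *\<^sub>R id_blinfun"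
    by (simp only: terms)
qed

lemma neumann_coefficients_bound:
  assumes "z \<noteq> 0"
  shows "\<bar>Re (1 / z ^ n)\<bar> \<le> 1 / cmod z ^ n" "\<bar>Im (1 / z ^ n)\<bar> \<le> 1 / cmod z ^ n"
    "\<bar>Re (1 / z ^ Suc n)\<bar> \<le> (1 / cmod z) / cmod z ^ n" "\<bar>Im (1 / z ^ Suc n)\<bar> \<le> (1 / cmod z) / cmod z ^ n"
  using abs_Re_le_cmod[of "1 / z ^ n"] abs_Im_le_cmod[of "1 / z ^ n"]
    abs_Re_le_cmod[of "1 / z ^ Suc n"] abs_Im_le_cmod[of "1 / z ^ Suc n"]
  by (simp_all add: norm_divide norm_power norm_mult)

text \<open>The resolvent is the Neumann series with coefficients \<open>1 / z ^ Suc n\<close>. As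
  the space is real, it is written as \<open>A + i B\<close> with two real series, and
  \<open>R\<close> is its action on pairs.\<close>

lemma not_in_spectrum:
  fixes S :: "'e::banach \<Rightarrow>\<^sub>L 'e"
  assumes "growth_bounded S s" "0 < s" "s < cmod z"
  shows "z \<notin> spectrum S"
proof -
  have z: "z \<noteq> 0" using assms by auto
  define c d where "c n = Re (1 / z ^ n)" and "d n = Im (1 / z ^ n)" for n
  note bounds = neumann_coefficients_bound[OF z]
  have c0: "summable (\<lambda>n. c n *\<^sub>R op_power S n)" and c1: "summable (\<lambda>n. c (Suc n) *\<^sub>R op_power S n)"
    and d0: "summable (\<lambda>n. d n *\<^sub>R op_power S n)" and d1: "summable (\<lambda>n. d (Suc n) *\<^sub>R op_power S n)"
    unfolding c_def d_def
    by (rule summable_operator_series[OF assms], rule bounds)+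
  define A B where "A = (\<Sum>n. c (Suc n) *\<^sub>R op_power S n)" and "B = (\<Sum>n. d (Suc n) *\<^sub>R op_power S n)"
  note SA = operator_series_shift[OF c0 c1, folded A_def]
  note SB = operator_series_shift[OF d0 d1, folded B_def]
  \<comment> \<open>Splitting this identity into real and imaginary parts expresses the unshifted
    series through \<open>A\<close> and \<open>B\<close>.\<close>
  have rec: "Complex (c n) (d n) = z * Complex (c (Suc n)) (d (Suc n))" for n
    using z by (simp add: c_def d_def)
  have c_rec: "c n = Re z * c (Suc n) - Im z * d (Suc n)" and d_rec: "d n = Im z * c (Suc n) + Re z * d (Suc n)" for n
    using arg_cong[OF rec[of n], of Re] arg_cong[OF rec[of n], of Im] by auto
  have "(\<lambda>n. Re z *\<^sub>R c (Suc n) *\<^sub>R op_power S n - Im z *\<^sub>R d (Suc n) *\<^sub>R op_power S n)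
      sums (Re z *\<^sub>R A - Im z *\<^sub>R B)"
    unfolding A_def B_def by (intro sums_diff sums_scaleR_right summable_sums c1 d1)
  moreover have "Re z *\<^sub>R c (Suc n) *\<^sub>R op_power S n - Im z *\<^sub>R d (Suc n) *\<^sub>R op_power S n
      = c n *\<^sub>R op_power S n" for n
    by (simp only: c_rec[of n] scaleR_diff_left scaleR_scaleR)
  ultimately have F: "(\<Sum>n. c n *\<^sub>R op_power S n) = Re z *\<^sub>R A - Im z *\<^sub>R B"
    by (simp add: sums_iff)
  have "(\<lambda>n. Im z *\<^sub>R c (Suc n) *\<^sub>R op_power S n + Re z *\<^sub>R d (Suc n) *\<^sub>R op_power S n)
      sums (Im z *\<^sub>R A + Re z *\<^sub>R B)"
    unfolding A_def B_def by (intro sums_add sums_scaleR_right summable_sums c1 d1)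
  moreover have "Im z *\<^sub>R c (Suc n) *\<^sub>R op_power S n + Re z *\<^sub>R d (Suc n) *\<^sub>R op_power S n
      = d n *\<^sub>R op_power S n" for n
    by (simp only: d_rec[of n] scaleR_add_left scaleR_scaleR)
  ultimately have G: "(\<Sum>n. d n *\<^sub>R op_power S n) = Im z *\<^sub>R A + Re z *\<^sub>R B"
    by (simp add: sums_iff)
  have "c 0 = 1" "d 0 = 0" by (simp_all add: c_def d_def)
  then have eqs: "S (A f) = Re z *\<^sub>R A f - Im z *\<^sub>R B f - f" "A (S f) = Re z *\<^sub>R A f - Im z *\<^sub>R B f - f"
    "S (B f) = Im z *\<^sub>R A f + Re z *\<^sub>R B f" "B (S f) = Im z *\<^sub>R A f + Re z *\<^sub>R B f" for f
    using arg_cong[OF SA(1), of "\<lambda>V. blinfun_apply V f"] arg_cong[OF SA(2), of "\<lambda>V. blinfun_apply V f"]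
      arg_cong[OF SB(1), of "\<lambda>V. blinfun_apply V f"] arg_cong[OF SB(2), of "\<lambda>V. blinfun_apply V f"]
    by (simp_all add: F G blinfun.add_left blinfun.diff_left blinfun.scaleR_left)
  define R where "R = (\<lambda>(x, y). (A x - B y, B x + A y))"
  have "bounded_linear R"
    unfolding R_def case_prod_unfold
    by (intro bounded_linear_Pair bounded_linear_sub bounded_linear_add
        bounded_linear_compose[OF blinfun.bounded_linear_right] bounded_linear_fst bounded_linear_snd)
  moreover have "R \<circ> complex_shifted S z = id" "complex_shifted S z \<circ> R = id"
    by (auto simp: R_def complex_shifted_def fun_eq_iff eqs blinfun.add_right blinfun.diff_right
        blinfun.scaleR_right algebra_simps)
  ultimately show ?thesis
    unfolding spectrum_def by blast
qed

text \<open>A bounded left inverse of the shifted operator would carry vectors tending to 0 to the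
  unit vectors \<open>(x k, 0)\<close>.\<close>

lemma approximate_eigenvalue_in_spectrum:
  fixes S :: "'e::real_normed_vector \<Rightarrow>\<^sub>L 'e"
  assumes "\<And>k. norm (x k) = 1" "(\<lambda>k. S (x k) - s *\<^sub>R x k) \<longlonglongrightarrow> 0"
  shows "complex_of_real s \<in> spectrum S"
proof (rule ccontr)
  assume "complex_of_real s \<notin> spectrum S"
  then obtain R where R: "bounded_linear R" "R \<circ> complex_shifted S (complex_of_real s) = id"
    unfolding spectrum_def by blast
  have "(\<lambda>k. R (- (S (x k) - s *\<^sub>R x k), 0)) \<longlonglongrightarrow> R (- 0, 0)"
    by (intro bounded_linear.tendsto[OF R(1)] tendsto_Pair tendsto_minus assms(2) tendsto_const)
  moreover have "R (- (S (x k) - s *\<^sub>R x k), 0) = (x k, 0)" for k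
    using fun_cong[OF R(2), of "(x k, 0)"] by (simp add: complex_shifted_def)
  ultimately have "(\<lambda>k. (x k, 0::'e)) \<longlonglongrightarrow> 0"
    using linear_0[OF bounded_linear.linear[OF R(1)]] by (simp flip: zero_prod_def)
  then have "(\<lambda>k. norm (x k, 0::'e)) \<longlonglongrightarrow> 0"
    by (rule tendsto_norm_zero)
  then show False
    using assms(1) by (simp add: norm_Pair LIMSEQ_const_iff)
qed

section \<open>Positive operators on spaces of bounded continuous functions\<close>

definition positive_operator ::
  "(('a::topological_space \<Rightarrow>\<^sub>C real) \<Rightarrow>\<^sub>L ('b::topological_space \<Rightarrow>\<^sub>C real)) \<Rightarrow> bool" where
  "positive_operator S \<longleftrightarrow>
     (\<forall>f. (\<forall>a. 0 \<le> apply_bcontfun f a) \<longrightarrow> (\<forall>a. 0 \<le> apply_bcontfun (blinfun_apply S f) a))"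

abbreviation one_bcontfun :: "'a::topological_space \<Rightarrow>\<^sub>C real" where
  "one_bcontfun \<equiv> const_bcontfun 1"

lemma abs_apply_bcontfun_le: "\<bar>apply_bcontfun f a\<bar> \<le> norm f" for f :: "'a::topological_space \<Rightarrow>\<^sub>C real"
  using norm_bounded[of f a] by simp

lemma norm_bcontfun_leI:
  fixes f :: "'a::topological_space \<Rightarrow>\<^sub>C real"
  shows "(\<And>a. \<bar>apply_bcontfun f a\<bar> \<le> b) \<Longrightarrow> norm f \<le> b"
  by (rule norm_bound) simp

lemma norm_one_bcontfun [simp]: "norm one_bcontfun = 1"
proof (rule antisym)
  show "norm one_bcontfun \<le> 1"
    by (rule norm_bcontfun_leI) (simp add: const_bcontfun.rep_eq)
  show "1 \<le> norm (one_bcontfun :: 'a \<Rightarrow>\<^sub>C real)"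
    using abs_apply_bcontfun_le[of "one_bcontfun :: 'a \<Rightarrow>\<^sub>C real"] by (simp add: const_bcontfun.rep_eq)
qed

lemma positive_operatorD:
  "positive_operator S \<Longrightarrow> (\<And>a. 0 \<le> apply_bcontfun f a) \<Longrightarrow> 0 \<le> apply_bcontfun (blinfun_apply S f) a"
  by (simp add: positive_operator_def)

lemma positive_operator_mono:
  assumes "positive_operator S" "\<And>a. apply_bcontfun f a \<le> apply_bcontfun g a"
  shows "apply_bcontfun (blinfun_apply S f) a \<le> apply_bcontfun (blinfun_apply S g) a"
  using positive_operatorD[OF assms(1), of "g - f" a] assms(2) by (simp add: blinfun.diff_right)

lemma positive_operator_id [simp]: "positive_operator id_blinfun"
  by (simp add: positive_operator_def)

lemma positive_operator_compose: "positive_operator S \<Longrightarrow> positive_operator R \<Longrightarrow> positive_operator (S o\<^sub>L R)"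
  by (simp add: positive_operator_def)

lemma positive_operator_power: "positive_operator S \<Longrightarrow> positive_operator (op_power S n)"
  by (induction n) (auto simp: op_power_Suc intro: positive_operator_compose)

lemma positive_operator_abs_le:
  assumes "positive_operator S"
  shows "\<bar>apply_bcontfun (blinfun_apply S f) a\<bar> \<le> norm f * apply_bcontfun (blinfun_apply S one_bcontfun) a"
proof -
  have "apply_bcontfun (blinfun_apply S f) a \<le> apply_bcontfun (blinfun_apply S (norm f *\<^sub>R one_bcontfun)) a"
    by (intro positive_operator_mono assms)
      (use abs_apply_bcontfun_le[of f] in \<open>auto simp: const_bcontfun.rep_eq abs_le_iff\<close>)
  moreover have "apply_bcontfun (blinfun_apply S (- (norm f *\<^sub>R one_bcontfun))) a \<le> apply_bcontfun (blinfun_apply S f) a"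
    by (intro positive_operator_mono assms)
      (use abs_apply_bcontfun_le[of f] in \<open>auto simp: const_bcontfun.rep_eq abs_le_iff minus_le_iff\<close>)
  ultimately show ?thesis
    by (simp add: blinfun.scaleR_right blinfun.minus_right abs_le_iff)
qed

text \<open>A positive operator attains its norm at the constant 1. For powers of \<open>M\<close>
  this identifies the norm with the largest word length.\<close>

lemma norm_positive_operator_le:
  assumes "positive_operator S" "\<And>a. apply_bcontfun (blinfun_apply S one_bcontfun) a \<le> B"
  shows "norm S \<le> B"
proof (rule norm_blinfun_bound)
  show "0 \<le> B"
    using positive_operatorD[OF assms(1), of one_bcontfun undefined] assms(2)[of undefined]
    by (simp add: const_bcontfun.rep_eq)
  show "norm (S f) \<le> B * norm f" for f
  proof (rule norm_bcontfun_leI)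
    fix a
    have "\<bar>apply_bcontfun (S f) a\<bar> \<le> norm f * apply_bcontfun (S one_bcontfun) a"
      using assms(1) by (rule positive_operator_abs_le)
    also have "\<dots> \<le> norm f * B"
      using assms(2) by (rule mult_left_mono) simp
    finally show "\<bar>apply_bcontfun (S f) a\<bar> \<le> B * norm f" by (simp add: mult.commute)
  qed
qed

lemma positive_operator_one_le_norm:
  assumes "positive_operator S"
  shows "apply_bcontfun (blinfun_apply S one_bcontfun) a \<le> norm S"
proof -
  have "apply_bcontfun (S one_bcontfun) a \<le> norm (S one_bcontfun)"
    using abs_apply_bcontfun_le[of "S one_bcontfun" a] by simp
  also have "\<dots> \<le> norm S" using norm_blinfun[of S one_bcontfun] by simp
  finally show ?thesis .
qed

text \<open>\<open>x\<close> is the resolvent at \<open>l\<close> applied to the constant 1. It is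
  nonnegative because the Neumann series has nonnegative coefficients and evaluation at a point is
  continuous.\<close>

lemma positive_resolvent:
  fixes S :: "('a::topological_space \<Rightarrow>\<^sub>C real) \<Rightarrow>\<^sub>L ('a \<Rightarrow>\<^sub>C real)"
  assumes "positive_operator S" "growth_bounded S s" "0 < s" "s < l"
  obtains x where "\<And>a. 0 \<le> apply_bcontfun x a" "l *\<^sub>R x - S x = one_bcontfun"
proof -
  define c where "c n = 1 / l ^ n" for n
  have l: "l > 0" using assms by simp
  have c0: "summable (\<lambda>n. c n *\<^sub>R op_power S n)" and c1: "summable (\<lambda>n. c (Suc n) *\<^sub>R op_power S n)"
    by (rule summable_operator_series[OF assms(2-4), of _ 1];  use l in \<open>simp add: c_def\<close>)
      (rule summable_operator_series[OF assms(2-4), of _ "1 / l"];  use l in \<open>simp add: c_def\<close>)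
  define A where "A = (\<Sum>n. c (Suc n) *\<^sub>R op_power S n)"
  have "(\<Sum>n. c n *\<^sub>R op_power S n) = (\<Sum>n. l *\<^sub>R c (Suc n) *\<^sub>R op_power S n)"
    using l by (simp add: c_def)
  also have "\<dots> = l *\<^sub>R A"
    unfolding A_def by (rule suminf_scaleR_right[symmetric, OF c1])
  finally have SA: "S o\<^sub>L A = l *\<^sub>R A - id_blinfun"
    using operator_series_shift(1)[OF c0 c1] by (simp add: A_def c_def)
  have "l *\<^sub>R A one_bcontfun - S (A one_bcontfun) = one_bcontfun"
    using arg_cong[OF SA, of "\<lambda>V. blinfun_apply V one_bcontfun"]
    by (simp add: blinfun.diff_left blinfun.scaleR_left)
  moreover have "0 \<le> apply_bcontfun (A one_bcontfun) a" for a
  proof -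
    have "(\<lambda>n. \<Sum>k<n. c (Suc k) *\<^sub>R op_power S k) \<longlonglongrightarrow> A"
      unfolding A_def using summable_LIMSEQ[OF c1] .
    then have "(\<lambda>n. (\<Sum>k<n. c (Suc k) *\<^sub>R op_power S k) one_bcontfun) \<longlonglongrightarrow> A one_bcontfun"
      by (intro tendsto_intros)
    then have lim: "(\<lambda>n. apply_bcontfun ((\<Sum>k<n. c (Suc k) *\<^sub>R op_power S k) one_bcontfun) a)
        \<longlonglongrightarrow> apply_bcontfun (A one_bcontfun) a"
      by (rule tendsto_uniform_limitI[OF tendsto_bcontfun_uniform_limit UNIV_I])
    have "0 \<le> apply_bcontfun (op_power S n one_bcontfun) a" for n
      by (intro positive_operatorD positive_operator_power assms(1)) (simp add: const_bcontfun.rep_eq)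
    then have "0 \<le> apply_bcontfun ((\<Sum>k<n. c (Suc k) *\<^sub>R op_power S k) one_bcontfun) a" for n
      by (induction n) (use l in \<open>auto simp: c_def blinfun.add_left blinfun.scaleR_left\<close>)
    then show ?thesis
      by (intro LIMSEQ_le_const[OF lim] exI[of _ 0] allI impI)
  qed
  ultimately show thesis by (rule that[rotated])
qed

text \<open>If \<open>norm x\<close> were smaller than \<open>1/(l - s)\<close>, then \<open>S x \<le> q x\<close> for some \<open>q < s\<close>, so that the
  powers of \<open>S\<close> would grow more slowly than \<open>s ^ n\<close>.\<close>

lemma positive_resolvent_norm_ge:
  fixes S :: "('a::topological_space \<Rightarrow>\<^sub>C real) \<Rightarrow>\<^sub>L ('a \<Rightarrow>\<^sub>C real)"
  assumes "positive_operator S" and low: "\<And>n. s ^ n \<le> norm (op_power S n)" and "0 < s" "s < l"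
    and x: "\<And>a. 0 \<le> apply_bcontfun x a" "l *\<^sub>R x - S x = one_bcontfun"
  shows "1 / (l - s) \<le> norm x"
proof -
  define C where "C = norm x"
  \<comment> \<open>From \<open>S x = l x - 1\<close> and \<open>x \<le> C\<close> one gets
    \<open>S x \<le> (l - 1 / C) x\<close>, which dictates \<open>q\<close>.\<close>
  define q where "q = l - 1 / C"
  have Sx: "apply_bcontfun (S x) a = l * apply_bcontfun x a - 1" for a
    using arg_cong[OF x(2), of "\<lambda>f. apply_bcontfun f a"] by (simp add: const_bcontfun.rep_eq)
  have Sx0: "0 \<le> apply_bcontfun (S x) a" for a
    using assms(1) x(1) by (rule positive_operatorD)
  have lx: "1 \<le> l * apply_bcontfun x a" for a
    using Sx0[of a] Sx[of a] by simp
  have xC: "apply_bcontfun x a \<le> C" for a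
    using abs_apply_bcontfun_le[of x a] by (simp add: C_def)
  have l: "0 < l" using assms by simp
  have xp: "0 < apply_bcontfun x a" for a
    using zero_less_mult_pos[OF less_le_trans[OF zero_less_one lx[of a]] l] .
  have C: "0 < C" using less_le_trans[OF xp xC] .
  have Sq: "apply_bcontfun (S x) a \<le> q * apply_bcontfun x a" for a
    using xC[of a] C by (simp add: Sx q_def algebra_simps)
  have q0: "0 \<le> q"
    using order_trans[OF Sx0 Sq, of undefined] xp[of undefined] by (simp add: zero_le_mult_iff)
  have pow: "apply_bcontfun (op_power S n x) a \<le> q ^ n * apply_bcontfun x a" for n a
  proof (induction n arbitrary: a)
    case (Suc n)
    have "apply_bcontfun (op_power S (Suc n) x) a \<le> apply_bcontfun (S (q ^ n *\<^sub>R x)) a"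
      unfolding op_power_Suc by simp (intro positive_operator_mono assms(1), simp add: Suc)
    also have "\<dots> = q ^ n * apply_bcontfun (S x) a"
      by (simp add: blinfun.scaleR_right)
    also have "\<dots> \<le> q ^ n * (q * apply_bcontfun x a)"
      using q0 Sq by (intro mult_left_mono) auto
    finally show ?case by (simp add: mult_ac)
  qed simp
  \<comment> \<open>The inequality \<open>1 \<le> l * x\<close> transfers the slow growth from
    \<open>x\<close> to the constant 1, where a positive operator attains its norm.\<close>
  have "s ^ n \<le> (l * C) * q ^ n" for n
  proof -
    have "norm (op_power S n) \<le> l * (q ^ n * C)"
    proof (rule norm_positive_operator_le)
      show "positive_operator (op_power S n)"
        using assms(1) by (rule positive_operator_power)
      fix a
      have "apply_bcontfun (op_power S n one_bcontfun) a \<le> apply_bcontfun (op_power S n (l *\<^sub>R x)) a"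
        by (intro positive_operator_mono positive_operator_power assms(1))
          (use lx in \<open>simp add: const_bcontfun.rep_eq\<close>)
      also have "\<dots> = l * apply_bcontfun (op_power S n x) a"
        by (simp add: blinfun.scaleR_right)
      also have "\<dots> \<le> l * (q ^ n * apply_bcontfun x a)"
        using pow l by (intro mult_left_mono) auto
      also have "\<dots> \<le> l * (q ^ n * C)"
        using xC l q0 by (intro mult_left_mono) auto
      finally show "apply_bcontfun (op_power S n one_bcontfun) a \<le> l * (q ^ n * C)" .
    qed
    with low[of n] show ?thesis by (simp add: mult_ac)
  qed
  then have qs: "(l * C) * q ^ n \<ge> s ^ n" for n .
  have "q > 0"
  proof (rule ccontr)
    assume "\<not> q > 0"
    with q0 have "q = 0" by simp
    with qs[of 1] \<open>0 < s\<close> show False by simp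
  qed
  then have "s \<le> q" using qs by (rule power_le_const_mult_power_imp_le)
  then have "1 / C \<le> l - s" by (simp add: q_def)
  then show ?thesis
    using C assms(4) by (simp add: C_def field_simps)
qed

text \<open>Normalising the resolvent value \<open>y\<close> at \<open>s + e\<close> leaves the
  error \<open>e *\<^sub>R x - one_bcontfun /\<^sub>R norm y\<close>. Both terms have norm at most
  \<open>e\<close>, the second one because \<open>norm y \<ge> 1 / e\<close>.\<close>

lemma positive_approximate_eigenvectors:
  fixes S :: "('a::topological_space \<Rightarrow>\<^sub>C real) \<Rightarrow>\<^sub>L ('a \<Rightarrow>\<^sub>C real)"
  assumes "positive_operator S" "growth_bounded S s" "\<And>n. s ^ n \<le> norm (op_power S n)" "0 < s"
  shows "\<exists>x. (\<forall>k. norm (x k) = 1) \<and> (\<forall>k a. 0 \<le> apply_bcontfun (x k) a) \<and>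
    (\<lambda>k. S (x k) - s *\<^sub>R x k) \<longlonglongrightarrow> 0"
proof -
  have "\<exists>x. norm x = 1 \<and> (\<forall>a. 0 \<le> apply_bcontfun x a) \<and>
      norm (S x - s *\<^sub>R x) \<le> 2 * inverse (real (Suc k))" for k
  proof -
    define e where "e = inverse (real (Suc k))"
    have e: "0 < e" by (simp add: e_def)
    obtain y where y: "\<And>a. 0 \<le> apply_bcontfun y a" "(s + e) *\<^sub>R y - S y = one_bcontfun"
      using positive_resolvent[OF assms(1,2,4), of "s + e"] e by auto
    have ny: "1 / e \<le> norm y"
      using positive_resolvent_norm_ge[OF assms(1,3,4) _ y] e by simp
    then have "0 < norm y" using e by (smt (verit) divide_pos_pos)
    define x where "x = y /\<^sub>R norm y"
    have "S x - s *\<^sub>R x = e *\<^sub>R x - one_bcontfun /\<^sub>R norm y"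
      unfolding y(2)[symmetric] by (simp add: x_def blinfun.scaleR_right algebra_simps)
    also have "norm \<dots> \<le> norm (e *\<^sub>R x) + norm (one_bcontfun /\<^sub>R norm y :: 'a \<Rightarrow>\<^sub>C real)"
      by (rule norm_triangle_ineq4)
    also have "\<dots> = e + 1 / norm y"
      using \<open>0 < norm y\<close> e by (simp add: x_def divide_inverse)
    also have "1 / norm y \<le> e"
      using ny \<open>0 < norm y\<close> e by (simp add: field_simps)
    finally have "norm (S x - s *\<^sub>R x) \<le> 2 * e" by simp
    moreover have "norm x = 1" "\<forall>a. 0 \<le> apply_bcontfun x a"
      using \<open>0 < norm y\<close> y by (auto simp: x_def)
    ultimately show ?thesis
      unfolding e_def by blast
  qed
  then obtain x where x: "\<And>k. norm (x k) = 1" "\<And>k a. 0 \<le> apply_bcontfun (x k) a"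
      "\<And>k. norm (S (x k) - s *\<^sub>R x k) \<le> 2 * inverse (real (Suc k))"
    by metis
  have "(\<lambda>k. 2 * inverse (real (Suc k))) \<longlonglongrightarrow> 2 * 0"
    by (intro tendsto_intros LIMSEQ_inverse_real_of_nat)
  then have "(\<lambda>k. 2 * inverse (real (Suc k))) \<longlonglongrightarrow> 0"
    by simp
  then have "(\<lambda>k. S (x k) - s *\<^sub>R x k) \<longlonglongrightarrow> 0"
    by (rule Lim_null_comparison[OF always_eventually, rotated]) (rule allI, rule x(3))
  with x(1,2) show ?thesis by (intro exI[of _ x]) simp
qed

lemma spectral_radius_positive_operator:
  fixes S :: "('a::topological_space \<Rightarrow>\<^sub>C real) \<Rightarrow>\<^sub>L ('a \<Rightarrow>\<^sub>C real)"
  assumes "positive_operator S" "growth_bounded S s" "\<And>n. s ^ n \<le> norm (op_power S n)" "0 < s"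
  shows "spectral_radius S = s"
  unfolding spectral_radius_def
proof (rule cSup_eq_maximum)
  have "complex_of_real s \<in> spectrum S"
    using positive_approximate_eigenvectors[OF assms] by (auto intro: approximate_eigenvalue_in_spectrum)
  then show "s \<in> cmod ` spectrum S"
    using assms(4) by (intro image_eqI[of _ _ "complex_of_real s"]) auto
  show "y \<le> s" if "y \<in> cmod ` spectrum S" for y
    using that not_in_spectrum[OF assms(2,4)] by (auto simp: not_less[symmetric])
qed

section \<open>Quasi-compact and mean ergodic operators\<close>

text \<open>Split \<open>op_power T m\<close> as \<open>Q + V\<close> with
  \<open>norm Q < 1\<close>: the powers of \<open>Q\<close> decay, and what remains of the power
  stays compact.\<close>

lemma ess_norm_op_power_decomposition:
  fixes T :: "'e::real_normed_vector \<Rightarrow>\<^sub>L 'e"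
  assumes "ess_norm (op_power T m) < 1" "0 < e"
  shows "\<exists>k V. compact_operator V \<and> norm (op_power T (m * k) - V) < e"
proof -
  obtain V where V: "compact_operator V" "norm (op_power T m - V) < 1"
    using ess_norm_lessE[OF assms(1)] by blast
  define Q where "Q = op_power T m - V"
  obtain k where k: "norm Q ^ k < e"
    using real_arch_pow_inv[OF assms(2), of "norm Q"] V(2) by (auto simp: Q_def)
  have "compact_operator (op_power (Q + V) k - op_power Q k)"
    by (rule op_power_compact_perturbation[OF V(1)])
  then have "compact_operator (op_power T (m * k) - op_power Q k)"
    by (simp add: Q_def op_power_mult)
  moreover have "norm (op_power T (m * k) - (op_power T (m * k) - op_power Q k)) < e"
    using norm_op_power[of Q k] k by simp
  ultimately show ?thesis by blast
qed

lemma totally_bounded_imp_convergent_subseq: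
  fixes x :: "nat \<Rightarrow> 'e::complete_space"
  assumes "\<And>e. 0 < e \<Longrightarrow> \<exists>F. finite F \<and> range x \<subseteq> (\<Union>y\<in>F. ball y e)"
  shows "\<exists>l r. strict_mono (r :: nat \<Rightarrow> nat) \<and> (x \<circ> r) \<longlonglongrightarrow> l"
proof -
  have "compact (closure (range x))"
    unfolding compact_eq_totally_bounded
  proof (intro conjI allI impI)
    show "complete (closure (range x))"
      by (simp add: complete_eq_closed)
    fix e :: real assume "0 < e"
    then obtain F where F: "finite F" "range x \<subseteq> (\<Union>y\<in>F. ball y (e / 2))"
      using assms[of "e / 2"] by auto
    have "range x \<subseteq> (\<Union>y\<in>F. cball y (e / 2))"
      by (rule order_trans[OF F(2)]) (intro UN_mono order_refl ball_subset_cball)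
    then have "closure (range x) \<subseteq> (\<Union>y\<in>F. cball y (e / 2))"
      by (rule closure_minimal) (intro closed_UN F(1) closed_cball ballI)
    also have "\<dots> \<subseteq> (\<Union>y\<in>F. ball y e)"
      using \<open>0 < e\<close> by (intro UN_mono) auto
    finally show "\<exists>F. finite F \<and> closure (range x) \<subseteq> (\<Union>y\<in>F. ball y e)"
      using F(1) by blast
  qed
  then have "seq_compact (closure (range x))"
    by (simp add: compact_eq_seq_compact_metric)
  moreover have "\<forall>n. x n \<in> closure (range x)"
    using closure_subset[of "range x"] by auto
  ultimately show ?thesis
    using seq_compactE[of "closure (range x)" x] by metis
qed

text \<open>From the index \<open>m * k\<close> on, the orbit stays close to the image under the
  compact \<open>V\<close> of a ball containing the orbit; the finitely many earlier points are
  added to the net.\<close>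

lemma orbit_convergent_subseq:
  fixes T :: "'e::banach \<Rightarrow>\<^sub>L 'e"
  assumes C: "\<And>n. norm (op_power T n) \<le> C" and ess: "ess_norm (op_power T m) < 1"
  shows "\<exists>l r. strict_mono (r :: nat \<Rightarrow> nat) \<and> ((\<lambda>n. op_power T n f) \<circ> r) \<longlonglongrightarrow> l"
proof (rule totally_bounded_imp_convergent_subseq)
  fix e :: real assume e: "0 < e"
  define D where "D = C * norm f + 1"
  have "0 \<le> C" using C[of 0] order_trans[OF norm_ge_zero] by blast
  then have D: "0 < D" unfolding D_def by (intro add_nonneg_pos mult_nonneg_nonneg) auto
  have fD: "norm (op_power T n f) \<le> D" for n
    using order_trans[OF norm_blinfun mult_right_mono[OF C norm_ge_zero]] by (simp add: D_def add_increasing2)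
  obtain k V where V: "compact_operator V" "norm (op_power T (m * k) - V) < e / (2 * D)"
    using ess_norm_op_power_decomposition[OF ess, of "e / (2 * D)"] e D by auto
  obtain K where K: "compact K" "blinfun_apply V ` cball 0 D \<subseteq> K"
    using compact_operator_cball[OF V(1) D] by blast
  obtain F where F: "finite F" "K \<subseteq> (\<Union>y\<in>F. ball y (e / 2))"
    using K(1) e unfolding compact_eq_totally_bounded by (meson half_gt_zero)
  define F' where "F' = F \<union> (\<lambda>n. op_power T n f) ` {..<m * k}"
  have "op_power T n f \<in> (\<Union>y\<in>F'. ball y e)" for n
  proof (cases "n < m * k")
    case True
    then have "op_power T n f \<in> F'" by (simp add: F'_def)
    then show ?thesis using e by force
  next
    case False
    define h where "h = op_power T (n - m * k) f"
    have eq: "op_power T n f = op_power T (m * k) h"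
      using op_power_add[of T "m * k" "n - m * k"] False by (simp add: h_def)
    have h: "norm h \<le> D" using fD by (simp add: h_def)
    then have "V h \<in> K" using K(2) by auto
    then obtain y where y: "y \<in> F" "dist y (V h) < e / 2"
      using F(2) by auto
    have "norm ((op_power T (m * k) - V) h) \<le> norm (op_power T (m * k) - V) * norm h"
      by (rule norm_blinfun)
    also have "\<dots> \<le> e / (2 * D) * D"
      using V(2) h e D by (intro mult_mono) auto
    finally have "dist (V h) (op_power T (m * k) h) \<le> e / 2"
      using D by (simp add: dist_norm norm_minus_commute blinfun.diff_left)
    with y(2) have "dist y (op_power T n f) < e"
      using dist_triangle[of y "op_power T n f" "V h"] by (simp add: eq)
    with y(1) show ?thesis by (auto simp: F'_def)
  qed
  moreover have "finite F'" using F(1) by (simp add: F'_def)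
  ultimately show "\<exists>F. finite F \<and> range (\<lambda>n. op_power T n f) \<subseteq> (\<Union>y\<in>F. ball y e)"
    by blast
qed

text \<open>Power boundedness makes the powers equicontinuous, so the Cauchy property at the points
  of a finite net carries over to all of \<open>K\<close>.\<close>

lemma power_bounded_Cauchy_uniform_on_compact:
  fixes T :: "'e::real_normed_vector \<Rightarrow>\<^sub>L 'e"
  assumes C: "\<And>n. norm (op_power T n) \<le> C" and Cauchy: "\<And>f. Cauchy (\<lambda>n. op_power T n f)"
    and "compact K" "0 < e"
  shows "\<exists>N. \<forall>i\<ge>N. \<forall>j\<ge>N. \<forall>y\<in>K. norm (op_power T i y - op_power T j y) < e"
proof -
  define d where "d = e / (3 * (C + 1))"
  have "0 \<le> C" using C[of 0] order_trans[OF norm_ge_zero] by blast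
  then have d: "0 < d" "C * d < e / 3"
    using \<open>0 < e\<close> by (auto simp: d_def field_simps intro!: add_nonneg_pos)
  obtain F where F: "finite F" "K \<subseteq> (\<Union>y\<in>F. ball y d)"
    using assms(3) d(1) unfolding compact_eq_totally_bounded by meson
  have "\<exists>N. \<forall>i\<ge>N. \<forall>j\<ge>N. dist (op_power T i y) (op_power T j y) < e / 3" for y
    using Cauchy[of y, unfolded Cauchy_def, rule_format, of "e / 3"] \<open>0 < e\<close> by auto
  then obtain N where N: "\<And>y i j. i \<ge> N y \<Longrightarrow> j \<ge> N y \<Longrightarrow> dist (op_power T i y) (op_power T j y) < e / 3"
    by metis
  \<comment> \<open>The sum is a common upper bound of the \<open>N y\<close>, also for an empty
    net.\<close>
  define M where "M = (\<Sum>y\<in>F. N y)"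
  have NM: "N y \<le> M" if "y \<in> F" for y
    unfolding M_def using F(1) that by (simp add: member_le_sum)
  show ?thesis
  proof (intro exI[of _ M] allI impI ballI)
    fix i j y assume ij: "i \<ge> M" "j \<ge> M" and "y \<in> K"
    then obtain z where z: "z \<in> F" "dist z y < d" using F(2) by auto
    have *: "dist (op_power T n y) (op_power T n z) < e / 3" for n
    proof -
      have "norm (op_power T n (y - z)) \<le> norm (op_power T n) * norm (y - z)"
        by (rule norm_blinfun)
      also have "\<dots> \<le> C * d"
        using C[of n] z(2) \<open>0 \<le> C\<close> by (intro mult_mono) (auto simp: dist_norm norm_minus_commute)
      finally show ?thesis using d(2) by (simp add: dist_norm blinfun.diff_right)
    qed
    have "dist (op_power T i z) (op_power T j z) < e / 3"
      using N NM[OF z(1)] ij order_trans by blast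
    then show "norm (op_power T i y - op_power T j y) < e"
      using *[of i] *[of j]
        dist_triangle[of "op_power T i y" "op_power T j y" "op_power T i z"]
        dist_triangle[of "op_power T i z" "op_power T j y" "op_power T j z"]
      by (simp add: dist_norm norm_minus_commute)
  qed
qed

text \<open>A difference of late powers is a difference \<open>W\<close> of powers applied after
  \<open>op_power T (m * k)\<close>. On the compact part \<open>V\<close> pointwise convergence is
  uniform; the remainder is small, and \<open>W\<close> is bounded.\<close>

lemma strongly_imp_uniformly_power_convergent:
  fixes T :: "'e::real_normed_vector \<Rightarrow>\<^sub>L 'e"
  assumes C: "\<And>n. norm (op_power T n) \<le> C" and Cauchy: "\<And>f. Cauchy (\<lambda>n. op_power T n f)"
    and ess: "ess_norm (op_power T m) < 1"
  shows "Cauchy (\<lambda>n. op_power T n)"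
  unfolding Cauchy_def
proof (intro allI impI)
  fix e :: real assume e: "0 < e"
  define d where "d = e / (6 * (C + 1))"
  have C0: "0 \<le> C" using C[of 0] order_trans[OF norm_ge_zero] by blast
  then have d: "0 < d" "2 * C * d < e / 3"
    using \<open>0 < e\<close> by (auto simp: d_def field_simps intro!: add_nonneg_pos)
  obtain k V where V: "compact_operator V" "norm (op_power T (m * k) - V) < d"
    using ess_norm_op_power_decomposition[OF ess d(1)] by blast
  obtain K where K: "compact K" "blinfun_apply V ` cball 0 1 \<subseteq> K"
    using compact_operator_cball[OF V(1) zero_less_one] by blast
  obtain N where N: "\<And>i j y. i \<ge> N \<Longrightarrow> j \<ge> N \<Longrightarrow> y \<in> K \<Longrightarrow> norm (op_power T i y - op_power T j y) < e / 3"
    using power_bounded_Cauchy_uniform_on_compact[OF C Cauchy K(1), of "e / 3"] e by auto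
  have le: "norm (op_power T (i + m * k) - op_power T (j + m * k)) \<le> 2 * e / 3"
    if ij: "i \<ge> N" "j \<ge> N" for i j
  proof -
    define W where "W = op_power T i - op_power T j"
    have "norm (W o\<^sub>L V) \<le> e / 3"
    proof (rule norm_blinfun_bound)
      show "0 \<le> e / 3" using e by simp
      show "norm ((W o\<^sub>L V) f) \<le> e / 3 * norm f" for f
      proof (cases "f = 0")
        case False
        then have "V (f /\<^sub>R norm f) \<in> K" using K(2) by auto
        then have "norm (W (V (f /\<^sub>R norm f))) < e / 3"
          using N[OF ij] by (simp add: W_def blinfun.diff_left)
        moreover have "norm (W (V (f /\<^sub>R norm f))) = norm (W (V f)) / norm f"
          by (simp add: blinfun.scaleR_right divide_inverse_commute)
        ultimately show ?thesis using False by (simp add: pos_divide_less_eq)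
      qed simp
    qed
    moreover have "norm (W o\<^sub>L (op_power T (m * k) - V)) \<le> e / 3"
    proof -
      have "norm W \<le> C + C"
        unfolding W_def using norm_triangle_ineq4 add_mono[OF C C] order_trans by blast
      then have "norm W * norm (op_power T (m * k) - V) \<le> (2 * C) * d"
        using V(2) C0 by (intro mult_mono) auto
      then show ?thesis
        using norm_blinfun_compose[of W "op_power T (m * k) - V"] d(2) by linarith
    qed
    moreover have "op_power T (i + m * k) - op_power T (j + m * k) =
        (W o\<^sub>L V) + (W o\<^sub>L (op_power T (m * k) - V))"
      by (rule blinfun_eqI) (simp add: op_power_add W_def blinfun.add_left blinfun.diff_left blinfun.diff_right)
    ultimately show ?thesis
      using norm_triangle_ineq[of "W o\<^sub>L V" "W o\<^sub>L (op_power T (m * k) - V)"] by simp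
  qed
  show "\<exists>M. \<forall>i\<ge>M. \<forall>j\<ge>M. dist (op_power T i) (op_power T j) < e"
  proof (intro exI[of _ "N + m * k"] allI impI)
    fix i j assume ij: "i \<ge> N + m * k" "j \<ge> N + m * k"
    then have "norm (op_power T (i - m * k + m * k) - op_power T (j - m * k + m * k)) \<le> 2 * e / 3"
      by (intro le) auto
    with ij e show "dist (op_power T i) (op_power T j) < e"
      by (simp add: dist_norm)
  qed
qed

lemma apply_bcontfun_limit:
  fixes x :: "nat \<Rightarrow> 'a::topological_space \<Rightarrow>\<^sub>C real"
  assumes "x \<longlonglongrightarrow> l"
  shows "(\<lambda>n. apply_bcontfun (x n) a) \<longlonglongrightarrow> apply_bcontfun l a"
  by (rule tendsto_uniform_limitI[OF tendsto_bcontfun_uniform_limit[OF assms] UNIV_I])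

lemma op_power_approximate_fixed_point:
  fixes T :: "'e::real_normed_vector \<Rightarrow>\<^sub>L 'e"
  assumes "(\<lambda>k. T (x k) - x k) \<longlonglongrightarrow> 0"
  shows "(\<lambda>k. op_power T j (x k) - x k) \<longlonglongrightarrow> 0"
proof (induction j)
  case (Suc j)
  have "(\<lambda>k. T (op_power T j (x k) - x k) + (T (x k) - x k)) \<longlonglongrightarrow> T 0 + 0"
    by (intro tendsto_add assms bounded_linear.tendsto[OF blinfun.bounded_linear_right] Suc)
  then show ?case
    by (simp add: op_power_Suc blinfun.diff_right)
qed simp

text \<open>For approximately fixed unit vectors, \<open>u k - Q (u k)\<close> differs from
  \<open>V (u k)\<close> by a null sequence, so it converges along the subsequence chosen for
  \<open>V\<close>. As \<open>norm Q < 1\<close>, the identity minus \<open>Q\<close> is bounded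
  below, which makes \<open>u\<close> itself Cauchy.\<close>

lemma quasi_compact_fixed_point:
  fixes T :: "('a::topological_space \<Rightarrow>\<^sub>C real) \<Rightarrow>\<^sub>L ('a \<Rightarrow>\<^sub>C real)"
  assumes T: "positive_operator T" "growth_bounded T 1" "\<And>n. 1 \<le> norm (op_power T n)"
    and ess: "ess_norm (op_power T m) < 1"
  shows "\<exists>l. norm l = 1 \<and> (\<forall>a. 0 \<le> apply_bcontfun l a) \<and> T l = l"
proof -
  obtain x where x: "\<And>k. norm (x k) = 1" "\<And>k a. 0 \<le> apply_bcontfun (x k) a"
    "(\<lambda>k. T (x k) - x k) \<longlonglongrightarrow> 0"
    using positive_approximate_eigenvectors[OF T(1,2)] T(3) by auto
  obtain V where V: "compact_operator V" "norm (op_power T m - V) < 1"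
    using ess_norm_lessE[OF ess] by blast
  define Q where "Q = op_power T m - V"
  obtain K where K: "compact K" "blinfun_apply V ` cball 0 1 \<subseteq> K"
    using compact_operator_cball[OF V(1) zero_less_one] by blast
  have "seq_compact K" "\<forall>k. V (x k) \<in> K"
    using K x(1) by (auto simp: compact_eq_seq_compact_metric image_subset_iff)
  then obtain y r where r: "strict_mono (r :: nat \<Rightarrow> nat)" and y: "((\<lambda>k. V (x k)) \<circ> r) \<longlonglongrightarrow> y"
    using seq_compactE[of K "\<lambda>k. V (x k)"] by metis
  define u where "u = x \<circ> r"
  have Tu: "(\<lambda>k. T (u k) - u k) \<longlonglongrightarrow> 0"
    using LIMSEQ_subseq_LIMSEQ[OF x(3) r] by (simp add: u_def comp_def)
  have "(\<lambda>k. V (u k) - (op_power T m (u k) - u k)) \<longlonglongrightarrow> y - 0"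
    using y by (intro tendsto_diff op_power_approximate_fixed_point Tu) (simp add: u_def comp_def)
  then have "Cauchy (\<lambda>k. V (u k) - (op_power T m (u k) - u k))"
    by (rule LIMSEQ_imp_Cauchy)
  then have CQ: "Cauchy (\<lambda>k. u k - Q (u k))"
    by (simp add: Q_def blinfun.diff_left algebra_simps)
  have Q1: "0 < 1 - norm Q" using V(2) by (simp add: Q_def)
  have contr: "(1 - norm Q) * norm (u i - u j) \<le> dist (u i - Q (u i)) (u j - Q (u j))" for i j
  proof -
    have "norm (u i - u j) = norm (((u i - Q (u i)) - (u j - Q (u j))) + Q (u i - u j))"
      by (simp add: blinfun.diff_right)
    also have "\<dots> \<le> dist (u i - Q (u i)) (u j - Q (u j)) + norm Q * norm (u i - u j)"
      using norm_triangle_ineq norm_blinfun add_left_mono order_trans unfolding dist_norm by meson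
    finally show ?thesis by (simp add: algebra_simps)
  qed
  have "Cauchy u"
    unfolding Cauchy_def
  proof (intro allI impI)
    fix e :: real assume "0 < e"
    then obtain M where M: "\<And>i j. i \<ge> M \<Longrightarrow> j \<ge> M \<Longrightarrow> dist (u i - Q (u i)) (u j - Q (u j)) < (1 - norm Q) * e"
      using CQ mult_pos_pos[OF Q1] unfolding Cauchy_def by meson
    have "dist (u i) (u j) < e" if "i \<ge> M" "j \<ge> M" for i j
      using le_less_trans[OF contr M[OF that]] Q1 by (simp add: dist_norm)
    then show "\<exists>M. \<forall>i\<ge>M. \<forall>j\<ge>M. dist (u i) (u j) < e" by blast
  qed
  then obtain l where l: "u \<longlonglongrightarrow> l"
    using Cauchy_convergent_iff convergent_def by metis
  have "norm l = 1"
    using LIMSEQ_unique[OF tendsto_norm[OF l]] x(1) by (simp add: u_def)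
  moreover have "0 \<le> apply_bcontfun l a" for a
    by (rule LIMSEQ_le_const[OF apply_bcontfun_limit[OF l, of a]]) (use x(2) in \<open>simp add: u_def\<close>)
  moreover have "T l - l = 0"
    by (rule LIMSEQ_unique[OF _ Tu])
      (intro tendsto_diff l bounded_linear.tendsto[OF blinfun.bounded_linear_right])
  ultimately show ?thesis by auto
qed

text \<open>The limit \<open>l\<close> of the averages of 1 is fixed. If it were 0, positivity would
  give some average \<open>A n\<close> with norm at most 1/2; but approximate eigenvectors for 1 are
  almost fixed by \<open>A n\<close> as well.\<close>

lemma mean_ergodic_fixed_point:
  fixes T :: "('a::topological_space \<Rightarrow>\<^sub>C real) \<Rightarrow>\<^sub>L ('a \<Rightarrow>\<^sub>C real)"
  assumes T: "positive_operator T" "growth_bounded T 1" "\<And>n. 1 \<le> norm (op_power T n)"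
    and erg: "mean_ergodic T"
  shows "\<exists>l. l \<noteq> 0 \<and> (\<forall>a. 0 \<le> apply_bcontfun l a) \<and> T l = l"
proof -
  define A where "A n = (1 / real n) *\<^sub>R (\<Sum>j<n. op_power T j)" for n
  have A: "A n f = (1 / real n) *\<^sub>R (\<Sum>j<n. op_power T j f)" for n f
    by (simp add: A_def blinfun.scaleR_left blinfun.sum_left)
  obtain l where l: "(\<lambda>n. A n one_bcontfun) \<longlonglongrightarrow> l"
    using erg unfolding mean_ergodic_def convergent_def A by blast
  have posA: "positive_operator (A n)" for n
    unfolding positive_operator_def
  proof (intro allI impI)
    fix f :: "'a \<Rightarrow>\<^sub>C real" and a assume f: "\<forall>a. 0 \<le> apply_bcontfun f a"
    then have nn: "0 \<le> apply_bcontfun (op_power T j f) a" for j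
      by (intro positive_operatorD positive_operator_power T(1)) simp
    have "apply_bcontfun (\<Sum>j<k. op_power T j f) a = (\<Sum>j<k. apply_bcontfun (op_power T j f) a)" for k
      by (induction k) auto
    then show "0 \<le> apply_bcontfun (A n f) a"
      by (auto simp: A intro!: divide_nonneg_nonneg sum_nonneg nn)
  qed
  have l0: "0 \<le> apply_bcontfun l a" for a
    by (rule LIMSEQ_le_const[OF apply_bcontfun_limit[OF l, of a]])
      (intro exI[of _ 0] allI impI positive_operatorD[OF posA], simp add: const_bcontfun.rep_eq)
  \<comment> \<open>The powers of \<open>T\<close> are not known to be bounded here. Expressing the
    image of an average through the next average avoids estimating
    \<open>op_power T n one_bcontfun\<close> divided by \<open>n\<close>.\<close>
  have TA: "T (A n one_bcontfun) = ((real n + 1) / real n) *\<^sub>R A (Suc n) one_bcontfun - (1 / real n) *\<^sub>R one_bcontfun"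
    if "n \<ge> 1" for n
  proof -
    have "T (\<Sum>j<n. op_power T j one_bcontfun) + one_bcontfun = (\<Sum>j<Suc n. op_power T j one_bcontfun)"
      by (simp only: sum.lessThan_Suc_shift) (simp add: blinfun.sum_right op_power_Suc)
    moreover have c: "(real n + 1) / real n * (1 / real (Suc n)) = 1 / real n"
      using that by (simp add: field_simps)
    ultimately have "T (\<Sum>j<n. op_power T j one_bcontfun) = (\<Sum>j<Suc n. op_power T j one_bcontfun) - one_bcontfun"
      by (simp only: eq_diff_eq)
    with c show ?thesis
      by (simp only: A blinfun.scaleR_right scaleR_scaleR c scaleR_diff_right)
  qed
  have "(\<lambda>n. (1 + inverse (real n)) *\<^sub>R A (Suc n) one_bcontfun - inverse (real n) *\<^sub>R one_bcontfun)
      \<longlonglongrightarrow> (1 + 0) *\<^sub>R l - 0 *\<^sub>R one_bcontfun"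
    by (intro tendsto_intros lim_inverse_n LIMSEQ_Suc[OF l])
  then have "(\<lambda>n. T (A n one_bcontfun)) \<longlonglongrightarrow> (1 + 0) *\<^sub>R l - 0 *\<^sub>R one_bcontfun"
    by (rule Lim_transform_eventually)
      (rule eventually_sequentiallyI[of 1], simp add: TA field_simps)
  moreover have "(\<lambda>n. T (A n one_bcontfun)) \<longlonglongrightarrow> T l"
    by (intro bounded_linear.tendsto[OF blinfun.bounded_linear_right] l)
  ultimately have "T l = (1 + 0) *\<^sub>R l - 0 *\<^sub>R one_bcontfun"
    by (rule LIMSEQ_unique[rotated])
  then have Tl: "T l = l"
    by simp
  have "l \<noteq> 0"
  proof
    assume "l = 0"
    then have "(\<lambda>n. norm (A n one_bcontfun)) \<longlonglongrightarrow> 0"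
      using l tendsto_norm_zero by blast
    then have "eventually (\<lambda>n. norm (A n one_bcontfun) < 1 / 2 \<and> n \<ge> 1) sequentially"
      by (intro eventually_conj order_tendstoD(2)[where y = 0] eventually_ge_at_top) auto
    from eventually_happens'[OF sequentially_bot this]
    obtain n where n: "norm (A n one_bcontfun) < 1 / 2" "n \<ge> 1" by blast
    have nA: "norm (A n) \<le> 1 / 2"
      using n(1) abs_apply_bcontfun_le[of "A n one_bcontfun"]
      by (intro norm_positive_operator_le posA) (smt (verit))
    obtain x where x: "\<And>k. norm (x k) = 1" "(\<lambda>k. T (x k) - x k) \<longlonglongrightarrow> 0"
      using positive_approximate_eigenvectors[OF T(1,2)] T(3) by auto
    have "(\<lambda>k. (1 / real n) *\<^sub>R (\<Sum>j<n. op_power T j (x k) - x k)) \<longlonglongrightarrow> (1 / real n) *\<^sub>R (\<Sum>j<n. 0)"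
      by (intro tendsto_scaleR tendsto_const tendsto_sum op_power_approximate_fixed_point x)
    moreover have "(1 / real n) *\<^sub>R (\<Sum>j<n. op_power T j (x k) - x k) = A n (x k) - x k" for k
      using n(2) by (simp add: A sum_subtractf scaleR_diff_right sum_constant_scaleR)
    ultimately have "(\<lambda>k. norm (A n (x k) - x k)) \<longlonglongrightarrow> 0"
      using tendsto_norm_zero by simp
    moreover have "1 / 2 \<le> norm (A n (x k) - x k)" for k
    proof -
      have "norm (A n (x k)) \<le> 1 / 2"
        using norm_blinfun[of "A n" "x k"] nA x(1) by simp
      then show ?thesis
        using norm_triangle_ineq2[of "x k" "A n (x k)"] x(1)[of k] by (simp add: norm_minus_commute)
    qed
    ultimately have "1 / 2 \<le> (0::real)"
      by (intro LIMSEQ_le_const) auto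
    then show False by simp
  qed
  with l0 Tl show ?thesis by blast
qed

text \<open>Irreducibility in the strong form that primitivity gives: one power works at all letters
  at once. The locale serves both \<open>M\<close>, where the eigenvalue of a length function is
  still unknown, and \<open>T\<close>, where it is 1.\<close>

locale irreducible_positive_operator =
  fixes T :: "('a::topological_space \<Rightarrow>\<^sub>C real) \<Rightarrow>\<^sub>L ('a \<Rightarrow>\<^sub>C real)"
  assumes compact_space: "compact (UNIV :: 'a set)"
    and positive: "positive_operator T"
    and irreducible: "(\<And>a. 0 \<le> apply_bcontfun f a) \<Longrightarrow> f \<noteq> 0 \<Longrightarrow>
      \<exists>n\<ge>1. \<forall>a. 0 < apply_bcontfun (blinfun_apply (op_power T n) f) a"
begin

lemma positive_lower_bound:
  fixes f :: "'a \<Rightarrow>\<^sub>C real"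
  assumes "\<And>a. 0 < apply_bcontfun f a"
  obtains d where "0 < d" "\<And>a. d \<le> apply_bcontfun f a"
proof -
  obtain b where "\<forall>a\<in>UNIV. apply_bcontfun f b \<le> apply_bcontfun f a"
    using continuous_attains_inf[OF compact_space, of "apply_bcontfun f"] by auto
  with that[of "apply_bcontfun f b"] assms show thesis by simp
qed

lemma op_power_eigenvector:
  assumes "T l = c *\<^sub>R l"
  shows "op_power T n l = c ^ n *\<^sub>R l"
  by (induction n) (simp_all add: op_power_Suc blinfun.scaleR_right assms)

text \<open>Some power with \<open>n \<ge> 1\<close> makes \<open>l\<close> strictly positive, and
  this image is just \<open>c ^ n *\<^sub>R l\<close>, so both factors are positive.\<close>

lemma eigenfunction_positive:
  assumes l: "l \<noteq> 0" "\<And>a. 0 \<le> apply_bcontfun l a" and c: "0 \<le> c" "T l = c *\<^sub>R l"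
  shows "0 < c" "0 < apply_bcontfun l a"
proof -
  obtain n where n: "n \<ge> 1" "\<forall>a. 0 < apply_bcontfun (op_power T n l) a"
    using irreducible[OF l(2,1)] by blast
  then have "0 < c ^ n * apply_bcontfun l a" for a
    by (simp add: op_power_eigenvector[OF c(2)])
  with l(2) c(1) have pos: "0 < c ^ n" "0 < apply_bcontfun l a" for a
    by (auto simp: zero_less_mult_iff not_less[symmetric])
  show "0 < apply_bcontfun l a" by (rule pos(2))
  show "0 < c"
    using pos(1) n(1) c(1) by (cases "c = 0") (auto simp: power_0_left)
qed

text \<open>Positivity and compactness sandwich the constant 1 between two multiples of
  \<open>l\<close>, namely \<open>l / norm l \<le> 1 \<le> l / d\<close>. Applying powers replaces
  \<open>l\<close> by \<open>c ^ n *\<^sub>R l\<close>.\<close>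

lemma eigenfunction_growth:
  assumes l: "l \<noteq> 0" "\<And>a. 0 \<le> apply_bcontfun l a" and c: "0 \<le> c" "T l = c *\<^sub>R l"
  shows "\<exists>\<alpha>>0. \<exists>\<beta>>0. \<forall>n a. \<alpha> * c ^ n \<le> apply_bcontfun (op_power T n one_bcontfun) a \<and>
    apply_bcontfun (op_power T n one_bcontfun) a \<le> \<beta> * c ^ n"
proof -
  note pos = eigenfunction_positive[OF assms]
  obtain d where d: "0 < d" "\<And>a. d \<le> apply_bcontfun l a"
    using positive_lower_bound[of l] pos(2) by blast
  have nl: "0 < norm l" using l(1) by simp
  have "(d / norm l) * c ^ n \<le> apply_bcontfun (op_power T n one_bcontfun) a \<and>
    apply_bcontfun (op_power T n one_bcontfun) a \<le> (norm l / d) * c ^ n" for n a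
  proof
    have "apply_bcontfun (op_power T n (d *\<^sub>R one_bcontfun)) a \<le> apply_bcontfun (op_power T n l) a"
      by (intro positive_operator_mono positive_operator_power positive) (simp add: d const_bcontfun.rep_eq)
    then have "d * apply_bcontfun (op_power T n one_bcontfun) a \<le> c ^ n * apply_bcontfun l a"
      by (simp add: op_power_eigenvector[OF c(2)] blinfun.scaleR_right)
    also have "\<dots> \<le> c ^ n * norm l"
      using abs_apply_bcontfun_le[of l a] c(1) by (intro mult_left_mono) auto
    finally show "apply_bcontfun (op_power T n one_bcontfun) a \<le> (norm l / d) * c ^ n"
      using d(1) by (simp add: field_simps)
    have "apply_bcontfun (op_power T n l) a \<le> apply_bcontfun (op_power T n (norm l *\<^sub>R one_bcontfun)) a"
      using abs_apply_bcontfun_le[of l]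
      by (intro positive_operator_mono positive_operator_power positive) (simp add: const_bcontfun.rep_eq abs_le_iff)
    then have le: "c ^ n * apply_bcontfun l a \<le> norm l * apply_bcontfun (op_power T n one_bcontfun) a"
      by (simp add: op_power_eigenvector[OF c(2)] blinfun.scaleR_right)
    have "c ^ n * d \<le> c ^ n * apply_bcontfun l a"
      using d(2) c(1) by (intro mult_left_mono) auto
    then show "(d / norm l) * c ^ n \<le> apply_bcontfun (op_power T n one_bcontfun) a"
      using le nl by (simp add: field_simps)
  qed
  moreover have "0 < d / norm l" "0 < norm l / d" using d nl by auto
  ultimately show ?thesis by blast
qed

lemma power_bounded:
  assumes l: "l \<noteq> 0" "\<And>a. 0 \<le> apply_bcontfun l a" "T l = l"
  shows "\<exists>C. \<forall>n. norm (op_power T n) \<le> C"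
proof -
  obtain \<beta> where "\<And>n a. apply_bcontfun (op_power T n one_bcontfun) a \<le> \<beta> * 1 ^ n"
    using eigenfunction_growth[OF l(1,2), of 1] l(3) by auto
  then have "norm (op_power T n) \<le> \<beta>" for n
    by (intro norm_positive_operator_le positive_operator_power positive) simp
  then show ?thesis by blast
qed

text \<open>The supremum of \<open>T\<^sup>n f / l\<close> decreases to a limit \<open>M\<close>, so every limit point \<open>g\<close> of the orbit
  satisfies \<open>sup (T\<^sup>n g / l) = M\<close> for all \<open>n\<close>; if \<open>g \<noteq> M l\<close>, irreducibility would push the supremum
  strictly below \<open>M\<close>.\<close>

lemma orbit_convergent:
  assumes l: "l \<noteq> 0" "\<And>a. 0 \<le> apply_bcontfun l a" "T l = l"
    and r: "strict_mono (r :: nat \<Rightarrow> nat)" and g: "((\<lambda>n. op_power T n f) \<circ> r) \<longlonglongrightarrow> g"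
  shows "\<exists>c. (\<lambda>n. op_power T n f) \<longlonglongrightarrow> c *\<^sub>R l"
proof -
  have lpos: "0 < apply_bcontfun l a" for a
    using eigenfunction_positive(2)[OF l(1,2), of 1] l(3) by simp
  obtain d where d: "0 < d" "\<And>a. d \<le> apply_bcontfun l a"
    using positive_lower_bound[of l] lpos by blast
  obtain C where C: "\<And>n. norm (op_power T n) \<le> C"
    using power_bounded[OF l] by blast
  have Tl: "op_power T n l = l" for n
    using op_power_eigenvector[of l 1] l(3) by simp
  \<comment> \<open>The upper gauge relative to \<open>l\<close>: Lipschitz with constant
    \<open>1 / d\<close>, and not increased by powers of \<open>T\<close>, which are positive and
    fix \<open>l\<close>.\<close>
  define R where "R h = (SUP a. apply_bcontfun h a / apply_bcontfun l a)" for h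
  have h_le: "apply_bcontfun h a / apply_bcontfun l a \<le> norm h / d" for h a
    using abs_apply_bcontfun_le[of h a] d(1) d(2)[of a] by (intro frac_le) auto
  have bdd: "bdd_above (range (\<lambda>a. apply_bcontfun h a / apply_bcontfun l a))" for h
    using h_le by (rule bdd_aboveI2)
  have R_upper: "apply_bcontfun h a \<le> R h * apply_bcontfun l a" for h a
    using cSUP_upper[OF _ bdd, of a h] lpos[of a] by (simp add: R_def pos_divide_le_eq)
  have R_least: "R h \<le> c" if "\<And>a. apply_bcontfun h a \<le> c * apply_bcontfun l a" for h c
    unfolding R_def using that lpos by (intro cSUP_least) (auto simp: pos_divide_le_eq)
  have R_T: "R (op_power T n h) \<le> R h" for n h
  proof (rule R_least)
    fix a
    have "apply_bcontfun (op_power T n h) a \<le> apply_bcontfun (op_power T n (R h *\<^sub>R l)) a"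
      using R_upper by (intro positive_operator_mono positive_operator_power positive) simp
    then show "apply_bcontfun (op_power T n h) a \<le> R h * apply_bcontfun l a"
      by (simp add: blinfun.scaleR_right Tl)
  qed
  have R_diff: "R h \<le> R k + norm (h - k) / d" for h k
  proof (rule R_least)
    fix a
    have "apply_bcontfun h a = apply_bcontfun k a + apply_bcontfun (h - k) a" by simp
    also have "\<dots> \<le> R k * apply_bcontfun l a + norm (h - k) / d * apply_bcontfun l a"
      using h_le[of "h - k" a] lpos[of a] by (intro add_mono R_upper) (simp add: pos_divide_le_eq)
    finally show "apply_bcontfun h a \<le> (R k + norm (h - k) / d) * apply_bcontfun l a"
      by (simp add: distrib_right)
  qed
  have R_lim: "(\<lambda>n. R (x n)) \<longlonglongrightarrow> R k" if "x \<longlonglongrightarrow> k" for x k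
  proof -
    have lim: "(\<lambda>n. norm (x n - k) / d) \<longlonglongrightarrow> 0 / d"
      using that d(1) by (intro tendsto_divide tendsto_const tendsto_norm_zero) (auto simp: LIM_zero_iff)
    have le: "norm (R (x n) - R k) \<le> norm (x n - k) / d" for n
      using R_diff[of "x n" k] R_diff[of k "x n"] by (simp add: norm_minus_commute abs_le_iff)
    have "(\<lambda>n. R (x n) - R k) \<longlonglongrightarrow> 0"
      by (rule Lim_null_comparison[OF always_eventually lim[unfolded div_0]]) (rule allI, rule le)
    then show ?thesis by (simp add: LIM_zero_iff)
  qed
  define x where "x n = op_power T n f" for n
  have x_add: "x (n + m) = op_power T n (x m)" for n m
    by (simp add: x_def op_power_add)
  have "decseq (\<lambda>n. R (x n))"
    unfolding decseq_Suc_iff using R_T[of 1] x_add[of 1] by simp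
  moreover have "- (C * norm f / d) \<le> R (x n)" for n
  proof -
    have "norm (x n) \<le> C * norm f"
      unfolding x_def using norm_blinfun C mult_right_mono[OF C norm_ge_zero] order_trans by blast
    then have "norm (x n) / d \<le> C * norm f / d"
      using d(1) by (simp add: divide_right_mono)
    moreover have "- R (x n) \<le> norm (x n) / d"
      using R_diff[of 0 "x n"] by (simp add: R_def)
    ultimately show ?thesis by linarith
  qed
  ultimately obtain M where M: "(\<lambda>n. R (x n)) \<longlonglongrightarrow> M"
    using decseq_convergent by metis
  have xr: "(\<lambda>k. x (r k)) \<longlonglongrightarrow> g"
    using g by (simp add: x_def comp_def)
  have RT: "R (op_power T j g) = M" for j
  proof -
    have "(\<lambda>k. op_power T j (x (r k))) \<longlonglongrightarrow> op_power T j g"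
      by (intro bounded_linear.tendsto[OF blinfun.bounded_linear_right] xr)
    then have "(\<lambda>k. R (x (j + r k))) \<longlonglongrightarrow> R (op_power T j g)"
      unfolding x_add by (rule R_lim)
    moreover have "(\<lambda>k. R (x (j + r k))) \<longlonglongrightarrow> M"
    proof -
      have "strict_mono (\<lambda>k. j + r k)"
        using r by (simp add: strict_mono_def)
      then show ?thesis
        using LIMSEQ_subseq_LIMSEQ[OF M] by (simp add: comp_def)
    qed
    ultimately show ?thesis by (rule LIMSEQ_unique)
  qed
  have "M *\<^sub>R l - g = 0"
  proof (rule ccontr)
    assume "M *\<^sub>R l - g \<noteq> 0"
    moreover have "0 \<le> apply_bcontfun (M *\<^sub>R l - g) a" for a
      using R_upper[of g a] RT[of 0] by simp
    ultimately obtain n where "\<And>a. 0 < apply_bcontfun (op_power T n (M *\<^sub>R l - g)) a"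
      using irreducible by blast
    then obtain e where e: "0 < e" "\<And>a. e \<le> apply_bcontfun (op_power T n (M *\<^sub>R l - g)) a"
      using positive_lower_bound by blast
    have nl: "0 < norm l" using l(1) by simp
    \<comment> \<open>The uniform gap \<open>e\<close> below \<open>M *\<^sub>R l\<close> becomes a
      gap relative to \<open>l\<close>, since \<open>l\<close> is at most \<open>norm l\<close>
      pointwise.\<close>
    have "R (op_power T n g) \<le> M - e / norm l"
    proof (rule R_least)
      fix a
      have "e / norm l * apply_bcontfun l a \<le> e / norm l * norm l"
        using e(1) nl abs_apply_bcontfun_le[of l a] by (intro mult_left_mono) auto
      also have "\<dots> \<le> apply_bcontfun (op_power T n (M *\<^sub>R l - g)) a"
        using e(2) nl by simp
      finally show "apply_bcontfun (op_power T n g) a \<le> (M - e / norm l) * apply_bcontfun l a"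
        by (simp add: blinfun.diff_right blinfun.scaleR_right Tl algebra_simps)
    qed
    with RT[of n] divide_pos_pos[OF e(1) nl] show False
      by linarith
  qed
  then have gM: "g = M *\<^sub>R l" by simp
  \<comment> \<open>One orbit point close to the fixed vector keeps the rest of the orbit close, by
    power boundedness; this upgrades convergence of the subsequence.\<close>
  have "x \<longlonglongrightarrow> M *\<^sub>R l"
    unfolding LIMSEQ_iff
  proof (intro allI impI)
    fix e :: real assume e: "0 < e"
    have C0: "0 \<le> C" using C[of 0] order_trans[OF norm_ge_zero] by blast
    then have "0 < e / (C + 1)" using e by (simp add: add_nonneg_pos)
    then obtain k where k: "norm (x (r k) - M *\<^sub>R l) < e / (C + 1)"
      using xr unfolding gM LIMSEQ_iff by (meson order_refl)
    show "\<exists>N. \<forall>n\<ge>N. norm (x n - M *\<^sub>R l) < e"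
    proof (intro exI[of _ "r k"] allI impI)
      fix n assume n: "r k \<le> n"
      have "x n - M *\<^sub>R l = op_power T (n - r k) (x (r k) - M *\<^sub>R l)"
        using x_add[of "n - r k" "r k"] n by (simp add: blinfun.diff_right blinfun.scaleR_right Tl)
      then have "norm (x n - M *\<^sub>R l) \<le> C * norm (x (r k) - M *\<^sub>R l)"
        using norm_blinfun[of "op_power T (n - r k)" "x (r k) - M *\<^sub>R l"]
          mult_right_mono[OF C[of "n - r k"] norm_ge_zero[of "x (r k) - M *\<^sub>R l"]] by simp
      also have "\<dots> \<le> (C + 1) * norm (x (r k) - M *\<^sub>R l)"
        by (intro mult_right_mono) auto
      also have "\<dots> < e"
        using k C0 by (simp add: pos_less_divide_eq mult.commute add_nonneg_pos)
      finally show "norm (x n - M *\<^sub>R l) < e" .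
    qed
  qed
  then show ?thesis
    unfolding x_def by blast
qed

lemma quasi_compact_strong_convergence:
  assumes growth: "growth_bounded T 1" "\<And>n. 1 \<le> norm (op_power T n)"
    and ess: "ess_norm (op_power T m) < 1"
  shows "\<exists>l. (\<forall>a. 0 < apply_bcontfun l a) \<and> T l = l \<and> (\<forall>f. \<exists>c. (\<lambda>n. op_power T n f) \<longlonglongrightarrow> c *\<^sub>R l)"
proof -
  obtain l where l: "norm l = 1" "\<And>a. 0 \<le> apply_bcontfun l a" "T l = l"
    using quasi_compact_fixed_point[OF positive growth ess] by blast
  then have l0: "l \<noteq> 0" by auto
  obtain C where C: "\<And>n. norm (op_power T n) \<le> C"
    using power_bounded[OF l0 l(2,3)] by blast
  have "\<exists>c. (\<lambda>n. op_power T n f) \<longlonglongrightarrow> c *\<^sub>R l" for f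
  proof -
    obtain g r where "strict_mono (r :: nat \<Rightarrow> nat)" "((\<lambda>n. op_power T n f) \<circ> r) \<longlonglongrightarrow> g"
      using orbit_convergent_subseq[OF C ess, of f] by blast
    then show ?thesis by (rule orbit_convergent[OF l0 l(2,3)])
  qed
  moreover have "0 < apply_bcontfun l a" for a
    using eigenfunction_positive(2)[OF l0 l(2), of 1] l(3) by simp
  ultimately show ?thesis using l(3) by blast
qed

lemma quasi_compact_imp_uniformly_power_convergent:
  assumes growth: "growth_bounded T 1" "\<And>n. 1 \<le> norm (op_power T n)"
    and ess: "ess_norm (op_power T m) < 1"
  shows "uniformly_power_convergent T"
proof -
  obtain l where l: "\<And>a. 0 < apply_bcontfun l a" "T l = l"
    "\<And>f. \<exists>c. (\<lambda>n. op_power T n f) \<longlonglongrightarrow> c *\<^sub>R l"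
    using quasi_compact_strong_convergence[OF assms] by blast
  have "l \<noteq> 0" using l(1)[of undefined] by auto
  then obtain C where C: "\<And>n. norm (op_power T n) \<le> C"
    using power_bounded[of l] l(1,2) less_imp_le by blast
  have "Cauchy (\<lambda>n. op_power T n f)" for f
    using l(3)[of f] LIMSEQ_imp_Cauchy by blast
  then have "Cauchy (\<lambda>n. op_power T n)"
    using C ess by (intro strongly_imp_uniformly_power_convergent)
  then show ?thesis
    unfolding uniformly_power_convergent_def by (rule Cauchy_convergent)
qed

end

text \<open>Subtracting the rank-one operator \<open>f \<mapsto> e f(p) 1\<close> from \<open>T\<^sup>N\<close> leaves a positive operator
  whose powers tend to \<open>0\<close>.\<close>

lemma minorised_imp_ess_norm_less_one:
  fixes T :: "('a::topological_space \<Rightarrow>\<^sub>C real) \<Rightarrow>\<^sub>L ('a \<Rightarrow>\<^sub>C real)"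
  assumes T: "positive_operator T"
    and bounds: "\<And>n a. \<alpha> \<le> apply_bcontfun (op_power T n one_bcontfun) a"
      "\<And>n a. apply_bcontfun (op_power T n one_bcontfun) a \<le> \<beta>"
    and pos: "0 < \<alpha>" "0 < e" "1 \<le> N"
    and minor: "\<And>f a. (\<And>a. 0 \<le> apply_bcontfun f a) \<Longrightarrow>
      e * apply_bcontfun f p \<le> apply_bcontfun (op_power T N f) a"
  shows "\<exists>m\<ge>1. ess_norm (op_power T m) < 1"
proof -
  define v :: "('a \<Rightarrow>\<^sub>C real) \<Rightarrow> ('a \<Rightarrow>\<^sub>C real)" where "v f = (e * apply_bcontfun f p) *\<^sub>R one_bcontfun" for f
  have "bounded_linear v"
  proof (rule bounded_linear_intro[where K = e])
    show "v (f + g) = v f + v g" for f g by (simp add: v_def distrib_left scaleR_add_left)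
    show "v (c *\<^sub>R f) = c *\<^sub>R v f" for c f by (simp add: v_def)
    show "norm (v f) \<le> norm f * e" for f
      using abs_apply_bcontfun_le[of f p] pos(2) by (simp add: v_def abs_mult mult.commute)
  qed
  then have V: "Blinfun v f = v f" for f
    by (simp add: bounded_linear_Blinfun_apply)
  have cV: "compact_operator (Blinfun v)"
  proof (rule compact_operatorI)
    show "compact ((\<lambda>c. c *\<^sub>R one_bcontfun) ` cball (0::real) e :: ('a \<Rightarrow>\<^sub>C real) set)"
      by (intro compact_continuous_image continuous_intros compact_cball)
    show "blinfun_apply (Blinfun v) ` cball 0 1 \<subseteq> (\<lambda>c. c *\<^sub>R one_bcontfun) ` cball 0 e"
    proof (rule image_subsetI)
      fix f :: "'a \<Rightarrow>\<^sub>C real" assume "f \<in> cball 0 1"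
      then have "\<bar>apply_bcontfun f p\<bar> \<le> 1"
        using abs_apply_bcontfun_le[of f p] by simp
      then have "e * apply_bcontfun f p \<in> cball 0 e"
        using pos(2) mult_left_mono[of "\<bar>apply_bcontfun f p\<bar>" 1 e] by (simp add: abs_mult)
      then show "Blinfun v f \<in> (\<lambda>c. c *\<^sub>R one_bcontfun) ` cball 0 e"
        unfolding V v_def by (rule imageI)
    qed
  qed
  define Q where "Q = op_power T N - Blinfun v"
  have Qf: "apply_bcontfun (Q f) a = apply_bcontfun (op_power T N f) a - e * apply_bcontfun f p" for f a
    by (simp add: Q_def blinfun.diff_left V v_def const_bcontfun.rep_eq)
  have Q: "positive_operator Q"
    unfolding positive_operator_def using minor by (simp add: Qf)
  \<comment> \<open>Subtracting the rank-one part removes at least \<open>e * \<alpha>\<close> from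
    a function that is at most \<open>\<beta>\<close>, hence at least this fraction of it.\<close>
  define \<delta> where "\<delta> = e * \<alpha> / \<beta>"
  have \<beta>: "0 < \<beta>" using bounds pos(1) order_trans less_le_trans by blast
  have \<delta>: "0 < \<delta>" using pos \<beta> by (simp add: \<delta>_def)
  let ?u = "\<lambda>n. op_power T n one_bcontfun"
  have Qu: "apply_bcontfun (Q (?u j)) a \<le> (1 - \<delta>) * apply_bcontfun (?u (j + N)) a" for j a
  proof -
    have "\<delta> * apply_bcontfun (?u (j + N)) a \<le> \<delta> * \<beta>"
      using \<delta> bounds(2) by (intro mult_left_mono) auto
    also have "\<dots> = e * \<alpha>" using \<beta> by (simp add: \<delta>_def)
    also have "\<dots> \<le> e * apply_bcontfun (?u j) p"
      using pos bounds(1) by (intro mult_left_mono) auto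
    finally show ?thesis
      by (simp add: Qf algebra_simps op_power_add flip: add.commute[of N j])
  qed
  have \<delta>1: "0 \<le> 1 - \<delta>"
  proof -
    have "0 \<le> apply_bcontfun (Q (?u 0)) p"
      by (rule positive_operatorD[OF Q]) (simp add: const_bcontfun.rep_eq)
    also have "\<dots> \<le> (1 - \<delta>) * apply_bcontfun (?u (0 + N)) p" by (rule Qu)
    finally show ?thesis
      using less_le_trans[OF pos(1) bounds(1)] by (simp add: zero_le_mult_iff not_le[symmetric])
  qed
  \<comment> \<open>The comparison is with the later iterate at \<open>j + k * N\<close>, since
    \<open>op_power T N\<close> moves \<open>?u j\<close> to \<open>?u (j + N)\<close>; all iterates
    stay below \<open>\<beta>\<close>, so this costs nothing in the end.\<close>
  have Qk: "apply_bcontfun (op_power Q k (?u j)) a \<le> (1 - \<delta>) ^ k * apply_bcontfun (?u (j + k * N)) a" for k j a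
  proof (induction k arbitrary: j)
    case (Suc k)
    have "apply_bcontfun (op_power Q (Suc k) (?u j)) a \<le> apply_bcontfun (op_power Q k ((1 - \<delta>) *\<^sub>R ?u (j + N))) a"
      unfolding op_power_Suc_apply using Qu
      by (intro positive_operator_mono positive_operator_power Q) simp
    also have "\<dots> = (1 - \<delta>) * apply_bcontfun (op_power Q k (?u (j + N))) a"
      by (simp add: blinfun.scaleR_right)
    also have "\<dots> \<le> (1 - \<delta>) * ((1 - \<delta>) ^ k * apply_bcontfun (?u (j + N + k * N)) a)"
      using Suc \<delta>1 by (intro mult_left_mono)
    finally show ?case by (simp add: mult.assoc add.assoc)
  qed simp
  have nQ: "norm (op_power Q k) \<le> (1 - \<delta>) ^ k * \<beta>" for k
  proof (intro norm_positive_operator_le positive_operator_power Q)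
    fix a
    show "apply_bcontfun (op_power Q k one_bcontfun) a \<le> (1 - \<delta>) ^ k * \<beta>"
      using order_trans[OF Qk[of k 0 a] mult_left_mono[OF bounds(2) zero_le_power[OF \<delta>1]]] by simp
  qed
  obtain k where k: "(1 - \<delta>) ^ k < 1 / (\<beta> + 1)"
    using real_arch_pow_inv[of "1 / (\<beta> + 1)" "1 - \<delta>"] \<beta> \<delta> by auto
  \<comment> \<open>The exponent \<open>Suc k\<close> ensures that the final power
    \<open>N * Suc k\<close> is at least 1.\<close>
  have "(1 - \<delta>) ^ Suc k \<le> (1 - \<delta>) ^ k"
    using \<delta> \<delta>1 by (intro power_decreasing) auto
  then have "(1 - \<delta>) ^ Suc k * \<beta> \<le> (1 - \<delta>) ^ k * \<beta>"
    using \<beta> by (intro mult_right_mono) auto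
  also have "\<dots> \<le> 1 / (\<beta> + 1) * \<beta>"
    using k \<beta> by (intro mult_right_mono) auto
  also have "\<dots> < 1" using \<beta> by simp
  finally have lt: "norm (op_power Q (Suc k)) < 1"
    using nQ[of "Suc k"] by simp
  have "compact_operator (op_power (Q + Blinfun v) (Suc k) - op_power Q (Suc k))"
    by (rule op_power_compact_perturbation[OF cV])
  then have "compact_operator (op_power T (N * Suc k) - op_power Q (Suc k))"
    unfolding op_power_mult by (simp add: Q_def)
  from ess_norm_le[OF this, of "op_power T (N * Suc k)"] lt
  have "ess_norm (op_power T (N * Suc k)) < 1" by simp
  moreover have "1 \<le> N * Suc k" using pos(3) by simp
  ultimately show ?thesis by blast
qed

section \<open>The operator of a primitive substitution\<close>

lemma funpow_subst_word_append:
  "(subst_word \<rho> ^^ n) (u @ v) = (subst_word \<rho> ^^ n) u @ (subst_word \<rho> ^^ n) v"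
  by (induction n) (simp_all add: subst_word_def)

lemma funpow_subst_word: "(subst_word \<rho> ^^ n) w = concat (map (subst_power \<rho> n) w)"
proof (induction w)
  case Nil
  show ?case by (induction n) (simp_all add: subst_word_def)
next
  case (Cons a w)
  then show ?case
    using funpow_subst_word_append[of n \<rho> "[a]" w] by (simp add: subst_power_def)
qed

lemma subst_power_0 [simp]: "subst_power \<rho> 0 a = [a]"
  by (simp add: subst_power_def)

lemma subst_power_add: "subst_power \<rho> (m + n) a = concat (map (subst_power \<rho> m) (subst_power \<rho> n a))"
  by (simp add: subst_power_def funpow_add flip: funpow_subst_word)

lemma subst_power_1 [simp]: "subst_power \<rho> (Suc 0) = \<rho>"
  by (rule ext) (simp add: subst_power_def subst_word_def)

lemma sum_list_map_concat:
  fixes f :: "'a \<Rightarrow> 'b::comm_monoid_add"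
  shows "(\<Sum>x\<leftarrow>concat ws. f x) = (\<Sum>w\<leftarrow>ws. \<Sum>x\<leftarrow>w. f x)"
  by (induction ws) simp_all

lemma member_le_sum_list_nonneg:
  fixes f :: "'a \<Rightarrow> real"
  assumes "\<And>x. 0 \<le> f x" "y \<in> set w"
  shows "f y \<le> (\<Sum>x\<leftarrow>w. f x)"
  using assms(2)
proof (induction w)
  case (Cons x w)
  have "0 \<le> (\<Sum>x\<leftarrow>w. f x)"
    using assms(1) by (intro sum_list_nonneg) auto
  with Cons assms(1)[of x] show ?case by auto
qed simp

locale primitive_substitution =
  fixes \<rho> :: "'a::t2_space \<Rightarrow> 'a list"
  assumes compact_space: "compact (UNIV :: 'a set)"
    and substitution: "substitution \<rho>"
    and primitive: "primitive \<rho>"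
begin

abbreviation M where "M \<equiv> subst_operator \<rho>"
abbreviation T where "T \<equiv> normalised_operator \<rho>"
abbreviation r where "r \<equiv> spectral_radius (subst_operator \<rho>)"
abbreviation len where "len n a \<equiv> length (subst_power \<rho> n a)"

section \<open>Word lengths, the spectral radius and the normalised operator\<close>

lemma op_power_M_apply:
  "apply_bcontfun (op_power M n f) a = (\<Sum>b\<leftarrow>subst_power \<rho> n a. apply_bcontfun f b)"
proof (induction n arbitrary: f)
  case (Suc n)
  have "apply_bcontfun (op_power M (Suc n) f) a = (\<Sum>b\<leftarrow>subst_power \<rho> n a. \<Sum>c\<leftarrow>\<rho> b. apply_bcontfun f c)"
    unfolding op_power_Suc_apply by (simp add: Suc subst_operator_apply[OF compact_space substitution])
  also have "\<dots> = (\<Sum>c\<leftarrow>subst_power \<rho> (1 + n) a. apply_bcontfun f c)"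
    unfolding subst_power_add by (simp add: sum_list_map_concat comp_def)
  finally show ?case by simp
qed simp

lemma positive_M: "positive_operator M"
  unfolding positive_operator_def
  by (auto simp: subst_operator_apply[OF compact_space substitution] intro!: sum_list_nonneg)

lemma M_one: "apply_bcontfun (op_power M n one_bcontfun) a = real (len n a)"
  by (simp add: op_power_M_apply const_bcontfun.rep_eq sum_list_triv)

lemma len_le_norm: "real (len n a) \<le> norm (op_power M n)"
  using positive_operator_one_le_norm[OF positive_operator_power[OF positive_M]] by (simp add: M_one)

text \<open>Makes the \<open>Min\<close> and \<open>Max\<close> of condition (7) genuine
  extrema.\<close>

lemma finite_range_len: "finite (range (len n))"
proof (rule finite_subset)
  show "range (len n) \<subseteq> {..nat \<lceil>norm (op_power M n)\<rceil>}"
  proof (rule image_subsetI)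
    fix a
    have "real (len n a) \<le> real (nat \<lceil>norm (op_power M n)\<rceil>)"
      by (rule order_trans[OF len_le_norm real_nat_ceiling_ge])
    then show "len n a \<in> {..nat \<lceil>norm (op_power M n)\<rceil>}"
      by (simp only: of_nat_le_iff atMost_iff)
  qed
qed simp

text \<open>Primitivity for the whole space makes some iterate of every letter nonempty, while an
  empty image would stay empty under further iteration.\<close>

lemma rho_nonempty: "\<rho> a \<noteq> []"
proof
  assume empty: "\<rho> a = []"
  obtain n where n: "n \<ge> 1" "\<And>a. set (subst_power \<rho> n a) \<inter> UNIV \<noteq> {}"
    using primitive unfolding primitive_def by (metis open_UNIV UNIV_not_empty)
  have "subst_power \<rho> (n - 1 + 1) a = []"
    unfolding subst_power_add by (simp add: empty)
  with n show False by (metis Int_empty_left empty_set le_add_diff_inverse2)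
qed

lemma length_le_concat_map: "(\<And>b. f b \<noteq> []) \<Longrightarrow> length w \<le> length (concat (map f w))"
proof (induction w)
  case (Cons b w)
  then have "1 \<le> length (f b)" by (simp add: Suc_le_eq)
  with Cons show ?case by fastforce
qed simp

lemma len_Suc: "len n a \<le> len (Suc n) a"
  using length_le_concat_map[of \<rho> "subst_power \<rho> n a"] rho_nonempty subst_power_add[of \<rho> 1 n a] by simp

lemma len_mono: "m \<le> n \<Longrightarrow> len m a \<le> len n a"
  by (rule lift_Suc_mono_le[of "\<lambda>n. len n a"]) (rule len_Suc)

lemma len_ge_1: "1 \<le> len n a"
  using len_mono[of 0 n a] by simp

lemma norm_M_ge_1: "1 \<le> norm (op_power M n)"
  using order_trans[OF _ len_le_norm[of n undefined]] len_ge_1[of n undefined] by simp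

lemma letters_of_nonempty_open:
  assumes "open U" "U \<noteq> {}"
  shows "\<exists>n\<ge>1. \<forall>a. \<exists>b\<in>set (subst_power \<rho> n a). b \<in> U"
  using primitive assms unfolding primitive_def by (meson disjoint_iff)

text \<open>A nonzero nonnegative function is positive on a nonempty open set, and primitivity
  places a letter of that set into every word of one fixed iterate.\<close>

sublocale M: irreducible_positive_operator M
proof
  show "compact (UNIV :: 'a set)" by (rule compact_space)
  show "positive_operator M" by (rule positive_M)
  fix f :: "'a \<Rightarrow>\<^sub>C real"
  assume f: "\<And>a. 0 \<le> apply_bcontfun f a" "f \<noteq> 0"
  define U where "U = {a. 0 < apply_bcontfun f a}"
  have "open U"
    unfolding U_def by (intro open_Collect_less continuous_on_const continuous_on_apply_bcontfun)
  moreover have "U \<noteq> {}"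
  proof
    assume "U = {}"
    then have *: "\<not> 0 < apply_bcontfun f a" for a
      by (simp add: U_def)
    have "apply_bcontfun f a = 0" for a
      using f(1)[of a] *[of a] by linarith
    then have "f = 0" by (intro bcontfun_eqI) simp
    with f(2) show False by simp
  qed
  ultimately obtain n where n: "n \<ge> 1" "\<And>a. \<exists>b\<in>set (subst_power \<rho> n a). b \<in> U"
    using letters_of_nonempty_open by blast
  have "0 < apply_bcontfun (op_power M n f) a" for a
  proof -
    obtain b where "b \<in> set (subst_power \<rho> n a)" "0 < apply_bcontfun f b"
      using n(2)[of a] by (auto simp: U_def)
    then show ?thesis
      using member_le_sum_list_nonneg[of "apply_bcontfun f" b "subst_power \<rho> n a"] f(1)
      by (simp add: op_power_M_apply)
  qed
  with n(1) show "\<exists>n\<ge>1. \<forall>a. 0 < apply_bcontfun (op_power M n f) a" by blast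
qed

text \<open>\<open>s\<close> is Gelfand's formula written as an infimum: lying below every root
  gives the lower estimate of the norms, and \<open>submultiplicative_bound\<close> gives the growth
  bound. No word is empty, so \<open>s \<ge> 1\<close>, which supplies the positivity needed for
  \<open>spectral_radius_positive_operator\<close>.\<close>

lemma spectral_radius_M:
  shows growth_M: "growth_bounded M r" and power_le_norm_M: "r ^ n \<le> norm (op_power M n)" and r_ge_1: "1 \<le> r"
proof -
  define u where "u n = norm (op_power M n)" for n
  define s where "s = (INF n\<in>{1..}. root n (u n))"
  have u: "0 \<le> u n" "u (m + n) \<le> u m * u n" "1 \<le> u n" for m n
    by (simp_all add: u_def norm_op_power_add norm_M_ge_1)
  have bdd: "bdd_below ((\<lambda>n. root n (u n)) ` {1..})"
    by (rule bdd_belowI[of _ 0]) (auto simp: u real_root_ge_zero)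
  have s1: "1 \<le> s"
    unfolding s_def by (rule cINF_greatest) (use u(3) in auto)
  have low: "s ^ n \<le> u n" for n
  proof (cases "n = 0")
    case True
    then show ?thesis using u(3)[of 0] by simp
  next
    case False
    then have "s \<le> root n (u n)"
      unfolding s_def by (intro cINF_lower[OF bdd]) auto
    then have "s ^ n \<le> root n (u n) ^ n"
      using s1 by (intro power_mono) auto
    with False u(1) show ?thesis by simp
  qed
  have growth: "growth_bounded M s"
    unfolding growth_bounded_def
  proof (intro allI impI)
    fix l assume l: "s < l"
    have "\<exists>m\<in>{1..}. root m (u m) < l"
      using l cINF_less_iff[OF _ bdd, of l] by (auto simp: s_def)
    then obtain m where m: "m \<ge> 1" "root m (u m) < l" by auto
    have "u m = root m (u m) ^ m" using m(1) u(1) by simp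
    also have "\<dots> \<le> l ^ m"
      using m u(1) by (intro power_mono) (auto simp: real_root_ge_zero)
    finally have "u m \<le> l ^ m" .
    moreover have "0 < l" using l s1 by simp
    ultimately have "\<exists>C>0. \<forall>n. u n \<le> C * l ^ n"
      by (intro submultiplicative_bound[OF u(1,2) m(1)])
    then show "\<exists>C. \<forall>n. norm (op_power M n) \<le> C * l ^ n"
      unfolding u_def by blast
  qed
  have "r = s"
    using spectral_radius_positive_operator[OF positive_M growth] low s1 by (simp add: u_def)
  with growth low[of n] s1 show "growth_bounded M r" "r ^ n \<le> norm (op_power M n)" "1 \<le> r"
    by (simp_all add: u_def)
qed

lemma r_pos: "0 < r"
  using r_ge_1 by simp

lemma op_power_T: "op_power T n = (1 / r ^ n) *\<^sub>R op_power M n"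
  by (simp add: normalised_operator_def op_power_scaleR power_one_over)

lemma T_one: "apply_bcontfun (op_power T n one_bcontfun) a = real (len n a) / r ^ n"
  by (simp add: op_power_T blinfun.scaleR_left M_one)

lemma T_apply: "apply_bcontfun (op_power T n f) a = (\<Sum>b\<leftarrow>subst_power \<rho> n a. apply_bcontfun f b) / r ^ n"
  by (simp add: op_power_T blinfun.scaleR_left op_power_M_apply)

sublocale T: irreducible_positive_operator T
proof
  show "compact (UNIV :: 'a set)" by (rule compact_space)
  show "positive_operator T"
    using positive_M r_pos by (simp add: positive_operator_def normalised_operator_def blinfun.scaleR_left)
  fix f :: "'a \<Rightarrow>\<^sub>C real"
  assume "\<And>a. 0 \<le> apply_bcontfun f a" "f \<noteq> 0"
  then obtain n where "n \<ge> 1" "\<forall>a. 0 < apply_bcontfun (op_power M n f) a"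
    using M.irreducible by blast
  then show "\<exists>n\<ge>1. \<forall>a. 0 < apply_bcontfun (op_power T n f) a"
    using r_pos by (auto simp: op_power_T blinfun.scaleR_left intro!: exI[of _ n])
qed

lemma norm_T_ge_1: "1 \<le> norm (op_power T n)"
  using power_le_norm_M[of n] r_pos by (simp add: op_power_T)

lemma growth_T: "growth_bounded T 1"
  unfolding growth_bounded_def
proof (intro allI impI)
  fix l :: real assume l: "1 < l"
  then have "r < l * r" using r_pos by simp
  then obtain C where C: "\<And>n. norm (op_power M n) \<le> C * (l * r) ^ n"
    using growth_M unfolding growth_bounded_def by blast
  have "norm (op_power T n) \<le> C * l ^ n" for n
    using C[of n] r_pos by (simp add: op_power_T power_mult_distrib field_simps)
  then show "\<exists>C. \<forall>n. norm (op_power T n) \<le> C * l ^ n" by blast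
qed

lemma spectral_radius_T: "spectral_radius T = 1"
  using norm_T_ge_1 by (intro spectral_radius_positive_operator[OF T.positive growth_T]) auto

lemma quasi_compact_T_iff: "quasi_compact T \<longleftrightarrow> (\<exists>m\<ge>1. ess_norm (op_power T m) < 1)"
  unfolding quasi_compact_def spectral_radius_T by (rule ess_spectral_radius_less_one_iff)

lemma quasi_compact_T_imp_uniformly_power_convergent:
  "quasi_compact T \<Longrightarrow> uniformly_power_convergent T"
  unfolding quasi_compact_T_iff
  using T.quasi_compact_imp_uniformly_power_convergent[OF growth_T norm_T_ge_1] by blast

lemma fixed_point_natural_length:
  assumes "l \<noteq> 0" "\<And>a. 0 \<le> apply_bcontfun l a" "T l = l"
  shows "natural_length_function \<rho> l"
proof -
  have "r *\<^sub>R T l = M l"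
    using r_pos by (simp add: normalised_operator_def blinfun.scaleR_left)
  then have "M l = r *\<^sub>R l" using assms(3) by simp
  with assms(1,2) r_pos less_imp_le show ?thesis
    unfolding natural_length_function_def by blast
qed

lemma mean_ergodic_T_imp_natural_length:
  "mean_ergodic T \<Longrightarrow> \<exists>l. natural_length_function \<rho> l"
  using mean_ergodic_fixed_point[OF T.positive growth_T norm_T_ge_1] fixed_point_natural_length by blast

text \<open>The eigenvalue \<open>c\<close> is not assumed to be \<open>r\<close>. Lengths grow like
  \<open>c ^ n\<close> up to constants, and comparing this rate with the norms of the powers of
  \<open>M\<close> from both sides forces \<open>c = r\<close>.\<close>

lemma natural_length_imp_length_bounds:
  assumes "natural_length_function \<rho> l"
  shows "\<exists>\<alpha>>0. \<exists>\<beta>>0. \<forall>n\<ge>1. \<forall>a. \<alpha> * r ^ n \<le> real (len n a) \<and> real (len n a) \<le> \<beta> * r ^ n"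
proof -
  obtain c where l: "l \<noteq> 0" "\<And>a. 0 \<le> apply_bcontfun l a" "0 \<le> c" "M l = c *\<^sub>R l"
    using assms unfolding natural_length_function_def by blast
  obtain \<alpha> \<beta> where pos: "0 < \<alpha>" "0 < \<beta>"
    and bounds: "\<And>n a. \<alpha> * c ^ n \<le> real (len n a)" "\<And>n a. real (len n a) \<le> \<beta> * c ^ n"
    using M.eigenfunction_growth[OF l] unfolding M_one by blast
  have c: "0 < c" by (rule M.eigenfunction_positive(1)[OF l])
  have "norm (op_power M n) \<le> \<beta> * c ^ n" for n
    using bounds(2) by (intro norm_positive_operator_le positive_operator_power positive_M) (simp add: M_one)
  then have "r \<le> c"
    using power_le_norm_M order_trans by (intro power_le_const_mult_power_imp_le[OF c, of r \<beta>]) blast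
  moreover have "c \<le> r"
  proof (rule dense_ge)
    fix q assume q: "r < q"
    then obtain C where C: "\<And>n. norm (op_power M n) \<le> C * q ^ n"
      using growth_M unfolding growth_bounded_def by blast
    have "c ^ n \<le> (C / \<alpha>) * q ^ n" for n
    proof -
      have "\<alpha> * c ^ n \<le> C * q ^ n"
        using bounds(1)[of n undefined] len_le_norm[of n undefined] C[of n] by linarith
      then show ?thesis using pos(1) by (simp add: field_simps)
    qed
    moreover have "0 < q" using q r_pos by simp
    ultimately show "c \<le> q" by (intro power_le_const_mult_power_imp_le[of q c])
  qed
  ultimately have "c = r" by simp
  with pos bounds show ?thesis by blast
qed

section \<open>Extremal word lengths and condition (7)\<close>

lemma Min_len: obtains a where "Min (range (len n)) = len n a"
  using Min_in[OF finite_range_len, of n] that by auto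

lemma Max_len: obtains a where "Max (range (len n)) = len n a"
  using Max_in[OF finite_range_len, of n] that by auto

lemma Min_len_le: "Min (range (len n)) \<le> len n a"
  by (intro Min_le finite_range_len) simp

lemma Max_len_ge: "len n a \<le> Max (range (len n))"
  by (intro Max_ge finite_range_len) simp

lemma length_bounds_imp_ratio:
  assumes "0 < \<alpha>" "0 < \<beta>"
    and "\<And>n a. n \<ge> 1 \<Longrightarrow> \<alpha> * r ^ n \<le> real (len n a)" "\<And>n a. n \<ge> 1 \<Longrightarrow> real (len n a) \<le> \<beta> * r ^ n"
  shows "0 < (INF n\<in>{1::nat..}. real (Min (range (\<lambda>a. len n a))) / real (Max (range (\<lambda>b. len n b))))"
proof -
  have "\<alpha> / \<beta> \<le> (INF n\<in>{1::nat..}. real (Min (range (\<lambda>a. len n a))) / real (Max (range (\<lambda>b. len n b))))"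
  proof (rule cINF_greatest)
    fix n :: nat assume "n \<in> {1..}"
    then have n: "1 \<le> n" by simp
    obtain a where a: "Min (range (len n)) = len n a" by (rule Min_len)
    obtain b where b: "Max (range (len n)) = len n b" by (rule Max_len)
    have "\<alpha> / \<beta> = (\<alpha> * r ^ n) / (\<beta> * r ^ n)" using r_pos by simp
    also have "\<dots> \<le> real (len n a) / real (len n b)"
      using assms(3)[OF n, of a] assms(4)[OF n, of b] len_ge_1[of n b] by (intro frac_le) auto
    finally show "\<alpha> / \<beta> \<le> real (Min (range (len n))) / real (Max (range (len n)))"
      by (simp add: a b)
  qed auto
  with assms(1,2) show ?thesis
    using divide_pos_pos[OF assms(1,2)] by linarith
qed

text \<open>Minimal lengths are supermultiplicative under iteration, so the \<open>k\<close>-th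
  power of \<open>x\<close> is at most a length at level \<open>n * k\<close>, hence at most
  \<open>C * q ^ (n * k)\<close> for every \<open>q > r\<close>. Let \<open>k\<close> grow and
  \<open>q\<close> decrease to \<open>r\<close>.\<close>

lemma Min_len_le_power: "real (Min (range (len n))) \<le> r ^ n"
proof -
  define x where "x = real (Min (range (len n)))"
  have x0: "0 \<le> x" by (simp add: x_def)
  have pw: "x ^ k \<le> real (len (n * k) a)" for k a
  proof -
    have "apply_bcontfun (x ^ k *\<^sub>R one_bcontfun) a \<le> apply_bcontfun (op_power M (n * k) one_bcontfun) a" for a
    proof (induction k arbitrary: a)
      case (Suc k)
      have "x ^ Suc k \<le> x ^ k * real (len n a)"
        using Min_len_le[of n a] x0 by (simp add: x_def mult_right_mono mult.commute)
      also have "\<dots> = apply_bcontfun (op_power M n (x ^ k *\<^sub>R one_bcontfun)) a"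
        by (simp add: blinfun.scaleR_right M_one)
      also have "\<dots> \<le> apply_bcontfun (op_power M n (op_power M (n * k) one_bcontfun)) a"
        by (intro positive_operator_mono positive_operator_power positive_M Suc)
      finally show ?case
        by (simp add: op_power_add const_bcontfun.rep_eq)
    qed simp
    from this[of a] show ?thesis by (simp add: M_one const_bcontfun.rep_eq)
  qed
  have le: "x \<le> q ^ n" if q: "r < q" for q
  proof -
    obtain C where C: "\<And>n. norm (op_power M n) \<le> C * q ^ n"
      using growth_M q unfolding growth_bounded_def by blast
    have "x ^ k \<le> C * (q ^ n) ^ k" for k
      using pw[of k undefined] len_le_norm[of "n * k" undefined] C[of "n * k"] by (simp add: power_mult)
    moreover have "0 < q ^ n" using q r_pos by simp
    ultimately show ?thesis by (intro power_le_const_mult_power_imp_le[of "q ^ n" x])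
  qed
  have "(\<lambda>k. (r + inverse (real (Suc k))) ^ n) \<longlonglongrightarrow> (r + 0) ^ n"
    by (intro tendsto_intros LIMSEQ_inverse_real_of_nat)
  from LIMSEQ_le_const[OF this, of x] le show ?thesis
    by (simp add: x_def)
qed

text \<open>The extremes enclose \<open>r ^ n\<close>: the largest length bounds the norm of the
  power of \<open>M\<close>, and the smallest is bounded by \<open>Min_len_le_power\<close>. The
  ratio then pins every length to \<open>r ^ n\<close> up to the factors \<open>\<kappa>\<close> and
  \<open>1 / \<kappa>\<close>.\<close>

lemma ratio_imp_length_bounds:
  assumes "0 < (INF n\<in>{1::nat..}. real (Min (range (\<lambda>a. len n a))) / real (Max (range (\<lambda>b. len n b))))"
  shows "\<exists>\<alpha>>0. \<exists>\<beta>>0. \<forall>n\<ge>1. \<forall>a. \<alpha> * r ^ n \<le> real (len n a) \<and> real (len n a) \<le> \<beta> * r ^ n"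
proof -
  define \<kappa> where "\<kappa> = (INF n\<in>{1::nat..}. real (Min (range (\<lambda>a. len n a))) / real (Max (range (\<lambda>b. len n b))))"
  have \<kappa>: "0 < \<kappa>" using assms by (simp add: \<kappa>_def)
  have "\<kappa> * r ^ n \<le> real (len n a) \<and> real (len n a) \<le> (1 / \<kappa>) * r ^ n" if n: "n \<ge> 1" for n a
  proof -
    let ?lo = "real (Min (range (len n)))" and ?hi = "real (Max (range (len n)))"
    have hi: "real (len n a) \<le> ?hi" "0 < ?hi" for a
      using Max_len_ge[of n a] len_ge_1[of n a] by linarith+
    have "\<kappa> \<le> ?lo / ?hi"
      unfolding \<kappa>_def using n by (intro cINF_lower bdd_belowI[of _ 0]) auto
    then have lo: "\<kappa> * ?hi \<le> ?lo" using hi(2) by (simp add: pos_le_divide_eq)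
    have "norm (op_power M n) \<le> ?hi"
      using hi(1) by (intro norm_positive_operator_le positive_operator_power positive_M) (simp add: M_one)
    then have "r ^ n \<le> ?hi" using power_le_norm_M[of n] by linarith
    then have "\<kappa> * r ^ n \<le> \<kappa> * ?hi" using \<kappa> by (intro mult_left_mono) auto
    moreover have "?lo \<le> real (len n a)" using Min_len_le[of n a] by simp
    moreover have "\<kappa> * real (len n a) \<le> \<kappa> * ?hi" using hi(1)[of a] \<kappa> by (intro mult_left_mono) auto
    ultimately have "\<kappa> * r ^ n \<le> real (len n a)" "\<kappa> * real (len n a) \<le> r ^ n"
      using lo Min_len_le_power[of n] by linarith+
    then show ?thesis using \<kappa> by (simp add: field_simps)
  qed
  then show ?thesis using \<kappa> by (intro exI[of _ \<kappa>] conjI exI[of _ "1 / \<kappa>"]) auto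
qed

text \<open>Keeping only one occurrence of \<open>p\<close> in the sum over the iterate gives the
  minorisation, with \<open>e = 1 / r ^ N\<close>.\<close>

lemma length_bounds_common_letter_imp_quasi_compact:
  assumes "0 < \<alpha>" "0 < \<beta>"
    and bounds: "\<And>n a. n \<ge> 1 \<Longrightarrow> \<alpha> * r ^ n \<le> real (len n a)" "\<And>n a. n \<ge> 1 \<Longrightarrow> real (len n a) \<le> \<beta> * r ^ n"
    and p: "N \<ge> 1" "\<And>a. p \<in> set (subst_power \<rho> N a)"
  shows "quasi_compact T"
  unfolding quasi_compact_T_iff
proof (rule minorised_imp_ess_norm_less_one[OF T.positive])
  \<comment> \<open>The length bounds start at \<open>n = 1\<close>; at \<open>n = 0\<close> the
    function is constantly 1, hence \<open>min\<close> here and \<open>max\<close> below.\<close>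
  show "min \<alpha> 1 \<le> apply_bcontfun (op_power T n one_bcontfun) a" for n a
    using bounds(1)[of n a] r_pos
    by (cases "n = 0") (simp_all add: T_one pos_le_divide_eq min.coboundedI1 min_mult_distrib_right)
  show "apply_bcontfun (op_power T n one_bcontfun) a \<le> max \<beta> 1" for n a
    using bounds(2)[of n a] r_pos
    by (cases "n = 0") (simp_all add: T_one pos_divide_le_eq max.coboundedI1 max_mult_distrib_right)
  show "1 / r ^ N * apply_bcontfun f p \<le> apply_bcontfun (op_power T N f) a"
    if "\<And>a. 0 \<le> apply_bcontfun f a" for f a
    using member_le_sum_list_nonneg[of "apply_bcontfun f" p "subst_power \<rho> N a"] that p(2) r_pos
    by (simp add: T_apply divide_right_mono)
qed (use assms r_pos in auto)

text \<open>For \<open>r = 1\<close> all lengths would be at most \<open>\<beta>\<close>, against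
  the standing assumption that words become arbitrarily long.\<close>

lemma r_gt_1:
  assumes "0 < \<beta>" "\<And>n a. n \<ge> 1 \<Longrightarrow> real (len n a) \<le> \<beta> * r ^ n"
  shows "1 < r"
proof (rule ccontr)
  assume "\<not> 1 < r"
  with r_ge_1 have "r = 1" by simp
  obtain n a where n: "n \<ge> 1" "nat \<lceil>\<beta>\<rceil> + 1 \<le> len n a"
    using substitution unfolding substitution_def by (metis le_add2)
  have "\<beta> < real (len n a)"
    using n(2) by linarith
  with assms(2)[OF n(1), of a] \<open>r = 1\<close> show False by simp
qed

end

section \<open>Words and local functions\<close>

lemma open_vimage_coordinate:
  fixes W :: "'b::topological_space set"
  assumes "open W"
  shows "open ((\<lambda>z :: 'a \<Rightarrow> 'b. z i) -` W)"
  using assms continuous_on_open_vimage[of UNIV "\<lambda>z :: 'a \<Rightarrow> 'b. z i"] by simp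

text \<open>Distinct points of a product differ at a coordinate, and preimages of separating open
  sets separate them. The chain of instances up to \<open>t2_space\<close> makes the Hausdorff
  theory available for bi-infinite words.\<close>

instance "fun" :: (type, t0_space) t0_space
proof
  fix x y :: "'a \<Rightarrow> 'b"
  assume "x \<noteq> y"
  then obtain i where i: "x i \<noteq> y i" by auto
  obtain U where "open U" "\<not> (x i \<in> U \<longleftrightarrow> y i \<in> U)"
    using iffD1[OF separation_t0 i] by auto
  then show "\<exists>U. open U \<and> \<not> (x \<in> U \<longleftrightarrow> y \<in> U)"
    by (intro exI[of _ "(\<lambda>z. z i) -` U"]) (auto intro: open_vimage_coordinate)
qed

instance "fun" :: (type, t1_space) t1_space
proof
  fix x y :: "'a \<Rightarrow> 'b"
  assume "x \<noteq> y"
  then obtain i where i: "x i \<noteq> y i" by auto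
  obtain U where "open U" "x i \<in> U" "y i \<notin> U"
    using iffD1[OF separation_t1 i] by auto
  then show "\<exists>U. open U \<and> x \<in> U \<and> y \<notin> U"
    by (intro exI[of _ "(\<lambda>z. z i) -` U"]) (auto intro: open_vimage_coordinate)
qed

instance "fun" :: (type, t2_space) t2_space
proof
  fix x y :: "'a \<Rightarrow> 'b"
  assume "x \<noteq> y"
  then obtain i where i: "x i \<noteq> y i" by auto
  obtain U V where "open U" "open V" "x i \<in> U" "y i \<in> V" "U \<inter> V = {}"
    using hausdorff[OF i] by auto
  then show "\<exists>U V. open U \<and> open V \<and> x \<in> U \<and> y \<in> V \<and> U \<inter> V = {}"
    by (intro exI[of _ "(\<lambda>z. z i) -` U"] exI[of _ "(\<lambda>z. z i) -` V"]) (auto intro: open_vimage_coordinate)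
qed

lemma compact_UNIV_fun:
  assumes "compact (UNIV :: 'a::topological_space set)"
  shows "compact (UNIV :: ('i \<Rightarrow> 'a) set)"
proof -
  have "compact_space (euclidean :: 'a topology)"
    using assms by (simp add: compact_space_def)
  then have "compact_space (product_topology (\<lambda>_::'i. euclidean :: 'a topology) UNIV)"
    by (simp add: compact_space_product_topology)
  then show ?thesis
    unfolding euclidean_product_topology by (simp add: compact_space_def)
qed

section \<open>Continuity of maps from and into the space of finite words\<close>

abbreviation words_of_length :: "nat \<Rightarrow> (nat \<Rightarrow> 'a::topological_space) topology" where
  "words_of_length n \<equiv> product_topology (\<lambda>_. euclidean) {..<n}"

text \<open>The universal property of a disjoint union, with \<open>map x [0..<n]\<close> as the
  inclusion of the summand of length \<open>n\<close>.\<close>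

lemma continuous_map_from_words:
  "continuous_map word_topology Y g \<longleftrightarrow>
     (\<forall>n. continuous_map (words_of_length n) Y (\<lambda>x. g (map x [0..<n])))"
proof
  assume g: "continuous_map word_topology Y g"
  show "\<forall>n. continuous_map (words_of_length n) Y (\<lambda>x. g (map x [0..<n]))"
  proof
    fix n
    have *: "{x \<in> topspace (words_of_length n). g (map x [0..<n]) \<in> U} =
        {x \<in> {..<n} \<rightarrow>\<^sub>E UNIV. map x [0..<n] \<in> {w \<in> topspace word_topology. g w \<in> U}}" for U
      by simp
    show "continuous_map (words_of_length n) Y (\<lambda>x. g (map x [0..<n]))"
      unfolding continuous_map
    proof (intro conjI allI impI)
      show "(\<lambda>x. g (map x [0..<n])) ` topspace (words_of_length n) \<subseteq> topspace Y"
        using g unfolding continuous_map by auto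
      fix U assume "openin Y U"
      then have "openin word_topology {w \<in> topspace word_topology. g w \<in> U}"
        by (rule openin_continuous_map_preimage[OF g])
      then show "openin (words_of_length n) {x \<in> topspace (words_of_length n). g (map x [0..<n]) \<in> U}"
        unfolding openin_word_topology open_words_def * by blast
    qed
  qed
next
  assume g: "\<forall>n. continuous_map (words_of_length n) Y (\<lambda>x. g (map x [0..<n]))"
  show "continuous_map word_topology Y g"
    unfolding continuous_map
  proof (intro conjI allI impI)
    show "g ` topspace word_topology \<subseteq> topspace Y"
    proof (rule image_subsetI)
      fix w :: "'a list"
      have "restrict (\<lambda>i. w ! i) {..<length w} \<in> topspace (words_of_length (length w))"
        by simp
      then have "g (map (restrict (\<lambda>i. w ! i) {..<length w}) [0..<length w]) \<in> topspace Y"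
        using g[rule_format, of "length w"] unfolding continuous_map by blast
      moreover have "map (restrict (\<lambda>i. w ! i) {..<length w}) [0..<length w] = w"
        by (rule nth_equalityI) auto
      ultimately show "g w \<in> topspace Y" by simp
    qed
    fix U assume U: "openin Y U"
    have "openin (words_of_length n) {x \<in> {..<n} \<rightarrow>\<^sub>E UNIV. g (map x [0..<n]) \<in> U}" for n
      using openin_continuous_map_preimage[OF g[rule_format, of n] U] by simp
    then show "openin word_topology {w \<in> topspace word_topology. g w \<in> U}"
      unfolding openin_word_topology open_words_def by simp
  qed
qed

lemma openin_length_eq: "openin word_topology {w :: 'a::topological_space list. length w = n}"
  unfolding openin_word_topology open_words_def
proof
  fix m
  have "{x \<in> {..<m} \<rightarrow>\<^sub>E UNIV. map x [0..<m] \<in> {w :: 'a list. length w = n}} =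
      (if m = n then topspace (words_of_length m) else {})"
    by auto
  then show "openin (words_of_length m) {x \<in> {..<m} \<rightarrow>\<^sub>E UNIV. map x [0..<m] \<in> {w :: 'a list. length w = n}}"
    by (simp del: topspace_product_topology)
qed

lemma continuous_map_nth:
  assumes "k < n"
  shows "continuous_map (subtopology word_topology {w :: 'a::topological_space list. length w = n}) euclidean (\<lambda>w. w ! k)"
  unfolding continuous_map
proof (intro conjI allI impI)
  fix U :: "'a set" assume U: "openin euclidean U"
  have "openin word_topology {w. length w = n \<and> w ! k \<in> U}"
    unfolding openin_word_topology open_words_def
  proof
    fix m
    have "openin (words_of_length n) {x \<in> topspace (words_of_length n). x k \<in> U}"
      using assms U by (intro openin_continuous_map_preimage[of _ euclidean] continuous_map_product_projection) auto
    moreover have "{x \<in> {..<m} \<rightarrow>\<^sub>E UNIV. map x [0..<m] \<in> {w. length w = n \<and> w ! k \<in> U}} =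
        (if m = n then {x \<in> topspace (words_of_length n). x k \<in> U} else {})"
      using assms by auto
    ultimately show "openin (words_of_length m) {x \<in> {..<m} \<rightarrow>\<^sub>E UNIV. map x [0..<m] \<in> {w. length w = n \<and> w ! k \<in> U}}"
      by simp
  qed
  moreover have "{w \<in> topspace (subtopology word_topology {w. length w = n}). w ! k \<in> U} =
      {w. length w = n \<and> w ! k \<in> U} \<inter> {w. length w = n}"
    by auto
  ultimately show "openin (subtopology word_topology {w. length w = n})
      {w \<in> topspace (subtopology word_topology {w. length w = n}). w ! k \<in> U}"
    unfolding openin_subtopology by blast
qed simp

text \<open>Fixing the length near \<open>x0\<close> places the map locally into one summand, a
  finite product, where continuity is checked letter by letter.\<close>

lemma continuous_map_into_words:
  assumes "\<And>x0. x0 \<in> topspace X \<Longrightarrow> \<exists>N n. openin X N \<and> x0 \<in> N \<and> (\<forall>x\<in>N. length (g x) = n) \<and>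
      (\<forall>k<n. continuous_map (subtopology X N) euclidean (\<lambda>x. g x ! k))"
  shows "continuous_map X word_topology g"
  unfolding continuous_map
proof (intro conjI allI impI)
  fix W :: "'b list set" assume "openin word_topology W"
  then have W: "open_words W" by (simp add: openin_word_topology)
  show "openin X {x \<in> topspace X. g x \<in> W}"
    unfolding openin_subopen[of X "{x \<in> topspace X. g x \<in> W}"]
  proof
    fix x0 assume x0: "x0 \<in> {x \<in> topspace X. g x \<in> W}"
    then obtain N n where N: "openin X N" "x0 \<in> N" "\<And>x. x \<in> N \<Longrightarrow> length (g x) = n"
      and cont: "\<And>k. k < n \<Longrightarrow> continuous_map (subtopology X N) euclidean (\<lambda>x. g x ! k)"
      using assms[of x0] by auto
    define h where "h x = restrict (\<lambda>k. g x ! k) {..<n}" for x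
    have h: "continuous_map (subtopology X N) (words_of_length n) h"
      unfolding continuous_map_componentwise
      by (auto simp: h_def cont intro: continuous_map_eq[OF cont])
    have "map (h x) [0..<n] = g x" if "x \<in> N" for x
      using N(3)[OF that] by (intro nth_equalityI) (auto simp: h_def)
    moreover have "h x \<in> {..<n} \<rightarrow>\<^sub>E UNIV" for x
      by (auto simp: h_def)
    moreover have "N \<subseteq> topspace X" using N(1) by (rule openin_subset)
    ultimately have eq: "{x \<in> topspace (subtopology X N). h x \<in> {y \<in> {..<n} \<rightarrow>\<^sub>E UNIV. map y [0..<n] \<in> W}} =
        {x \<in> N. g x \<in> W}"
      by auto
    have "openin (subtopology X N) {x \<in> N. g x \<in> W}"
      unfolding eq[symmetric] using W unfolding open_words_def
      by (intro openin_continuous_map_preimage[OF h]) blast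
    then have "openin X {x \<in> N. g x \<in> W}"
      using N(1) openin_trans_full by blast
    moreover have "{x \<in> N. g x \<in> W} \<subseteq> {x \<in> topspace X. g x \<in> W}"
      using \<open>N \<subseteq> topspace X\<close> by blast
    ultimately show "\<exists>T. openin X T \<and> x0 \<in> T \<and> T \<subseteq> {x \<in> topspace X. g x \<in> W}"
      using x0 N(2) by blast
  qed
qed simp

lemma continuous_map_append:
  assumes G: "continuous_map X word_topology G" and H: "continuous_map X word_topology H"
  shows "continuous_map X word_topology (\<lambda>x. G x @ H x)"
proof (rule continuous_map_into_words)
  fix x0 assume x0: "x0 \<in> topspace X"
  define A where "A = {x \<in> topspace X. G x \<in> {w. length w = length (G x0)}}"
  define B where "B = {x \<in> topspace X. H x \<in> {w. length w = length (H x0)}}"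
  have A: "openin X A" and B: "openin X B"
    unfolding A_def B_def
    by (rule openin_continuous_map_preimage[OF G openin_length_eq])
      (rule openin_continuous_map_preimage[OF H openin_length_eq])
  have cG: "continuous_map (subtopology X A) euclidean (\<lambda>x. G x ! k)" if "k < length (G x0)" for k
  proof -
    have "continuous_map (subtopology X A) (subtopology word_topology {w. length w = length (G x0)}) G"
      using continuous_map_from_subtopology[OF G, of A] by (auto simp: continuous_map_in_subtopology A_def)
    from continuous_map_compose[OF this continuous_map_nth[OF that]] show ?thesis
      by (simp add: comp_def)
  qed
  have cH: "continuous_map (subtopology X B) euclidean (\<lambda>x. H x ! k)" if "k < length (H x0)" for k
  proof -
    have "continuous_map (subtopology X B) (subtopology word_topology {w. length w = length (H x0)}) H"
      using continuous_map_from_subtopology[OF H, of B] by (auto simp: continuous_map_in_subtopology B_def)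
    from continuous_map_compose[OF this continuous_map_nth[OF that]] show ?thesis
      by (simp add: comp_def)
  qed
  show "\<exists>N n. openin X N \<and> x0 \<in> N \<and> (\<forall>x\<in>N. length (G x @ H x) = n) \<and>
      (\<forall>k<n. continuous_map (subtopology X N) euclidean (\<lambda>x. (G x @ H x) ! k))"
  proof (intro exI[of _ "A \<inter> B"] exI[of _ "length (G x0) + length (H x0)"] conjI allI impI ballI)
    show "openin X (A \<inter> B)" using A B by blast
    show "x0 \<in> A \<inter> B" using x0 by (simp add: A_def B_def)
    show "length (G x @ H x) = length (G x0) + length (H x0)" if "x \<in> A \<inter> B" for x
      using that by (simp add: A_def B_def)
    fix k assume k: "k < length (G x0) + length (H x0)"
    show "continuous_map (subtopology X (A \<inter> B)) euclidean (\<lambda>x. (G x @ H x) ! k)"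
    proof (cases "k < length (G x0)")
      case True
      have "continuous_map (subtopology X (A \<inter> B)) euclidean (\<lambda>x. G x ! k)"
        using cG[OF True] by (rule continuous_map_from_subtopology_mono) simp
      then show ?thesis
        by (rule continuous_map_eq) (use True in \<open>auto simp: nth_append A_def\<close>)
    next
      case False
      with k have "k - length (G x0) < length (H x0)" by simp
      then have "continuous_map (subtopology X (A \<inter> B)) euclidean (\<lambda>x. H x ! (k - length (G x0)))"
        by (intro continuous_map_from_subtopology_mono[OF cH]) auto
      then show ?thesis
        by (rule continuous_map_eq) (use False in \<open>auto simp: nth_append A_def\<close>)
    qed
  qed
qed

text \<open>On words of a fixed length the image is built up by appending the images of the letters
  one at a time.\<close>

lemma continuous_map_subst_word:
  assumes "continuous_map euclidean word_topology \<rho>"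
  shows "continuous_map word_topology word_topology (subst_word \<rho>)"
  unfolding continuous_map_from_words
proof
  fix n
  have "continuous_map (words_of_length n) word_topology (\<lambda>x. subst_word \<rho> (map x [0..<m]))" if "m \<le> n" for m
    using that
  proof (induction m)
    case 0
    then show ?case by (simp add: subst_word_def)
  next
    case (Suc m)
    have "continuous_map (words_of_length n) euclidean (\<lambda>x. x m)"
      using Suc by (intro continuous_map_product_projection) auto
    from continuous_map_compose[OF this assms]
    have "continuous_map (words_of_length n) word_topology (\<lambda>x. \<rho> (x m))"
      by (simp add: comp_def)
    from continuous_map_append[OF Suc.IH this] Suc.prems show ?case
      by (simp add: subst_word_def)
  qed
  then show "continuous_map (words_of_length n) word_topology (\<lambda>x. subst_word \<rho> (map x [0..<n]))"
    by simp
qed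

lemma continuous_map_subst_power:
  assumes "continuous_map euclidean word_topology \<rho>"
  shows "continuous_map euclidean word_topology (subst_power \<rho> n)"
proof (induction n)
  case 0
  show ?case
    by (rule continuous_map_into_words) (auto intro!: exI[of _ UNIV] exI[of _ 1])
next
  case (Suc n)
  have "subst_power \<rho> (Suc n) = subst_word \<rho> \<circ> subst_power \<rho> n"
    by (simp add: subst_power_def fun_eq_iff)
  with continuous_map_compose[OF Suc continuous_map_subst_word[OF assms]] show ?case
    by metis
qed

abbreviation window :: "int \<Rightarrow> nat \<Rightarrow> (int \<Rightarrow> 'a) \<Rightarrow> 'a list" where
  "window i n w \<equiv> map (\<lambda>k. w (i + int k)) [0..<n]"

lemma continuous_map_window:
  "continuous_map euclidean word_topology (window i n :: (int \<Rightarrow> 'a::topological_space) \<Rightarrow> 'a list)"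
proof (rule continuous_map_into_words)
  fix w0 :: "int \<Rightarrow> 'a"
  show "\<exists>N m. openin euclidean N \<and> w0 \<in> N \<and> (\<forall>w\<in>N. length (window i n w) = m) \<and>
      (\<forall>k<m. continuous_map (subtopology euclidean N) euclidean (\<lambda>w. window i n w ! k))"
    by (intro exI[of _ UNIV] exI[of _ n]) auto
qed

lemma closed_subshift: "closed (subshift \<rho>)"
proof -
  have "closed {w. window i n w \<in> language \<rho>}" for i n
    using closedin_continuous_map_preimage[OF continuous_map_window[of i n], of "language \<rho>"]
    by (simp add: language_def closedin_closure_of)
  then have "closed (\<Inter>i. \<Inter>n. {w. window i n w \<in> language \<rho>})"
    by (intro closed_INT) auto
  moreover have "subshift \<rho> = (\<Inter>i. \<Inter>n. {w. window i n w \<in> language \<rho>})"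
    by (auto simp: subshift_def)
  ultimately show ?thesis by simp
qed

text \<open>The word \<open>v\<close> placed with its letter number \<open>j\<close> at the origin of a bi-infinite word that is
  otherwise filled with \<open>undefined\<close>.\<close>

definition centred :: "'a list \<Rightarrow> int \<Rightarrow> int \<Rightarrow> 'a" where
  "centred v j = (\<lambda>i. if 0 \<le> j + i \<and> j + i < int (length v) then v ! nat (j + i) else undefined)"

text \<open>The analogue of a Birkhoff sum for a finite word. For a local function only positions
  near the two ends see the filler, so the sum is additive under concatenation up to a bounded
  error.\<close>

definition occurrence_sum :: "((int \<Rightarrow> 'a) \<Rightarrow> real) \<Rightarrow> 'a list \<Rightarrow> real" where
  "occurrence_sum f v = (\<Sum>j<length v. f (centred v (int j)))"

text \<open>Continuity is required on all bi-infinite words, because the function is evaluated at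
  centred finite words, which need not lie in the subshift.\<close>

definition local_function :: "nat \<Rightarrow> ((int \<Rightarrow> 'a::topological_space) \<Rightarrow> real) \<Rightarrow> bool" where
  "local_function K f \<longleftrightarrow> continuous_on UNIV f \<and>
     (\<forall>w w'. (\<forall>i. \<bar>i\<bar> \<le> int K \<longrightarrow> w i = w' i) \<longrightarrow> f w = f w')"

lemma continuous_map_occurrence_sum:
  assumes "continuous_on UNIV f"
  shows "continuous_map word_topology euclidean (occurrence_sum f)"
  unfolding continuous_map_from_words
proof
  fix n
  have "continuous_map (words_of_length n) euclidean (\<lambda>x. f (centred (map x [0..<n]) (int j)))" for j
  proof -
    have "continuous_map (words_of_length n) euclidean (\<lambda>x. centred (map x [0..<n]) (int j) i)" for i
    proof (cases "0 \<le> int j + i \<and> int j + i < int n")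
      case True
      then have "continuous_map (words_of_length n) euclidean (\<lambda>x. x (nat (int j + i)))"
        by (intro continuous_map_product_projection) auto
      with True show ?thesis
        by (simp add: centred_def nat_less_iff)
    qed (auto simp: centred_def)
    then have "continuous_map (words_of_length n) (product_topology (\<lambda>_. euclidean) UNIV)
        (\<lambda>x. centred (map x [0..<n]) (int j))"
      unfolding continuous_map_componentwise_UNIV by blast
    then have "continuous_map (words_of_length n) euclidean (\<lambda>x. centred (map x [0..<n]) (int j))"
      unfolding euclidean_product_topology .
    moreover have "continuous_map euclidean euclidean f" using assms by simp
    ultimately show ?thesis
      using continuous_map_compose[of _ _ _ euclidean f] by (fastforce simp: comp_def)
  qed
  then show "continuous_map (words_of_length n) euclidean (\<lambda>x. occurrence_sum f (map x [0..<n]))"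
    unfolding occurrence_sum_def by (simp add: continuous_map_sum)
qed

section \<open>Boundary errors of local functions on finite words\<close>

lemma abs_sum_diff_le:
  fixes a b :: "nat \<Rightarrow> real"
  assumes "finite S" "card S \<le> m" "0 \<le> c"
    and "\<And>j. j < n \<Longrightarrow> j \<notin> S \<Longrightarrow> a j = b j" "\<And>j. \<bar>a j - b j\<bar> \<le> c"
  shows "\<bar>(\<Sum>j<n. a j) - (\<Sum>j<n. b j)\<bar> \<le> c * real m"
proof -
  have "\<bar>(\<Sum>j<n. a j) - (\<Sum>j<n. b j)\<bar> \<le> (\<Sum>j<n. \<bar>a j - b j\<bar>)"
    unfolding sum_subtractf[symmetric] by (rule sum_abs)
  also have "\<dots> = (\<Sum>j\<in>{..<n} \<inter> S. \<bar>a j - b j\<bar>)"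
    using assms(4) by (intro sum.mono_neutral_right) auto
  also have "\<dots> \<le> real (card ({..<n} \<inter> S)) * c"
    using assms(5) by (intro sum_bounded_above)
  also have "\<dots> \<le> real m * c"
    using assms(1-3) card_mono[OF assms(1), of "{..<n} \<inter> S"] by (intro mult_right_mono) auto
  finally show ?thesis by (simp add: mult.commute)
qed

lemma sum_lessThan_add:
  fixes h :: "nat \<Rightarrow> 'b::comm_monoid_add"
  shows "(\<Sum>j<m + n. h j) = (\<Sum>j<m. h j) + (\<Sum>j<n. h (m + j))"
  by (induction n) (simp_all add: add.assoc)

context
  fixes f :: "(int \<Rightarrow> 'a::topological_space) \<Rightarrow> real" and K :: nat and B :: real
  assumes local: "local_function K f" and bounded: "\<And>w. \<bar>f w\<bar> \<le> B"
begin

lemma local_function_cong: "(\<And>i. \<bar>i\<bar> \<le> int K \<Longrightarrow> w i = w' i) \<Longrightarrow> f w = f w'"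
  using local unfolding local_function_def by blast

lemma local_function_diff_le: "\<bar>f w - f w'\<bar> \<le> 2 * B"
  using bounded[of w] bounded[of w'] by linarith

lemma local_function_bound_nonneg: "0 \<le> B"
  using bounded[of undefined] by linarith

lemma occurrence_sum_bound: "\<bar>occurrence_sum f v\<bar> \<le> B * real (length v)"
proof -
  have "\<bar>occurrence_sum f v\<bar> \<le> (\<Sum>j<length v. \<bar>f (centred v (int j))\<bar>)"
    unfolding occurrence_sum_def by (rule sum_abs)
  also have "\<dots> \<le> real (card {..<length v}) * B"
    using bounded by (intro sum_bounded_above)
  finally show ?thesis by (simp add: mult.commute)
qed

text \<open>Only the last \<open>K\<close> positions of \<open>u\<close> and the first
  \<open>K\<close> of \<open>v\<close> see across the seam; each of these \<open>2 * K\<close>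
  positions contributes at most \<open>2 * B\<close>.\<close>

lemma occurrence_sum_append:
  "\<bar>occurrence_sum f (u @ v) - occurrence_sum f u - occurrence_sum f v\<bar> \<le> 4 * B * real K"
proof -
  define a where "a j = f (centred (u @ v) (int j))" for j
  have "\<bar>(\<Sum>j<length u. a j) - (\<Sum>j<length u. f (centred u (int j)))\<bar> \<le> 2 * B * real K"
  \<comment> \<open>Truncated subtraction covers words shorter than \<open>K\<close>: then all
    positions of \<open>u\<close> are exceptional.\<close>
  proof (rule abs_sum_diff_le[where S = "{length u - K..<length u}"])
    show "a j = f (centred u (int j))" if "j < length u" "j \<notin> {length u - K..<length u}" for j
      unfolding a_def by (rule local_function_cong) (use that in \<open>auto simp: centred_def nth_append\<close>)
  qed (use local_function_bound_nonneg local_function_diff_le in \<open>auto simp: a_def\<close>)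
  moreover have "\<bar>(\<Sum>j<length v. a (length u + j)) - (\<Sum>j<length v. f (centred v (int j)))\<bar> \<le> 2 * B * real K"
  proof (rule abs_sum_diff_le[where S = "{..<K}"])
    show "a (length u + j) = f (centred v (int j))" if "j < length v" "j \<notin> {..<K}" for j
      unfolding a_def
    proof (rule local_function_cong)
      fix i :: int assume i: "\<bar>i\<bar> \<le> int K"
      with that have "nat (int (length u + j) + i) = length u + nat (int j + i)" by auto
      with i that show "centred (u @ v) (int (length u + j)) i = centred v (int j) i"
        by (auto simp: centred_def nth_append)
    qed
  qed (use local_function_bound_nonneg local_function_diff_le in \<open>auto simp: a_def\<close>)
  moreover have "occurrence_sum f (u @ v) = (\<Sum>j<length u. a j) + (\<Sum>j<length v. a (length u + j))"
    by (simp add: occurrence_sum_def sum_lessThan_add flip: a_def)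
  ultimately show ?thesis
    unfolding occurrence_sum_def[of f u] occurrence_sum_def[of f v] by linarith
qed

lemma occurrence_sum_concat:
  "\<bar>occurrence_sum f (concat ws) - (\<Sum>w\<leftarrow>ws. occurrence_sum f w)\<bar> \<le> 4 * B * real K * real (length ws)"
proof (induction ws)
  case Nil
  show ?case by (simp add: occurrence_sum_def)
next
  case (Cons w ws)
  then show ?case
    using occurrence_sum_append[of w "concat ws"] by (simp add: algebra_simps)
qed

text \<open>Both ends of the window are exceptional, with \<open>K\<close> positions each, because
  the filler replaces the letters of \<open>x\<close> outside the window.\<close>

lemma birkhoff_sum_window:
  "\<bar>(\<Sum>j<n. f ((left_shift ^^ j) x)) - occurrence_sum f (window 0 n x)\<bar> \<le> 4 * B * real K"
proof -
  have shift: "(left_shift ^^ j) x = (\<lambda>i. x (i + int j))" for j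
    by (induction j) (auto simp: left_shift_def fun_eq_iff algebra_simps)
  have "\<bar>(\<Sum>j<n. f ((left_shift ^^ j) x)) - (\<Sum>j<n. f (centred (window 0 n x) (int j)))\<bar> \<le> 2 * B * real (2 * K)"
  proof (rule abs_sum_diff_le[where S = "{..<K} \<union> {n - K..<n}"])
    show "f ((left_shift ^^ j) x) = f (centred (window 0 n x) (int j))"
      if "j < n" "j \<notin> {..<K} \<union> {n - K..<n}" for j
      unfolding shift by (rule local_function_cong) (use that in \<open>auto simp: centred_def add.commute\<close>)
    show "card ({..<K} \<union> {n - K..<n}) \<le> 2 * K"
      using card_Un_le[of "{..<K}" "{n - K..<n}"] by simp
  qed (use local_function_bound_nonneg local_function_diff_le in auto)
  then show ?thesis by (simp add: occurrence_sum_def)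
qed

end

section \<open>Factors of concatenated blocks\<close>

lemma prefix_concat_decomposition:
  assumes "prefix u (concat ws)" "\<And>w. w \<in> set ws \<Longrightarrow> length w \<le> H"
  shows "\<exists>ws' t. u = concat ws' @ t \<and> length t \<le> H \<and> set ws' \<subseteq> set ws"
  using assms
proof (induction ws arbitrary: u)
  case Nil
  then show ?case by (auto intro: exI[of _ "[]"])
next
  case (Cons w ws)
  show ?case
  proof (cases "prefix u w")
    case True
    then have "length u \<le> H" using Cons.prems(2)[of w] prefix_length_le by fastforce
    then show ?thesis by (intro exI[of _ "[]"] exI[of _ u]) auto
  next
    case False
    then obtain u' where u': "u = w @ u'" "prefix u' (concat ws)"
      using Cons.prems(1) by (auto simp: prefix_append)
    obtain ws' t where "u' = concat ws' @ t" "length t \<le> H" "set ws' \<subseteq> set ws"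
      using Cons.IH[OF u'(2)] Cons.prems(2) by auto
    then show ?thesis
      using u'(1) by (intro exI[of _ "w # ws'"] exI[of _ t]) auto
  qed
qed

text \<open>A factor cuts at most two blocks, one at each end, and the cut pieces are no longer than
  a block. A factor inside a single block counts as an end piece.\<close>

lemma sublist_concat_decomposition:
  assumes "sublist u (concat ws)" "\<And>w. w \<in> set ws \<Longrightarrow> length w \<le> H"
  shows "\<exists>s ws' t. u = s @ concat ws' @ t \<and> length s \<le> H \<and> length t \<le> H \<and> set ws' \<subseteq> set ws"
  using assms
proof (induction ws arbitrary: u)
  case Nil
  then show ?case by (auto intro!: exI[of _ "[]"])
next
  case (Cons w ws)
  have "sublist u w \<or> sublist u (concat ws) \<or> (\<exists>s v. u = s @ v \<and> suffix s w \<and> prefix v (concat ws))"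
    using Cons.prems(1) by (simp add: sublist_append)
  then consider "sublist u w" | "sublist u (concat ws)"
    | s v where "u = s @ v" "suffix s w" "prefix v (concat ws)"
    by blast
  then show ?case
  proof cases
    case 1
    then have "length u \<le> H" using Cons.prems(2)[of w] sublist_length_le by fastforce
    then show ?thesis by (intro exI[of _ u] exI[of _ "[]"]) auto
  next
    case 2
    then obtain s ws' t where "u = s @ concat ws' @ t" "length s \<le> H" "length t \<le> H" "set ws' \<subseteq> set ws"
      using Cons.IH Cons.prems(2) by (metis list.set_intros(2))
    then show ?thesis by (intro exI[of _ s] exI[of _ ws'] exI[of _ t]) auto
  next
    case 3
    obtain ws' t where "v = concat ws' @ t" "length t \<le> H" "set ws' \<subseteq> set ws"
      using prefix_concat_decomposition[OF 3(3)] Cons.prems(2) by (metis list.set_intros(2))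
    moreover have "length s \<le> H" using 3(2) Cons.prems(2)[of w] suffix_length_le by fastforce
    ultimately show ?thesis
      using 3(1) by (intro exI[of _ s] exI[of _ ws'] exI[of _ t]) auto
  qed
qed

text \<open>Stone-Weierstrass: local functions form an algebra, because two of them share the larger
  radius, and a Urysohn function of a single coordinate separates points.\<close>

lemma local_function_dense:
  fixes X :: "(int \<Rightarrow> 'a::t2_space) set"
  assumes "compact (UNIV :: 'a set)" "closed X" "continuous_on X f" "0 < e"
  shows "\<exists>K g. local_function K g \<and> (\<forall>x\<in>X. \<bar>f x - g x\<bar> < e)"
proof -
  have "compact X"
    using compact_Int_closed[OF compact_UNIV_fun[OF assms(1)] assms(2)] by simp
  have mono: "local_function K' g" if "local_function K g" "K \<le> K'" for K K' and g :: "(int \<Rightarrow> 'a) \<Rightarrow> real"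
    using that unfolding local_function_def by (meson of_nat_mono order_trans)
  have "\<exists>g. (\<exists>K. local_function K g) \<and> (\<forall>x\<in>X. \<bar>f x - g x\<bar> < e)"
  proof (rule Stone_Weierstrass_HOL[OF \<open>compact X\<close> _ _ _ _ _ assms(3,4)])
    show "\<exists>K. local_function K (\<lambda>x :: int \<Rightarrow> 'a. c)" for c :: real
      by (auto simp: local_function_def)
    show "continuous_on X g" if "\<exists>K. local_function K g" for g
      using that continuous_on_subset unfolding local_function_def by blast
    fix g h :: "(int \<Rightarrow> 'a) \<Rightarrow> real"
    assume "(\<exists>K. local_function K g) \<and> (\<exists>K. local_function K h)"
    then obtain K L where "local_function K g" "local_function L h" by blast
    then have gh: "local_function (max K L) g" "local_function (max K L) h"
      using mono by simp_all
    have "local_function (max K L) (\<lambda>x. g x + h x)" "local_function (max K L) (\<lambda>x. g x * h x)"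
      unfolding local_function_def
      using gh[unfolded local_function_def] by (auto intro!: continuous_intros arg_cong2[where f = "(+)"] arg_cong2[where f = "(*)"])
    then show "\<exists>K. local_function K (\<lambda>x. g x + h x)" "\<exists>K. local_function K (\<lambda>x. g x * h x)"
      by blast+
  next
    fix x y :: "int \<Rightarrow> 'a"
    assume "x \<in> X \<and> y \<in> X \<and> x \<noteq> y"
    then obtain i where i: "x i \<noteq> y i" by auto
    have "Hausdorff_space (euclidean :: 'a topology)"
      unfolding Hausdorff_space_def disjnt_def using separation_t2 by (metis open_openin)
    moreover have "compact_space (euclidean :: 'a topology)"
      using assms(1) by (simp add: compact_space_def)
    ultimately have "normal_space (euclidean :: 'a topology)"
      by (intro compact_Hausdorff_or_regular_imp_normal_space) auto
    then obtain h :: "'a \<Rightarrow> real" where h: "continuous_map euclidean euclideanreal h" "h ` {x i} \<subseteq> {0}" "h ` {y i} \<subseteq> {1}"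
      using i Urysohn_lemma_alt[of euclidean "{x i}" "{y i}" 0 1] by (auto simp: disjnt_def)
    define g where "g = (\<lambda>w :: int \<Rightarrow> 'a. h (w i))"
    have "continuous_on UNIV h"
      using h(1) by simp
    then have "continuous_on UNIV g"
      unfolding g_def using continuous_on_product_coordinates[of i]
      by (rule continuous_on_compose2) auto
    then have "local_function (nat \<bar>i\<bar>) g"
      by (auto simp: local_function_def g_def)
    moreover have "g x \<noteq> g y" using h by (simp add: g_def)
    ultimately show "\<exists>g. (\<exists>K. local_function K g) \<and> g x \<noteq> g y" by blast
  qed
  then show ?thesis by blast
qed

section \<open>Unique ergodicity\<close>

definition birkhoff_average :: "((int \<Rightarrow> 'a) \<Rightarrow> real) \<Rightarrow> nat \<Rightarrow> (int \<Rightarrow> 'a) \<Rightarrow> real" where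
  "birkhoff_average f n x = (\<Sum>j<n. f ((left_shift ^^ j) x)) / real n"

lemma birkhoff_average_diff_le:
  assumes "\<And>j. \<bar>f ((left_shift ^^ j) x) - g ((left_shift ^^ j) x)\<bar> \<le> e" "0 \<le> e"
  shows "\<bar>birkhoff_average f n x - birkhoff_average g n x\<bar> \<le> e"
proof (cases "n = 0")
  case False
  have "\<bar>(\<Sum>j<n. f ((left_shift ^^ j) x)) - (\<Sum>j<n. g ((left_shift ^^ j) x))\<bar> \<le> (\<Sum>j<n. \<bar>f ((left_shift ^^ j) x) - g ((left_shift ^^ j) x)\<bar>)"
    unfolding sum_subtractf[symmetric] by (rule sum_abs)
  also have "\<dots> \<le> real (card {..<n}) * e"
    using assms(1) by (intro sum_bounded_above)
  finally have "\<bar>((\<Sum>j<n. f ((left_shift ^^ j) x)) - (\<Sum>j<n. g ((left_shift ^^ j) x))) / real n\<bar> \<le> e"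
    using False by (simp add: pos_divide_le_eq mult.commute)
  then show ?thesis
    by (simp add: birkhoff_average_def diff_divide_distrib)
qed (simp add: birkhoff_average_def assms(2))

lemma left_shift_subshift:
  assumes "x \<in> subshift \<rho>"
  shows "left_shift x \<in> subshift \<rho>"
proof -
  have eq: "window i n (left_shift x) = window (i + 1) n x" for i n
    by (intro map_cong) (auto simp: left_shift_def algebra_simps)
  have "window (i + 1) n x \<in> language \<rho>" for i n
    using assms unfolding subshift_def by blast
  then show ?thesis
    unfolding subshift_def by (auto simp only: eq)
qed

lemma left_shift_funpow_subshift: "x \<in> subshift \<rho> \<Longrightarrow> (left_shift ^^ j) x \<in> subshift \<rho>"
  by (induction j) (simp_all add: left_shift_subshift)

lemma continuous_on_left_shift_funpow:
  "continuous_on S (left_shift ^^ j :: (int \<Rightarrow> 'a::topological_space) \<Rightarrow> int \<Rightarrow> 'a)"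
proof -
  have "left_shift ^^ j = (\<lambda>w :: int \<Rightarrow> 'a. \<lambda>i. w (i + int j))"
    by (induction j) (auto simp: left_shift_def fun_eq_iff algebra_simps)
  then show ?thesis
    by (auto intro!: continuous_on_coordinatewise_then_product continuous_on_subset[OF continuous_on_product_coordinates])
qed

text \<open>The constant may a priori depend on \<open>e\<close>. Comparison with \<open>x0\<close>
  shows that the values \<open>A n x0\<close> are Cauchy, and their limit serves for every
  \<open>e\<close>. This carries uniform averages from local functions to all continuous
  ones.\<close>

lemma uniform_limit_if_nearly_constant:
  fixes A :: "nat \<Rightarrow> 'x \<Rightarrow> real"
  assumes "x0 \<in> X" and approx: "\<And>e. 0 < e \<Longrightarrow> \<exists>c N. \<forall>n\<ge>N. \<forall>x\<in>X. \<bar>A n x - c\<bar> \<le> e"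
  shows "\<exists>c. \<forall>e>0. \<exists>N. \<forall>n\<ge>N. \<forall>x\<in>X. \<bar>A n x - c\<bar> \<le> e"
proof -
  have close: "\<exists>N. \<forall>n\<ge>N. \<forall>m\<ge>N. \<forall>x\<in>X. \<bar>A n x - A m x0\<bar> \<le> e" if e: "0 < e" for e
  proof -
    obtain c N where N: "\<And>n x. n \<ge> N \<Longrightarrow> x \<in> X \<Longrightarrow> \<bar>A n x - c\<bar> \<le> e / 2"
      using approx[of "e / 2"] e by auto
    have "\<bar>A n x - A m x0\<bar> \<le> e" if "n \<ge> N" "m \<ge> N" "x \<in> X" for n m x
      using N[OF that(1,3)] N[OF that(2) assms(1)] by linarith
    then show ?thesis by blast
  qed
  have "Cauchy (\<lambda>m. A m x0)"
    unfolding Cauchy_def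
  proof (intro allI impI)
    fix e :: real assume "0 < e"
    then obtain N where N: "\<And>n m. n \<ge> N \<Longrightarrow> m \<ge> N \<Longrightarrow> \<bar>A n x0 - A m x0\<bar> \<le> e / 2"
      using close[of "e / 2"] assms(1) by auto
    show "\<exists>M. \<forall>m\<ge>M. \<forall>n\<ge>M. dist (A m x0) (A n x0) < e"
      using le_less_trans[OF N, of _ _ e] \<open>0 < e\<close> by (intro exI[of _ N]) (auto simp: dist_real_def)
  qed
  then obtain c where c: "(\<lambda>m. A m x0) \<longlonglongrightarrow> c"
    using Cauchy_convergent convergent_def by blast
  have "\<exists>N. \<forall>n\<ge>N. \<forall>x\<in>X. \<bar>A n x - c\<bar> \<le> e" if e: "0 < e" for e
  proof -
    obtain N where N: "\<And>n m x. n \<ge> N \<Longrightarrow> m \<ge> N \<Longrightarrow> x \<in> X \<Longrightarrow> \<bar>A n x - A m x0\<bar> \<le> e"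
      using close[OF e] by blast
    have "\<bar>A n x - c\<bar> \<le> e" if "n \<ge> N" "x \<in> X" for n x
    proof (rule LIMSEQ_le_const2)
      show "(\<lambda>m. \<bar>A n x - A m x0\<bar>) \<longlonglongrightarrow> \<bar>A n x - c\<bar>"
        by (intro tendsto_intros c)
      show "\<exists>M. \<forall>m\<ge>M. \<bar>A n x - A m x0\<bar> \<le> e"
        using N[OF that(1) _ that(2)] by blast
    qed
    then show ?thesis by blast
  qed
  then show ?thesis by blast
qed

section \<open>Invariant functionals on C(X)\<close>

lemma mspace_CX_iff:
  assumes "compact X"
  shows "f \<in> mspace (CX X) \<longleftrightarrow> f \<in> extensional X \<and> continuous_on X f"
proof -
  have "compactin (top_of_set X) (topspace (top_of_set X))"
    using assms by (simp add: compactin_subtopology)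
  then show ?thesis
    unfolding compactin_mspace_cfunspace[OF \<open>compactin (top_of_set X) (topspace (top_of_set X))\<close>] by simp
qed

lemma restrict_mem_CX:
  assumes "compact X" "continuous_on X f"
  shows "restrict f X \<in> mspace (CX X)"
  unfolding mspace_CX_iff[OF assms(1)]
  using assms(2) continuous_on_cong[of X X "restrict f X" f] by simp

lemma measure_on_mono:
  assumes "compact X" "measure_on X \<mu>" "f \<in> mspace (CX X)" "g \<in> mspace (CX X)"
    and "\<And>x. x \<in> X \<Longrightarrow> f x \<le> g x"
  shows "\<mu> f \<le> \<mu> g"
proof -
  have add: "\<And>f g. f \<in> mspace (CX X) \<Longrightarrow> g \<in> mspace (CX X) \<Longrightarrow> \<mu> (\<lambda>x\<in>X. f x + g x) = \<mu> f + \<mu> g"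
    and pos: "\<And>f. f \<in> mspace (CX X) \<Longrightarrow> (\<And>x. x \<in> X \<Longrightarrow> 0 \<le> f x) \<Longrightarrow> 0 \<le> \<mu> f"
    using assms(2) unfolding measure_on_def by blast+
  define h where "h = restrict (\<lambda>x. g x - f x) X"
  have cont: "continuous_on X f" "continuous_on X g" "g \<in> extensional X"
    using assms(3,4) by (simp_all only: mspace_CX_iff[OF assms(1)])
  have h: "h \<in> mspace (CX X)"
    unfolding h_def by (intro restrict_mem_CX assms(1) continuous_on_diff cont)
  have "(\<lambda>x\<in>X. f x + h x) = g"
    using cont(3) by (intro extensionalityI[of _ X]) (auto simp: h_def)
  then have "\<mu> g = \<mu> f + \<mu> h" using add[OF assms(3) h] by simp
  moreover have "0 \<le> \<mu> h" using assms(5) by (intro pos h) (simp add: h_def)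
  ultimately show ?thesis by simp
qed

text \<open>Existence: the constants \<open>c f\<close>, read off as limits at \<open>x0\<close>,
  form a positive linear functional, invariant because the limits do not depend on the point.
  Uniqueness: an invariant \<open>\<nu>\<close> takes the same value at a function and at its
  Birkhoff averages, which are uniformly close to the constant \<open>c f\<close>.\<close>

lemma uniquely_ergodic_if_uniform_averages:
  fixes \<rho> :: "'a::t2_space \<Rightarrow> 'a list"
  defines "X \<equiv> subshift \<rho>"
  assumes K: "compact (UNIV :: 'a set)" and x0: "x0 \<in> X"
    and avg: "\<And>f. continuous_on X f \<Longrightarrow>
      \<exists>c. \<forall>e>0. \<exists>N. \<forall>n\<ge>N. \<forall>x\<in>X. \<bar>birkhoff_average f n x - c\<bar> \<le> e"
  shows "uniquely_ergodic X"
proof -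
  have X: "compact X"
    unfolding X_def using compact_Int_closed[OF compact_UNIV_fun[OF K] closed_subshift] by simp
  have shift: "(left_shift ^^ j) x \<in> X" if "x \<in> X" for x j
    using that unfolding X_def by (rule left_shift_funpow_subshift)
  have shift1: "left_shift x \<in> X" if "x \<in> X" for x
    using shift[OF that, of 1] by simp
  have CXD: "continuous_on X f" "f \<in> extensional X" if "f \<in> mspace (CX X)" for f
    using that by (simp_all only: mspace_CX_iff[OF X])
  have "\<exists>c. \<forall>f\<in>mspace (CX X). \<forall>e>0. \<exists>N. \<forall>n\<ge>N. \<forall>x\<in>X. \<bar>birkhoff_average f n x - c f\<bar> \<le> e"
    by (rule bchoice) (use avg CXD(1) in blast)
  then obtain c where c: "\<And>f e. f \<in> mspace (CX X) \<Longrightarrow> 0 < e \<Longrightarrow>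
      \<exists>N. \<forall>n\<ge>N. \<forall>x\<in>X. \<bar>birkhoff_average f n x - c f\<bar> \<le> e"
    by blast
  have lim: "(\<lambda>n. birkhoff_average f n x) \<longlonglongrightarrow> c f" if f: "f \<in> mspace (CX X)" and x: "x \<in> X" for f x
    unfolding LIMSEQ_iff
  proof (intro allI impI)
    fix e :: real assume e: "0 < e"
    then obtain N where N: "\<And>n x. n \<ge> N \<Longrightarrow> x \<in> X \<Longrightarrow> \<bar>birkhoff_average f n x - c f\<bar> \<le> e / 2"
      using c[OF f, of "e / 2"] by auto
    show "\<exists>N. \<forall>n\<ge>N. norm (birkhoff_average f n x - c f) < e"
      using le_less_trans[OF N[OF _ x], of _ e] e by (intro exI[of _ N]) auto
  qed
  have cI: "c f = d" if "f \<in> mspace (CX X)" "(\<lambda>n. birkhoff_average f n x0) \<longlonglongrightarrow> d" for f d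
    using LIMSEQ_unique[OF lim[OF that(1) x0] that(2)] .
  define \<mu> where "\<mu> = restrict c (mspace (CX X))"
  have \<mu>: "\<mu> f = c f" if "f \<in> mspace (CX X)" for f
    using that by (simp only: \<mu>_def restrict_apply')
  have c_add: "c (\<lambda>x\<in>X. f x + g x) = c f + c g" if "f \<in> mspace (CX X)" "g \<in> mspace (CX X)" for f g
  proof (rule cI)
    show "(\<lambda>x\<in>X. f x + g x) \<in> mspace (CX X)"
      by (intro restrict_mem_CX X continuous_on_add CXD that)
    have "birkhoff_average (\<lambda>x\<in>X. f x + g x) n x0 = birkhoff_average f n x0 + birkhoff_average g n x0" for n
      using x0 shift by (simp add: birkhoff_average_def sum.distrib add_divide_distrib)
    then show "(\<lambda>n. birkhoff_average (\<lambda>x\<in>X. f x + g x) n x0) \<longlonglongrightarrow> c f + c g"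
      using tendsto_add[OF lim[OF that(1) x0] lim[OF that(2) x0]] by simp
  qed
  have c_mult: "c (\<lambda>x\<in>X. b * f x) = b * c f" if "f \<in> mspace (CX X)" for f b
  proof (rule cI)
    show "(\<lambda>x\<in>X. b * f x) \<in> mspace (CX X)"
      by (intro restrict_mem_CX X continuous_on_mult_left CXD that)
    have "birkhoff_average (\<lambda>x\<in>X. b * f x) n x0 = b * birkhoff_average f n x0" for n
      using x0 shift by (simp add: birkhoff_average_def sum_distrib_left)
    then show "(\<lambda>n. birkhoff_average (\<lambda>x\<in>X. b * f x) n x0) \<longlonglongrightarrow> b * c f"
      using tendsto_mult_left[OF lim[OF that x0], of b] by simp
  qed
  have c_diff: "dist (c f) (c g) \<le> 1 * mdist (CX X) f g" if f: "f \<in> mspace (CX X)" and g: "g \<in> mspace (CX X)" for f g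
  proof (rule LIMSEQ_le_const2)
    show "(\<lambda>n. dist (birkhoff_average f n x0) (birkhoff_average g n x0)) \<longlonglongrightarrow> dist (c f) (c g)"
      by (intro tendsto_dist lim f g x0)
    have le: "\<bar>f x - g x\<bar> \<le> mdist (CX X) f g" if "x \<in> X" for x
      using mdist_cfunspace_imp_mdist_le[OF f g order_refl, of x] that by (simp add: dist_real_def)
    show "\<exists>N. \<forall>n\<ge>N. dist (birkhoff_average f n x0) (birkhoff_average g n x0) \<le> 1 * mdist (CX X) f g"
      using birkhoff_average_diff_le[of f x0 g "mdist (CX X) f g"] le shift[OF x0] le[OF x0]
      by (auto simp: dist_real_def)
  qed
  have "Lipschitz_continuous_map (CX X) euclidean_metric \<mu>"
    unfolding Lipschitz_continuous_map_def mdist_euclidean_metric mspace_euclidean_metric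
    using c_diff \<mu> by (intro conjI exI[of _ 1] ballI) auto
  then have cont: "continuous_map (mtopology_of (CX X)) euclidean \<mu>"
    using Lipschitz_continuous_imp_continuous_map by fastforce
  have one: "(\<lambda>x\<in>X. 1) \<in> mspace (CX X)"
    by (intro restrict_mem_CX X continuous_on_const)
  have prob: "invariant_probability X \<mu>"
    unfolding invariant_probability_def measure_on_def
  proof (intro conjI ballI allI impI)
    show "\<mu> \<in> extensional (mspace (CX X))" unfolding \<mu>_def by (rule restrict_extensional)
    show "continuous_map (mtopology_of (CX X)) euclidean \<mu>" by (rule cont)
    show "\<mu> (\<lambda>x\<in>X. 1) = 1"
      unfolding \<mu>[OF one]
    proof (rule cI[OF one])
      show "(\<lambda>n. birkhoff_average (\<lambda>x\<in>X. 1) n x0) \<longlonglongrightarrow> 1"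
        by (rule tendsto_eventually, rule eventually_sequentiallyI[of 1])
          (use shift[OF x0] in \<open>simp add: birkhoff_average_def\<close>)
    qed
    fix f assume f: "f \<in> mspace (CX X)"
    show "\<mu> (\<lambda>x\<in>X. f x + g x) = \<mu> f + \<mu> g" if "g \<in> mspace (CX X)" for g
      using c_add[OF f that] \<mu>[OF f] \<mu>[OF that] \<mu>[OF restrict_mem_CX[OF X continuous_on_add[OF CXD(1)[OF f] CXD(1)[OF that]]]]
      by simp
    show "\<mu> (\<lambda>x\<in>X. b * f x) = b * \<mu> f" for b
      using c_mult[OF f] \<mu>[OF f] \<mu>[OF restrict_mem_CX[OF X continuous_on_mult_left[OF CXD(1)[OF f]]]]
      by simp
    show "0 \<le> \<mu> f" if "\<forall>x\<in>X. 0 \<le> f x"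
      unfolding \<mu>[OF f]
      by (rule LIMSEQ_le_const[OF lim[OF f x0]])
        (use that shift[OF x0] in \<open>auto simp: birkhoff_average_def intro!: divide_nonneg_nonneg sum_nonneg\<close>)
    have contS: "continuous_on X (\<lambda>x. f (left_shift x))"
      using continuous_on_compose2[OF CXD(1)[OF f] continuous_on_left_shift_funpow[of X 1]] shift1 by auto
    have fS: "(\<lambda>x\<in>X. f (left_shift x)) \<in> mspace (CX X)"
      by (intro restrict_mem_CX X contS)
    show "\<mu> (\<lambda>x\<in>X. f (left_shift x)) = \<mu> f"
      unfolding \<mu>[OF f] \<mu>[OF fS]
    proof (rule cI[OF fS])
      have "birkhoff_average (\<lambda>x\<in>X. f (left_shift x)) n x0 = birkhoff_average f n (left_shift x0)" for n
        using shift[OF x0] by (simp add: birkhoff_average_def flip: funpow_swap1)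
      then show "(\<lambda>n. birkhoff_average (\<lambda>x\<in>X. f (left_shift x)) n x0) \<longlonglongrightarrow> c f"
        using lim[OF f shift1[OF x0]] by simp
    qed
  qed
  moreover have "\<nu> = \<mu>" if \<nu>: "invariant_probability X \<nu>" for \<nu>
  proof (rule extensionalityI[of _ "mspace (CX X)"])
    have m: "measure_on X \<nu>" and one1: "\<nu> (\<lambda>x\<in>X. 1) = 1"
      and inv: "\<And>f. f \<in> mspace (CX X) \<Longrightarrow> \<nu> (\<lambda>x\<in>X. f (left_shift x)) = \<nu> f"
      using \<nu> unfolding invariant_probability_def by blast+
    have ext: "\<nu> \<in> extensional (mspace (CX X))"
      and add: "\<And>f g. f \<in> mspace (CX X) \<Longrightarrow> g \<in> mspace (CX X) \<Longrightarrow> \<nu> (\<lambda>x\<in>X. f x + g x) = \<nu> f + \<nu> g"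
      and mult: "\<And>b f. f \<in> mspace (CX X) \<Longrightarrow> \<nu> (\<lambda>x\<in>X. b * f x) = b * \<nu> f"
      using m unfolding measure_on_def by blast+
    show "\<nu> \<in> extensional (mspace (CX X))" by (rule ext)
    show "\<mu> \<in> extensional (mspace (CX X))" unfolding \<mu>_def by (rule restrict_extensional)
    fix f assume f: "f \<in> mspace (CX X)"
    have contS: "continuous_on X (\<lambda>x. f ((left_shift ^^ j) x))" for j
      by (rule continuous_on_compose2[OF CXD(1)[OF f] continuous_on_left_shift_funpow]) (use shift in auto)
    have \<nu>S: "\<nu> (\<lambda>x\<in>X. f ((left_shift ^^ j) x)) = \<nu> f" for j
    proof (induction j)
      case 0
      have "(\<lambda>x\<in>X. f ((left_shift ^^ 0) x)) = f"
        using CXD(2)[OF f] by (intro extensionalityI[of _ X]) auto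
      then show ?case by simp
    next
      case (Suc j)
      have shift_eq: "(\<lambda>x\<in>X. f ((left_shift ^^ Suc j) x)) = (\<lambda>x\<in>X. (\<lambda>x\<in>X. f ((left_shift ^^ j) x)) (left_shift x))"
        using shift1 by (intro restrict_ext) (simp add: funpow_swap1)
      show ?case
        unfolding shift_eq inv[OF restrict_mem_CX[OF X contS]] by (simp only: Suc)
    qed
    \<comment> \<open>Additivity is given only for two functions, each restricted to
      \<open>X\<close>, hence the induction and the nested restrictions.\<close>
    have sums: "\<nu> (\<lambda>x\<in>X. \<Sum>j<n. f ((left_shift ^^ j) x)) = real n * \<nu> f" for n
    proof (induction n)
      case 0
      have zero: "(\<lambda>x\<in>X. \<Sum>j<0. f ((left_shift ^^ j) x)) = (\<lambda>x\<in>X. 0 * f x)"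
        by (intro restrict_ext) simp
      show ?case unfolding zero mult[OF f] by simp
    next
      case (Suc n)
      have sm: "(\<lambda>x\<in>X. \<Sum>j<n. f ((left_shift ^^ j) x)) \<in> mspace (CX X)"
        by (intro restrict_mem_CX X continuous_on_sum contS)
      have split: "(\<lambda>x\<in>X. \<Sum>j<Suc n. f ((left_shift ^^ j) x)) =
          (\<lambda>x\<in>X. (\<lambda>x\<in>X. \<Sum>j<n. f ((left_shift ^^ j) x)) x + (\<lambda>x\<in>X. f ((left_shift ^^ n) x)) x)"
        by (intro restrict_ext) simp
      show ?case
        unfolding split add[OF sm restrict_mem_CX[OF X contS[of n]]] Suc \<nu>S[of n] by (simp add: algebra_simps)
    qed
    have le: "\<bar>\<nu> f - c f\<bar> \<le> e" if e: "0 < e" for e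
    proof -
      obtain N where N: "\<And>n x. n \<ge> N \<Longrightarrow> x \<in> X \<Longrightarrow> \<bar>birkhoff_average f n x - c f\<bar> \<le> e"
        using c[OF f e] by blast
      \<comment> \<open>\<open>Suc N\<close> keeps the divisor of the average nonzero.\<close>
      define n where "n = Suc N"
      define g where "g = (\<lambda>x\<in>X. birkhoff_average f n x)"
      have gs: "g = (\<lambda>x\<in>X. (1 / real n) * (\<lambda>x\<in>X. \<Sum>j<n. f ((left_shift ^^ j) x)) x)"
        unfolding g_def by (intro restrict_ext) (simp add: birkhoff_average_def)
      have sm: "(\<lambda>x\<in>X. \<Sum>j<n. f ((left_shift ^^ j) x)) \<in> mspace (CX X)"
        by (intro restrict_mem_CX X continuous_on_sum contS)
      have \<nu>g: "\<nu> g = \<nu> f"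
        unfolding gs mult[OF sm] sums by (simp add: n_def)
      have g: "g \<in> mspace (CX X)"
        unfolding gs by (intro restrict_mem_CX X continuous_on_mult_left CXD sm)
      have const: "(\<lambda>x\<in>X. b) \<in> mspace (CX X)" "\<nu> (\<lambda>x\<in>X. b) = b" for b
      proof -
        show "(\<lambda>x\<in>X. b) \<in> mspace (CX X)" by (intro restrict_mem_CX X continuous_on_const)
        have "(\<lambda>x\<in>X. b) = (\<lambda>x\<in>X. b * (\<lambda>x\<in>X. 1) x)" by (intro restrict_ext) simp
        then show "\<nu> (\<lambda>x\<in>X. b) = b" using mult[OF one, of b] one1 by simp
      qed
      have b: "\<bar>g x - c f\<bar> \<le> e" if "x \<in> X" for x
        using N[of n x] that by (simp add: g_def n_def)
      have "\<nu> g \<le> \<nu> (\<lambda>x\<in>X. c f + e)"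
        by (rule measure_on_mono[OF X m g const(1)]) (use b in \<open>force simp: abs_le_iff\<close>)
      moreover have "\<nu> (\<lambda>x\<in>X. c f - e) \<le> \<nu> g"
        by (rule measure_on_mono[OF X m const(1) g]) (use b in \<open>force simp: abs_le_iff\<close>)
      ultimately show ?thesis by (simp add: const(2) \<nu>g abs_le_iff)
    qed
    have "\<bar>\<nu> f - c f\<bar> \<le> 0"
      by (rule field_le_epsilon) (use le in simp)
    then show "\<nu> f = \<mu> f" using \<mu>[OF f] by simp
  qed
  ultimately show ?thesis
    unfolding uniquely_ergodic_def by blast
qed

section \<open>Uniform averages on the subshift of a primitive substitution\<close>

context primitive_substitution
begin

lemma continuous_rho: "continuous_map euclidean word_topology \<rho>"
  using substitution by (simp add: substitution_def)

text \<open>Centre ever longer words around their position \<open>L\<close> and take a cluster point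
  in the compact product. Each fixed window of the approximants is eventually a factor of an
  iterate, and the language is closed.\<close>

lemma subshift_nonempty:
  assumes long: "\<And>L. \<exists>n a. L \<le> len n a"
  shows "subshift \<rho> \<noteq> {}"
proof -
  have "\<forall>L. \<exists>p. 2 * L \<le> len (fst p) (snd p)"
    using long by simp
  then obtain p where p: "\<And>L. 2 * L \<le> len (fst (p L)) (snd (p L))"
    by metis
  define n a where "n L = fst (p L)" and "a L = snd (p L)" for L
  have na: "2 * L \<le> len (n L) (a L)" for L
    using p by (simp add: n_def a_def)
  define x where "x L = centred (subst_power \<rho> (n L) (a L)) (int L)" for L
  have win: "sublist (window i m (x L)) (subst_power \<rho> (n L) (a L))"
    if L: "nat \<bar>i\<bar> + m \<le> L" for i m L
  proof -
    define v where "v = subst_power \<rho> (n L) (a L)"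
    have v: "2 * L \<le> length v" unfolding v_def by (rule na)
    have "window i m (x L) = take m (drop (nat (int L + i)) v)"
    proof (rule nth_equalityI)
      show "length (window i m (x L)) = length (take m (drop (nat (int L + i)) v))"
        using L v by auto
      fix k assume "k < length (window i m (x L))"
      then have k: "k < m" by simp
      have "nat (int L + (i + int k)) = nat (int L + i) + k" using L by auto
      then show "window i m (x L) ! k = take m (drop (nat (int L + i)) v) ! k"
        using k L v by (auto simp: x_def centred_def simp flip: v_def)
    qed
    then show ?thesis
      unfolding v_def by (metis append_take_drop_id sublist_appendI)
  qed
  \<comment> \<open>A cluster point of the filter replaces a convergent subsequence, since the
    compact space of bi-infinite words need not be sequentially compact.\<close>
  have "\<exists>y\<in>UNIV. inf (nhds y) (filtermap x sequentially) \<noteq> bot"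
    using compact_UNIV_fun[OF compact_space, where 'i = int] unfolding compact_filter
    by (auto simp: filtermap_bot_iff)
  then obtain y where y: "inf (nhds y) (filtermap x sequentially) \<noteq> bot" by blast
  have "window i m y \<in> language \<rho>" for i m
  proof (rule ccontr)
    define S where "S = {w :: int \<Rightarrow> 'a. window i m w \<in> language \<rho>}"
    assume "window i m y \<notin> language \<rho>"
    then have "y \<in> - S" by (simp add: S_def)
    moreover have "closed S"
      unfolding S_def
      using closedin_continuous_map_preimage[OF continuous_map_window[of i m], of "language \<rho>"]
      by (simp add: language_def closedin_closure_of)
    ultimately have "eventually (\<lambda>w. w \<in> - S) (nhds y)"
      by (intro eventually_nhds_in_open) (auto simp: open_Compl)
    moreover have "eventually (\<lambda>w. w \<in> S) (filtermap x sequentially)"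
      unfolding eventually_filtermap
    proof (rule eventually_sequentiallyI)
      fix L assume "nat \<bar>i\<bar> + m \<le> L"
      from win[OF this] have "window i m (x L) \<in> {u. \<exists>n a. sublist u (subst_power \<rho> n a)}" by blast
      then show "x L \<in> S"
        unfolding S_def language_def using closure_of_subset[of "{u. \<exists>n a. sublist u (subst_power \<rho> n a)}" word_topology]
        by auto
    qed
    ultimately have "eventually (\<lambda>w. False) (inf (nhds y) (filtermap x sequentially))"
      unfolding eventually_inf by (metis ComplD)
    with y show False by (simp add: eventually_False)
  qed
  then show ?thesis by (auto simp: subshift_def)
qed


context
  fixes l :: "'a \<Rightarrow>\<^sub>C real" and \<alpha> \<beta> :: real
  assumes l: "\<And>a. 0 < apply_bcontfun l a" "T l = l"
    and conv: "\<And>f. \<exists>c. (\<lambda>n. op_power T n f) \<longlonglongrightarrow> c *\<^sub>R l"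
    and ab: "0 < \<alpha>" "0 < \<beta>"
    and len_ge: "\<And>n a. \<alpha> * r ^ n \<le> real (len n a)"
    and len_le: "\<And>n a. real (len n a) \<le> \<beta> * r ^ n"
begin

lemma growth_rate_gt_1: "1 < r"
  by (rule r_gt_1[OF ab(2) len_le])

lemma len_eventually_ge: "\<exists>N. \<forall>n\<ge>N. \<forall>a. L \<le> real (len n a)"
proof -
  obtain N where N: "L / \<alpha> < r ^ N"
    using real_arch_pow[OF growth_rate_gt_1] by blast
  have "L \<le> real (len n a)" if "n \<ge> N" for n a
  proof -
    have "L < \<alpha> * r ^ N" using N ab(1) by (simp add: pos_divide_less_eq mult.commute)
    also have "\<dots> \<le> real (len N a)" by (rule len_ge)
    also have "\<dots> \<le> real (len n a)" using len_mono[OF that] by simp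
    finally show ?thesis by simp
  qed
  then show ?thesis by blast
qed

context
  fixes f :: "(int \<Rightarrow> 'a) \<Rightarrow> real" and K :: nat and B :: real
  assumes local: "local_function K f" and bounded: "\<And>w. \<bar>f w\<bar> \<le> B"
begin

text \<open>With \<open>\<phi>\<^sub>n(a) = F(\<rho>\<^sup>n(a)) / r\<^sup>n\<close>, where \<open>F\<close> sums \<open>f\<close> over the positions of a word, the
  functions \<open>\<phi>\<^bsub>n+k\<^esub>\<close> and \<open>T\<^sup>n \<phi>\<^sub>k\<close> differ only through the boundaries of the words
  \<open>\<rho>\<^sup>k(b)\<close>, hence by \<open>O(r\<^bsup>-k\<^esup>)\<close>. So \<open>\<phi>\<^sub>n\<close> converges, and its limit is fixed by \<open>T\<close>.\<close>

lemma occurrence_sum_asymptotics: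
  "\<exists>c. \<forall>e>0. \<exists>N. \<forall>n\<ge>N. \<forall>a. \<bar>occurrence_sum f (subst_power \<rho> n a) - c * real (len n a)\<bar> \<le> e * real (len n a)"
proof -
  define F where "F = occurrence_sum f"
  define D where "D = 4 * B * real K"
  have B0: "0 \<le> B" using bounded[of undefined] by linarith
  have D0: "0 \<le> D" using B0 by (simp add: D_def)
  have F_concat: "\<bar>F (concat ws) - (\<Sum>w\<leftarrow>ws. F w)\<bar> \<le> D * real (length ws)" for ws
    unfolding F_def D_def by (rule occurrence_sum_concat[OF local bounded])
  have contF: "continuous_on UNIV (\<lambda>a. F (subst_power \<rho> n a))" for n
  proof -
    have "continuous_map word_topology euclidean F"
      unfolding F_def using local by (intro continuous_map_occurrence_sum) (simp add: local_function_def)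
    from continuous_map_compose[OF continuous_map_subst_power[OF continuous_rho] this]
    show ?thesis by (simp add: comp_def)
  qed
  have "\<exists>g. \<forall>a. apply_bcontfun g a = F (subst_power \<rho> n a) / r ^ n" for n
  proof -
    have cont: "continuous_on UNIV (\<lambda>a. F (subst_power \<rho> n a) / r ^ n)"
      using r_pos by (intro continuous_on_divide contF continuous_on_const) simp
    have "(\<lambda>a. F (subst_power \<rho> n a) / r ^ n) \<in> bcontfun"
      using cont compact_imp_bounded[OF compact_continuous_image[OF cont compact_space]]
      by (simp add: bcontfun_def)
    then obtain g where "(\<lambda>a. F (subst_power \<rho> n a) / r ^ n) = apply_bcontfun g"
      by (rule bcontfunE)
    then show ?thesis by metis
  qed
  then obtain \<phi> where \<phi>: "\<And>n a. apply_bcontfun (\<phi> n) a = F (subst_power \<rho> n a) / r ^ n"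
    by metis
  define E where "E = D * \<beta>"
  \<comment> \<open>There are \<open>len n a\<close> blocks, at most \<open>\<beta> * r ^ n\<close>,
    and each costs one seam \<open>D\<close>; dividing by \<open>r ^ (k + n)\<close> leaves
    \<open>E / r ^ k\<close>.\<close>
  have step: "norm (\<phi> (k + n) - op_power T n (\<phi> k)) \<le> E / r ^ k" for n k
  proof (rule norm_bcontfun_leI)
    fix a
    define ws where "ws = map (subst_power \<rho> k) (subst_power \<rho> n a)"
    have "apply_bcontfun (\<phi> (k + n) - op_power T n (\<phi> k)) a = (F (concat ws) - (\<Sum>w\<leftarrow>ws. F w)) / (r ^ k * r ^ n)"
      using r_pos by (simp add: \<phi> T_apply subst_power_add ws_def comp_def power_add diff_divide_distrib
          divide_inverse sum_list_mult_const mult.assoc left_diff_distrib)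
    then have "\<bar>apply_bcontfun (\<phi> (k + n) - op_power T n (\<phi> k)) a\<bar> = \<bar>F (concat ws) - (\<Sum>w\<leftarrow>ws. F w)\<bar> / (r ^ k * r ^ n)"
      using r_pos by simp
    also have "\<dots> \<le> D * (\<beta> * r ^ n) / (r ^ k * r ^ n)"
      using r_pos order_trans[OF F_concat[of ws] mult_left_mono[OF _ D0, of "real (length ws)" "\<beta> * r ^ n"]] len_le[of n a]
      by (intro divide_right_mono) (simp_all add: ws_def)
    also have "\<dots> = E / r ^ k" using r_pos by (simp add: E_def)
    finally show "\<bar>apply_bcontfun (\<phi> (k + n) - op_power T n (\<phi> k)) a\<bar> \<le> E / r ^ k" .
  qed
  have E_small: "\<exists>k. \<forall>j\<ge>k. E / r ^ j < e" if e: "0 < e" for e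
  proof -
    obtain k where k: "E / e < r ^ k" using real_arch_pow[OF growth_rate_gt_1] by blast
    have "E / r ^ j < e" if "j \<ge> k" for j
    proof -
      have "E / e < r ^ j" using k power_increasing[OF that r_ge_1] by linarith
      then show ?thesis using e r_pos by (simp add: field_simps)
    qed
    then show ?thesis by blast
  qed
  have "Cauchy \<phi>"
    unfolding Cauchy_def
  proof (intro allI impI)
    fix e :: real assume e: "0 < e"
    then obtain k where k: "E / r ^ k < e / 3" using E_small[of "e / 3"] by auto
    obtain d where "(\<lambda>n. op_power T n (\<phi> k)) \<longlonglongrightarrow> d *\<^sub>R l" using conv by blast
    then have "Cauchy (\<lambda>n. op_power T n (\<phi> k))" by (rule LIMSEQ_imp_Cauchy)
    moreover have "0 < e / 3" using e by simp
    ultimately obtain N where N: "\<And>m n. m \<ge> N \<Longrightarrow> n \<ge> N \<Longrightarrow> dist (op_power T m (\<phi> k)) (op_power T n (\<phi> k)) < e / 3"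
      unfolding Cauchy_def by blast
    show "\<exists>M. \<forall>m\<ge>M. \<forall>n\<ge>M. dist (\<phi> m) (\<phi> n) < e"
    proof (intro exI[of _ "k + N"] allI impI)
      fix m n assume mn: "m \<ge> k + N" "n \<ge> k + N"
      then have "dist (op_power T (m - k) (\<phi> k)) (op_power T (n - k) (\<phi> k)) < e / 3"
        by (intro N) auto
      moreover have "dist (\<phi> m) (op_power T (m - k) (\<phi> k)) < e / 3" "dist (\<phi> n) (op_power T (n - k) (\<phi> k)) < e / 3"
        using le_less_trans[OF step[of k "m - k"] k] le_less_trans[OF step[of k "n - k"] k] mn
        by (simp_all add: dist_norm)
      ultimately show "dist (\<phi> m) (\<phi> n) < e"
        using dist_triangle[of "\<phi> m" "\<phi> n" "op_power T (m - k) (\<phi> k)"]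
          dist_triangle[of "op_power T (m - k) (\<phi> k)" "\<phi> n" "op_power T (n - k) (\<phi> k)"]
        by (simp add: dist_commute)
    qed
  qed
  then obtain \<psi> where \<psi>: "\<phi> \<longlonglongrightarrow> \<psi>"
    using Cauchy_convergent convergent_def by blast
  have T\<psi>: "T \<psi> = \<psi>"
  proof -
    have "(\<lambda>k. \<phi> (Suc k) - T (\<phi> k)) \<longlonglongrightarrow> \<psi> - T \<psi>"
      by (intro tendsto_diff LIMSEQ_Suc \<psi> bounded_linear.tendsto[OF blinfun.bounded_linear_right])
    moreover have "(\<lambda>k. \<phi> (Suc k) - T (\<phi> k)) \<longlonglongrightarrow> 0"
      unfolding LIMSEQ_iff
    proof (intro allI impI)
      fix e :: real assume "0 < e"
      then obtain k where k: "\<And>j. j \<ge> k \<Longrightarrow> E / r ^ j < e" using E_small by blast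
      show "\<exists>N. \<forall>n\<ge>N. norm (\<phi> (Suc n) - T (\<phi> n) - 0) < e"
        using le_less_trans[OF step[of _ 1] k] by (intro exI[of _ k]) simp
    qed
    ultimately have "\<psi> - T \<psi> = 0" by (rule LIMSEQ_unique)
    then show ?thesis by simp
  qed
  obtain c0 where "(\<lambda>n. op_power T n \<psi>) \<longlonglongrightarrow> c0 *\<^sub>R l" using conv by blast
  moreover have "op_power T n \<psi> = \<psi>" for n
    using T.op_power_eigenvector[of \<psi> 1] T\<psi> by simp
  ultimately have \<psi>l: "\<psi> = c0 *\<^sub>R l"
    by (simp add: LIMSEQ_const_iff)
  obtain c1 where c1: "(\<lambda>n. op_power T n one_bcontfun) \<longlonglongrightarrow> c1 *\<^sub>R l" using conv by blast
  \<comment> \<open>The lower length bound keeps the limit of the normalised lengths away from 0;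
    any letter would do in place of \<open>undefined\<close>.\<close>
  have "\<alpha> \<le> apply_bcontfun (c1 *\<^sub>R l) undefined"
  proof (rule LIMSEQ_le_const[OF apply_bcontfun_limit[OF c1]])
    show "\<exists>N. \<forall>n\<ge>N. \<alpha> \<le> apply_bcontfun (op_power T n one_bcontfun) undefined"
      using len_ge r_pos by (simp add: T_one pos_le_divide_eq)
  qed
  then have "c1 \<noteq> 0" using ab(1) by auto
  \<comment> \<open>Normalised sums and normalised lengths tend to multiples of the same
    \<open>l\<close>, so their quotient tends to a constant independent of the letter.\<close>
  define c where "c = c0 / c1"
  have "(\<lambda>n. \<phi> n - c *\<^sub>R op_power T n one_bcontfun) \<longlonglongrightarrow> \<psi> - c *\<^sub>R (c1 *\<^sub>R l)"
    by (intro tendsto_diff tendsto_scaleR tendsto_const \<psi> c1)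
  then have lim: "(\<lambda>n. \<phi> n - c *\<^sub>R op_power T n one_bcontfun) \<longlonglongrightarrow> 0"
    using \<open>c1 \<noteq> 0\<close> by (simp add: \<psi>l c_def)
  have "\<exists>N. \<forall>n\<ge>N. \<forall>a. \<bar>F (subst_power \<rho> n a) - c * real (len n a)\<bar> \<le> e * real (len n a)" if e: "0 < e" for e
  proof -
    have "0 < e * \<alpha>" using e ab(1) by simp
    then obtain N where N: "\<And>n. n \<ge> N \<Longrightarrow> norm (\<phi> n - c *\<^sub>R op_power T n one_bcontfun) < e * \<alpha>"
      using lim unfolding LIMSEQ_iff by auto
    have "\<bar>F (subst_power \<rho> n a) - c * real (len n a)\<bar> \<le> e * real (len n a)" if "n \<ge> N" for n a
    proof -
      have "apply_bcontfun (\<phi> n - c *\<^sub>R op_power T n one_bcontfun) a = (F (subst_power \<rho> n a) - c * real (len n a)) / r ^ n"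
        by (simp add: \<phi> T_one diff_divide_distrib)
      then have "\<bar>F (subst_power \<rho> n a) - c * real (len n a)\<bar> / r ^ n \<le> e * \<alpha>"
        using abs_apply_bcontfun_le[of "\<phi> n - c *\<^sub>R op_power T n one_bcontfun" a] N[OF that] r_pos by simp
      then have "\<bar>F (subst_power \<rho> n a) - c * real (len n a)\<bar> \<le> e * (\<alpha> * r ^ n)"
        using r_pos by (simp add: pos_divide_le_eq mult.assoc)
      also have "\<dots> \<le> e * real (len n a)"
        using len_ge e by (intro mult_left_mono) auto
      finally show ?thesis .
    qed
    then show ?thesis by blast
  qed
  then show ?thesis unfolding F_def by blast
qed

text \<open>Fix a level \<open>n\<close> so high that a seam costs at most a small fraction of a
  block, and cut a word into blocks of this level and two end pieces. Errors not proportional to the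
  length go into \<open>C\<close>. The resulting inequality is a closed condition, so it passes to
  the closure that defines the language.\<close>

lemma occurrence_sum_language:
  "\<exists>c. \<forall>e>0. \<exists>C. \<forall>u\<in>language \<rho>. \<bar>occurrence_sum f u - c * real (length u)\<bar> \<le> e * real (length u) + C"
proof -
  define F where "F = occurrence_sum f"
  define D where "D = 4 * B * real K"
  have B0: "0 \<le> B" using bounded[of undefined] by linarith
  have D0: "0 \<le> D" using B0 by (simp add: D_def)
  have F_concat: "\<bar>F (concat ws) - (\<Sum>w\<leftarrow>ws. F w)\<bar> \<le> D * real (length ws)" for ws
    unfolding F_def D_def by (rule occurrence_sum_concat[OF local bounded])
  have F_append: "\<bar>F (u @ v) - F u - F v\<bar> \<le> D" for u v
    unfolding F_def D_def by (rule occurrence_sum_append[OF local bounded])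
  have F_le: "\<bar>F u\<bar> \<le> B * real (length u)" for u
    unfolding F_def by (rule occurrence_sum_bound[OF local bounded])
  obtain c where c: "\<And>e. 0 < e \<Longrightarrow> \<exists>N. \<forall>n\<ge>N. \<forall>a. \<bar>F (subst_power \<rho> n a) - c * real (len n a)\<bar> \<le> e * real (len n a)"
    using occurrence_sum_asymptotics unfolding F_def by blast
  have short: "\<bar>F u - c * real (length u)\<bar> \<le> (B + \<bar>c\<bar>) * real (length u)" for u
    using F_le[of u] abs_triangle_ineq4[of "F u" "c * real (length u)"] by (simp add: abs_mult distrib_right)
  have "\<exists>C. \<forall>u\<in>language \<rho>. \<bar>F u - c * real (length u)\<bar> \<le> e * real (length u) + C" if e: "0 < e" for e
  proof -
    \<comment> \<open>One half of \<open>e\<close> pays for the deviation inside the blocks, the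
      other for the seams between them.\<close>
    define d where "d = e / 2"
    have d: "0 < d" using e by (simp add: d_def)
    obtain N1 where N1: "\<And>n a. n \<ge> N1 \<Longrightarrow> \<bar>F (subst_power \<rho> n a) - c * real (len n a)\<bar> \<le> d * real (len n a)"
      using c[OF d] by blast
    obtain N2 where N2: "\<And>n a. n \<ge> N2 \<Longrightarrow> D / d \<le> real (len n a)"
      using len_eventually_ge by blast
    define n where "n = max N1 N2"
    define H where "H = Max (range (len n))"
    have H: "len n a \<le> H" for a unfolding H_def by (rule Max_len_ge)
    define G where "G = (B + \<bar>c\<bar>) * real H"
    have short_H: "\<bar>F u - c * real (length u)\<bar> \<le> G" if "length u \<le> H" for u
    proof -
      have "(B + \<bar>c\<bar>) * real (length u) \<le> G"
        unfolding G_def using that B0 by (intro mult_left_mono) auto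
      with short[of u] show ?thesis by linarith
    qed
    have G0: "0 \<le> G" using B0 by (simp add: G_def)
    \<comment> \<open>Two seams \<open>D\<close> attach the end pieces, and each end piece itself
      deviates by at most \<open>G\<close>.\<close>
    define C where "C = 2 * D + 2 * G"
    have block: "\<bar>F (concat ws) - c * real (length (concat ws))\<bar> \<le> e * real (length (concat ws))"
      if "set ws \<subseteq> range (subst_power \<rho> n)" for ws
    proof -
      have w: "D \<le> d * real (length w)" "\<bar>F w - c * real (length w)\<bar> \<le> d * real (length w)" if w: "w \<in> set ws" for w
      proof -
        obtain a where "w = subst_power \<rho> n a" using w \<open>set ws \<subseteq> _\<close> by blast
        then show "D \<le> d * real (length w)" "\<bar>F w - c * real (length w)\<bar> \<le> d * real (length w)"
          using N1[of n a] N2[of n a] d by (simp_all add: n_def pos_divide_le_eq mult.commute)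
      qed
      have "\<bar>(\<Sum>w\<leftarrow>ws. F w) - c * real (length (concat ws))\<bar> + D * real (length ws) \<le> e * real (length (concat ws))"
        using w
      proof (induction ws)
        case (Cons w ws)
        have "\<bar>(\<Sum>w\<leftarrow>ws. F w) - c * real (length (concat ws))\<bar> + D * real (length ws) \<le> e * real (length (concat ws))"
          using Cons by simp
        moreover have "D \<le> d * real (length w)" "\<bar>F w - c * real (length w)\<bar> \<le> d * real (length w)"
          using Cons.prems by simp_all
        moreover have "(\<Sum>w\<leftarrow>w # ws. F w) = F w + (\<Sum>w\<leftarrow>ws. F w)"
          "c * real (length (concat (w # ws))) = c * real (length w) + c * real (length (concat ws))"
          "e * real (length (concat (w # ws))) = d * real (length w) + d * real (length w) + e * real (length (concat ws))"
          "D * real (length (w # ws)) = D + D * real (length ws)"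
          by (simp_all add: distrib_left d_def)
        ultimately show ?case by linarith
      qed simp
      with F_concat[of ws] show ?thesis by linarith
    qed
    have sub: "\<bar>F u - c * real (length u)\<bar> \<le> e * real (length u) + C" if u: "sublist u (subst_power \<rho> m a)" for u m a
    proof (cases "n \<le> m")
      case True
      have "subst_power \<rho> m a = concat (map (subst_power \<rho> n) (subst_power \<rho> (m - n) a))"
        using subst_power_add[of \<rho> n "m - n" a] True by simp
      then have "sublist u (concat (map (subst_power \<rho> n) (subst_power \<rho> (m - n) a)))"
        using u by simp
      moreover have "length w \<le> H" if "w \<in> set (map (subst_power \<rho> n) (subst_power \<rho> (m - n) a))" for w
        using that H by auto
      ultimately obtain s ws t where st: "u = s @ concat ws @ t" "length s \<le> H" "length t \<le> H"
        "set ws \<subseteq> set (map (subst_power \<rho> n) (subst_power \<rho> (m - n) a))"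
        using sublist_concat_decomposition[of u "map (subst_power \<rho> n) (subst_power \<rho> (m - n) a)" H] by blast
      then have ws: "set ws \<subseteq> range (subst_power \<rho> n)" by auto
      have split: "c * real (length u) = c * real (length s) + c * real (length (concat ws)) + c * real (length t)"
        by (simp add: st(1) distrib_left)
      have mid: "e * real (length (concat ws)) \<le> e * real (length u)"
        using e by (intro mult_left_mono) (simp_all add: st(1))
      show ?thesis
        using F_append[of s "concat ws @ t"] F_append[of "concat ws" t] short_H[OF st(2)] short_H[OF st(3)]
          block[OF ws] split mid
        unfolding C_def st(1)[symmetric] by linarith
    next
      case False
      \<comment> \<open>Below level \<open>n\<close> no word exceeds \<open>H\<close>, because
        lengths do not decrease along iterates.\<close>
      then have "length u \<le> H"
        using sublist_length_le[OF u] len_mono[of m n a] H[of a] by simp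
      from short_H[OF this] e D0 G0 show ?thesis
        by (simp add: C_def add_increasing)
    qed
    have "continuous_map word_topology euclidean F"
      unfolding F_def using local by (intro continuous_map_occurrence_sum) (simp add: local_function_def)
    moreover have "continuous_map word_topology euclidean (\<lambda>u :: 'a list. real (length u))"
      using continuous_map_sum_letters[of "\<lambda>_ :: 'a. 1"] by (simp add: sum_list_triv)
    ultimately have "continuous_map word_topology euclidean
        (\<lambda>u. \<bar>F u - c * real (length u)\<bar> - e * real (length u))"
      by (intro continuous_map_diff continuous_map_real_abs continuous_map_real_mult continuous_map_const[THEN iffD2]) auto
    from closedin_continuous_map_preimage[OF this, of "{..C}"]
    have "closedin word_topology {u. \<bar>F u - c * real (length u)\<bar> \<le> e * real (length u) + C}"
      by (simp add: algebra_simps)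
    then have "language \<rho> \<subseteq> {u. \<bar>F u - c * real (length u)\<bar> \<le> e * real (length u) + C}"
      unfolding language_def using sub by (intro closure_of_minimal) auto
    then show ?thesis by blast
  qed
  then show ?thesis unfolding F_def by blast
qed

text \<open>Windows of points of the subshift lie in the language, so the estimate there applies
  uniformly; dividing by \<open>n\<close> removes the constant error.\<close>

lemma local_averages_converge:
  "\<exists>c. \<forall>e>0. \<exists>N. \<forall>n\<ge>N. \<forall>x\<in>subshift \<rho>. \<bar>birkhoff_average f n x - c\<bar> \<le> e"
proof -
  obtain c where c: "\<And>e. 0 < e \<Longrightarrow> \<exists>C. \<forall>u\<in>language \<rho>. \<bar>occurrence_sum f u - c * real (length u)\<bar> \<le> e * real (length u) + C"
    using occurrence_sum_language by blast
  have "\<exists>N. \<forall>n\<ge>N. \<forall>x\<in>subshift \<rho>. \<bar>birkhoff_average f n x - c\<bar> \<le> e" if e: "0 < e" for e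
  proof -
    obtain C where C: "\<And>u. u \<in> language \<rho> \<Longrightarrow> \<bar>occurrence_sum f u - c * real (length u)\<bar> \<le> e / 2 * real (length u) + C"
      using c[of "e / 2"] e by auto
    define D where "D = C + 4 * B * real K"
    obtain N where N: "2 * D / e \<le> real N" using real_arch_simple by blast
    have "\<bar>birkhoff_average f n x - c\<bar> \<le> e" if n: "n \<ge> Suc N" and x: "x \<in> subshift \<rho>" for n x
    proof -
      have "window 0 n x \<in> language \<rho>" using x by (simp only: subshift_def mem_Collect_eq)
      from C[OF this] have "\<bar>occurrence_sum f (window 0 n x) - c * real n\<bar> \<le> e / 2 * real n + C"
        by simp
      then have "\<bar>(\<Sum>j<n. f ((left_shift ^^ j) x)) - c * real n\<bar> \<le> e / 2 * real n + D"
        using birkhoff_sum_window[OF local bounded, where n = n and x = x] unfolding D_def by linarith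
      also have "D \<le> e / 2 * real n"
        using N n e by (simp add: field_simps) (smt (verit) mult_left_mono of_nat_le_iff Suc_leD)
      finally have "\<bar>(\<Sum>j<n. f ((left_shift ^^ j) x)) - c * real n\<bar> \<le> e * real n" by simp
      moreover have "birkhoff_average f n x - c = ((\<Sum>j<n. f ((left_shift ^^ j) x)) - c * real n) / real n"
        using n by (simp add: birkhoff_average_def diff_divide_distrib)
      ultimately show ?thesis
        using n by (simp add: pos_divide_le_eq)
    qed
    then show ?thesis by blast
  qed
  then show ?thesis by blast
qed

end

lemma subshift_uniquely_ergodic: "uniquely_ergodic (subshift \<rho>)"
proof -
  have "\<exists>n a. L \<le> len n a" for L
    using len_eventually_ge[of "real L"] by auto
  then obtain x0 where x0: "x0 \<in> subshift \<rho>"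
    using subshift_nonempty by blast
  have "\<exists>c. \<forall>e>0. \<exists>N. \<forall>n\<ge>N. \<forall>x\<in>subshift \<rho>. \<bar>birkhoff_average f n x - c\<bar> \<le> e"
    if f: "continuous_on (subshift \<rho>) f" for f
  proof (rule uniform_limit_if_nearly_constant[OF x0])
    fix e :: real assume e: "0 < e"
    obtain K g where g: "local_function K g" "\<And>x. x \<in> subshift \<rho> \<Longrightarrow> \<bar>f x - g x\<bar> < e / 2"
      using local_function_dense[OF compact_space closed_subshift f, of "e / 2"] e by auto
    have "continuous_on UNIV g" using g(1) by (simp add: local_function_def)
    then have "bounded (range g)"
      using compact_imp_bounded compact_continuous_image[OF _ compact_UNIV_fun[OF compact_space]] by blast
    then obtain B where B: "\<And>w. \<bar>g w\<bar> \<le> B"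
      unfolding bounded_iff by auto
    obtain c where c: "\<forall>e>0. \<exists>N. \<forall>n\<ge>N. \<forall>x\<in>subshift \<rho>. \<bar>birkhoff_average g n x - c\<bar> \<le> e"
      using local_averages_converge[OF g(1) B] by blast
    obtain N where N: "\<And>n x. n \<ge> N \<Longrightarrow> x \<in> subshift \<rho> \<Longrightarrow> \<bar>birkhoff_average g n x - c\<bar> \<le> e / 2"
      using c[rule_format, of "e / 2"] e by auto
    have "\<bar>birkhoff_average f n x - c\<bar> \<le> e" if "n \<ge> N" "x \<in> subshift \<rho>" for n x
    proof -
      have "\<bar>birkhoff_average f n x - birkhoff_average g n x\<bar> \<le> e / 2"
        using e g(2)[OF left_shift_funpow_subshift[OF that(2)]] by (intro birkhoff_average_diff_le) (simp_all add: less_imp_le)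
      with N[OF that] show ?thesis by linarith
    qed
    then show "\<exists>c N. \<forall>n\<ge>N. \<forall>x\<in>subshift \<rho>. \<bar>birkhoff_average f n x - c\<bar> \<le> e" by blast
  qed
  then show ?thesis
    by (rule uniquely_ergodic_if_uniform_averages[OF compact_space x0])
qed

end

lemma quasi_compact_imp_uniquely_ergodic:
  assumes "quasi_compact T"
    and bounds: "0 < \<alpha>" "0 < \<beta>" "\<And>n a. n \<ge> 1 \<Longrightarrow> \<alpha> * r ^ n \<le> real (len n a)"
      "\<And>n a. n \<ge> 1 \<Longrightarrow> real (len n a) \<le> \<beta> * r ^ n"
  shows "uniquely_ergodic (subshift \<rho>)"
proof -
  obtain m where "ess_norm (op_power T m) < 1"
    using assms(1) unfolding quasi_compact_T_iff by blast
  from T.quasi_compact_strong_convergence[OF growth_T norm_T_ge_1 this]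
  obtain l where l: "\<And>a. 0 < apply_bcontfun l a" "T l = l"
    "\<And>f. \<exists>c. (\<lambda>n. op_power T n f) \<longlonglongrightarrow> c *\<^sub>R l" by blast
  show ?thesis
  proof (rule subshift_uniquely_ergodic[OF l])
    \<comment> \<open>Level 0, where every length is 1, is included by passing to
      \<open>min \<alpha> 1\<close> and \<open>max \<beta> 1\<close>.\<close>
    show "0 < min \<alpha> 1" "0 < max \<beta> 1" using bounds by auto
    show "min \<alpha> 1 * r ^ n \<le> real (len n a)" for n a
    proof (cases "n = 0")
      case False
      have "min \<alpha> 1 * r ^ n \<le> \<alpha> * r ^ n" using r_pos by (intro mult_right_mono) auto
      with bounds(3)[of n a] False show ?thesis by simp
    qed simp
    show "real (len n a) \<le> max \<beta> 1 * r ^ n" for n a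
    proof (cases "n = 0")
      case False
      have "\<beta> * r ^ n \<le> max \<beta> 1 * r ^ n" using r_pos by (intro mult_right_mono) auto
      with bounds(4)[of n a] False show ?thesis by simp
    qed simp
  qed
qed

end

section \<open>The equivalences\<close>

lemma cesaro_limit:
  fixes x :: "nat \<Rightarrow> 'e::real_normed_vector"
  assumes "x \<longlonglongrightarrow> L"
  shows "(\<lambda>n. (1 / real n) *\<^sub>R (\<Sum>j<n. x j)) \<longlonglongrightarrow> L"
  unfolding LIMSEQ_iff
proof (intro allI impI)
  fix e :: real assume e: "0 < e"
  then obtain N where N: "\<And>j. j \<ge> N \<Longrightarrow> norm (x j - L) < e / 2"
    using assms[unfolded LIMSEQ_iff, rule_format, of "e / 2"] by auto
  define S where "S = (\<Sum>j<N. norm (x j - L))"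
  obtain M where M: "2 * S / e < real M" using reals_Archimedean2 by blast
  have "norm ((1 / real n) *\<^sub>R (\<Sum>j<n. x j) - L) < e" if n: "n \<ge> max (Suc N) M" for n
  proof -
    have n0: "0 < real n" using n by simp
    have "(1 / real n) *\<^sub>R (\<Sum>j<n. x j) - L = (1 / real n) *\<^sub>R (\<Sum>j<n. x j - L)"
      using n0 by (simp add: sum_subtractf scaleR_diff_right sum_constant_scaleR)
    then have "norm ((1 / real n) *\<^sub>R (\<Sum>j<n. x j) - L) = norm (\<Sum>j<n. x j - L) / real n"
      by simp
    also have "norm (\<Sum>j<n. x j - L) \<le> (\<Sum>j<n. norm (x j - L))"
      by (rule norm_sum)
    also have "\<dots> = S + (\<Sum>j\<in>{N..<n}. norm (x j - L))"
      unfolding S_def lessThan_atLeast0 using n by (intro sum.atLeastLessThan_concat[symmetric]) auto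
    also have "(\<Sum>j\<in>{N..<n}. norm (x j - L)) \<le> real (card {N..<n}) * (e / 2)"
      using N by (intro sum_bounded_above) (auto intro: less_imp_le)
    also have "\<dots> \<le> real n * (e / 2)"
      using e by (intro mult_right_mono) auto
    finally have "norm ((1 / real n) *\<^sub>R (\<Sum>j<n. x j) - L) \<le> (S + real n * (e / 2)) / real n"
      using n0 by (simp add: divide_right_mono)
    also have "S < real n * (e / 2)"
    proof -
      have "2 * S / e < real n" using M n by linarith
      then show ?thesis using e by (simp add: field_simps)
    qed
    then have "(S + real n * (e / 2)) / real n < e"
      using n0 by (simp add: field_simps)
    finally show ?thesis .
  qed
  then show "\<exists>N. \<forall>n\<ge>N. norm ((1 / real n) *\<^sub>R (\<Sum>j<n. x j) - L) < e" by blast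
qed

lemma uniformly_imp_strongly_power_convergent:
  "uniformly_power_convergent S \<Longrightarrow> strongly_power_convergent S"
  unfolding uniformly_power_convergent_def strongly_power_convergent_def convergent_def
  using blinfun.tendsto[OF _ tendsto_const] by blast

lemma strongly_power_convergent_imp_mean_ergodic:
  "strongly_power_convergent S \<Longrightarrow> mean_ergodic S"
  unfolding strongly_power_convergent_def mean_ergodic_def convergent_def
  using cesaro_limit by blast

theorem theorem1p2:
  fixes \<rho> :: "'a::t2_space \<Rightarrow> 'a list"
  assumes "compact (UNIV :: 'a set)"
    and "substitution \<rho>"
    and "primitive \<rho>"
  shows
    "let r = spectral_radius (subst_operator \<rho>);
         T = normalised_operator \<rho>;
         C1 = quasi_compact T;
         C2 = uniformly_power_convergent T;
         C3 = strongly_power_convergent T;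
         C4 = mean_ergodic T;
         C5 = (\<exists>l. natural_length_function \<rho> l);
         C6 = (\<exists>\<alpha>>0. \<exists>\<beta>>0. \<forall>n\<ge>1. \<forall>a.
                 \<alpha> * r ^ n \<le> real (length (subst_power \<rho> n a)) \<and>
                 real (length (subst_power \<rho> n a)) \<le> \<beta> * r ^ n);
         C7 = ((INF n\<in>{1::nat..}. real (Min (range (\<lambda>a. length (subst_power \<rho> n a)))) /
                                  real (Max (range (\<lambda>b. length (subst_power \<rho> n b))))) > 0)
     in (C1 \<longrightarrow> C2) \<and> (C2 \<longrightarrow> C3) \<and> (C3 \<longrightarrow> C4) \<and> (C4 \<longrightarrow> C5) \<and> (C5 \<longrightarrow> C6) \<and> (C6 \<longrightarrow> C7) \<and>
        ((\<exists>p::'a. p isolated_in UNIV) \<or> (\<exists>p. \<exists>n\<ge>1. \<forall>a. p \<in> set (subst_power \<rho> n a)) \<longrightarrow>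
           (C7 \<longrightarrow> C1) \<and>
           (C1 \<longleftrightarrow> C2) \<and> (C2 \<longleftrightarrow> C3) \<and> (C3 \<longleftrightarrow> C4) \<and> (C4 \<longleftrightarrow> C5) \<and> (C5 \<longleftrightarrow> C6) \<and> (C6 \<longleftrightarrow> C7) \<and>
           (C1 \<or> C2 \<or> C3 \<or> C4 \<or> C5 \<or> C6 \<or> C7 \<longrightarrow> uniquely_ergodic (subshift \<rho>)))"
proof -
  interpret primitive_substitution \<rho>
    using assms by unfold_locales
  define C1 where "C1 \<longleftrightarrow> quasi_compact T"
  define C2 where "C2 \<longleftrightarrow> uniformly_power_convergent T"
  define C3 where "C3 \<longleftrightarrow> strongly_power_convergent T"
  define C4 where "C4 \<longleftrightarrow> mean_ergodic T"
  define C5 where "C5 \<longleftrightarrow> (\<exists>l. natural_length_function \<rho> l)"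
  define C6 where "C6 \<longleftrightarrow> (\<exists>\<alpha>>0. \<exists>\<beta>>0. \<forall>n\<ge>1. \<forall>a.
    \<alpha> * r ^ n \<le> real (len n a) \<and> real (len n a) \<le> \<beta> * r ^ n)"
  define C7 where "C7 \<longleftrightarrow> (INF n\<in>{1::nat..}. real (Min (range (\<lambda>a. len n a))) /
    real (Max (range (\<lambda>b. len n b)))) > 0"
  define P where "P \<longleftrightarrow> (\<exists>p::'a. p isolated_in UNIV) \<or> (\<exists>p. \<exists>n\<ge>1. \<forall>a. p \<in> set (subst_power \<rho> n a))"
  have "C1 \<longrightarrow> C2"
    unfolding C1_def C2_def using quasi_compact_T_imp_uniformly_power_convergent by blast
  moreover have "C2 \<longrightarrow> C3"
    unfolding C2_def C3_def using uniformly_imp_strongly_power_convergent by blast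
  moreover have "C3 \<longrightarrow> C4"
    unfolding C3_def C4_def using strongly_power_convergent_imp_mean_ergodic by blast
  moreover have "C4 \<longrightarrow> C5"
    unfolding C4_def C5_def using mean_ergodic_T_imp_natural_length by blast
  moreover have "C5 \<longrightarrow> C6"
    unfolding C5_def C6_def using natural_length_imp_length_bounds by blast
  moreover have "C6 \<longrightarrow> C7"
    unfolding C6_def C7_def using length_bounds_imp_ratio by blast
  moreover have "C7 \<longrightarrow> C6"
    unfolding C6_def C7_def using ratio_imp_length_bounds by blast
  moreover have "C6 \<longrightarrow> C1 \<and> uniquely_ergodic (subshift \<rho>)" if P
  proof
    assume C6
    then obtain \<alpha> \<beta> where bounds: "0 < \<alpha>" "0 < \<beta>"
      "\<And>n a. n \<ge> 1 \<Longrightarrow> \<alpha> * r ^ n \<le> real (len n a)" "\<And>n a. n \<ge> 1 \<Longrightarrow> real (len n a) \<le> \<beta> * r ^ n"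
      unfolding C6_def by blast
    have "\<exists>p. \<exists>n\<ge>1. \<forall>a. p \<in> set (subst_power \<rho> n a)"
      using \<open>P\<close> unfolding P_def
    proof
      \<comment> \<open>An isolated point is an open singleton, so primitivity forces it into every
        word of some iterate.\<close>
      assume "\<exists>p::'a. p isolated_in UNIV"
      then obtain p :: 'a where "open {p}" by (auto simp: isolated_in_def)
      then show ?thesis using letters_of_nonempty_open[of "{p}"] by auto
    qed
    then obtain p N where pN: "N \<ge> 1" "\<And>a. p \<in> set (subst_power \<rho> N a)" by blast
    have qc: "quasi_compact T"
      by (rule length_bounds_common_letter_imp_quasi_compact[OF bounds pN])
    moreover have "uniquely_ergodic (subshift \<rho>)"
      by (rule quasi_compact_imp_uniquely_ergodic[OF qc bounds])
    ultimately show "C1 \<and> uniquely_ergodic (subshift \<rho>)" by (simp add: C1_def)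
  qed
  ultimately show ?thesis
    unfolding Let_def C1_def[symmetric] C2_def[symmetric] C3_def[symmetric] C4_def[symmetric]
      C5_def[symmetric] C6_def[symmetric] C7_def[symmetric] P_def[symmetric]
    by argo
qed


end
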